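(* (a) Let $Q$ be a partial isometry on a Hilbert space such that $\Delta_Q := \sqrt{1-QQ^*}$ has finite rank, and let $e_1,\dots,e_q$ be an orthonormal basis of $\operatorname{Range}(\Delta_Q)$. Then $$K(Q) = \sum_{k=1}^q \lim_{n\to\infty} \|Q^n e_k\|^2.$$ (b) For any contraction $T$ on a Hilbert space for which $\Delta_T := \sqrt{1-TT^*}$ has finite rank, $$K(T) = \lim_{n\to\infty} \operatorname{tr}\big({T^*}^n T^n (1-TT^* )\big).$$
   Context: For a contraction $T$ on a Hilbert space $H$, write $\Delta_T := \sqrt{1-TT^*}$. When $\Delta_T$ has finite rank, the curvature of $T$ is $$K(T) := \int_{|z|=1} \lim_{r\uparrow 1} (1-r^2)\, \operatorname{tr}\big(\Delta_T (1-rzT^* )^{-1}(1-r\bar z T)^{-1}\Delta_T\big)\, dz,$$ where $dz$ denotes normalized arc-length (Haar probability) measure on the unit circle; the limit exists for almost every $z$ and is bounded by $\operatorname{rank}\Delta_T$. *)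

theory Defs
  imports "HOL-Analysis.Analysis"
begin

class complex_vector = real_vector +
  fixes scaleC :: "complex \<Rightarrow> 'a \<Rightarrow> 'a"
  assumes scaleC_add_right: "scaleC a (x + y) = scaleC a x + scaleC a y"
    and scaleC_add_left: "scaleC (a + b) x = scaleC a x + scaleC b x"
    and scaleC_scaleC: "scaleC a (scaleC b x) = scaleC (a * b) x"
    and scaleC_one: "scaleC 1 x = x"
    and scaleR_scaleC: "scaleR r x = scaleC (complex_of_real r) x"

class complex_inner = complex_vector + real_normed_vector +
  fixes cinner :: "'a \<Rightarrow> 'a \<Rightarrow> complex"
  assumes cinner_commute: "cinner x y = cnj (cinner y x)"
    and cinner_add_right: "cinner x (y + z) = cinner x y + cinner x z"
    and cinner_scaleC_right: "cinner x (scaleC r y) = r * cinner x y"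
    and cinner_ge_zero: "Im (cinner x x) = 0 \<and> 0 \<le> Re (cinner x x)"
    and cinner_eq_zero_iff: "cinner x x = 0 \<longleftrightarrow> x = 0"
    and norm_eq_sqrt_cinner: "norm x = sqrt (Re (cinner x x))"

class chilbert_space = complex_inner + complete_space

definition bounded_clinear :: "('a::complex_inner \<Rightarrow> 'b::complex_inner) \<Rightarrow> bool" where
  "bounded_clinear f \<longleftrightarrow> bounded_linear f \<and> (\<forall>c x. f (scaleC c x) = scaleC c (f x))"

definition adj :: "('a::complex_inner \<Rightarrow> 'b::complex_inner) \<Rightarrow> ('b \<Rightarrow> 'a)" where
  "adj f = (THE g. \<forall>x y. cinner (f x) y = cinner x (g y))"

definition cspan :: "'a::complex_vector set \<Rightarrow> 'a set" where
  "cspan S = {y. \<exists>F c. finite F \<and> F \<subseteq> S \<and> y = (\<Sum>x\<in>F. scaleC (c x) x)}"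

definition finite_rank :: "('a::complex_inner \<Rightarrow> 'b::complex_inner) \<Rightarrow> bool" where
  "finite_rank A \<longleftrightarrow> (\<exists>F. finite F \<and> range A \<subseteq> cspan F)"

definition positive_op :: "('a::complex_inner \<Rightarrow> 'a) \<Rightarrow> bool" where
  "positive_op S \<longleftrightarrow> (\<forall>x. Im (cinner x (S x)) = 0 \<and> 0 \<le> Re (cinner x (S x)))"

definition op_sqrt :: "('a::complex_inner \<Rightarrow> 'a) \<Rightarrow> ('a \<Rightarrow> 'a)" where
  "op_sqrt A = (THE S. bounded_clinear S \<and> positive_op S \<and> S \<circ> S = A)"

definition defect :: "('a::complex_inner \<Rightarrow> 'a) \<Rightarrow> ('a \<Rightarrow> 'a)" where
  "defect T = op_sqrt (\<lambda>x. x - T (adj T x))"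

definition contraction :: "('a::complex_inner \<Rightarrow> 'a) \<Rightarrow> bool" where
  "contraction T \<longleftrightarrow> bounded_clinear T \<and> (\<forall>x. norm (T x) \<le> norm x)"

definition partial_isometry :: "('a::complex_inner \<Rightarrow> 'a) \<Rightarrow> bool" where
  "partial_isometry Q \<longleftrightarrow> bounded_clinear Q \<and>
     (\<forall>x. (\<forall>y. Q y = 0 \<longrightarrow> cinner y x = 0) \<longrightarrow> norm (Q x) = norm x)"

definition orthonormal :: "'a::complex_inner set \<Rightarrow> bool" where
  "orthonormal B \<longleftrightarrow> (\<forall>e\<in>B. norm e = 1) \<and> (\<forall>e\<in>B. \<forall>f\<in>B. e \<noteq> f \<longrightarrow> cinner e f = 0)"

definition is_onb :: "'a::complex_inner set \<Rightarrow> bool" where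
  "is_onb B \<longleftrightarrow> orthonormal B \<and> closure (cspan B) = UNIV"

text \<open>Trace, computed in a (fixed, chosen) orthonormal basis; for trace-class
  (in particular finite-rank) operators this is independent of the basis.\<close>
definition trace :: "('a::complex_inner \<Rightarrow> 'a) \<Rightarrow> complex" where
  "trace A = infsum (\<lambda>e. cinner e (A e)) (SOME B. is_onb B)"

definition op_inv :: "('a \<Rightarrow> 'a) \<Rightarrow> ('a \<Rightarrow> 'a)" where
  "op_inv A = (THE B. A \<circ> B = id \<and> B \<circ> A = id)"

text \<open>Curvature. The unit circle with normalized arc-length measure is parametrized
  by \<open>t \<mapsto> exp(2\<pi> i t)\<close>, \<open>t \<in> [0,1]\<close>, with Lebesgue measure.\<close>
definition curvature :: "('a::chilbert_space \<Rightarrow> 'a) \<Rightarrow> complex" where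
  "curvature T = set_lebesgue_integral lborel {0..1::real}
     (\<lambda>t. let z = exp (2 * of_real pi * \<i> * complex_of_real t) in
        Lim (at_left (1::real))
          (\<lambda>r. complex_of_real (1 - r\<^sup>2) *
             trace (defect T \<circ> op_inv (\<lambda>x. x - scaleC (complex_of_real r * z) (adj T x))
                      \<circ> op_inv (\<lambda>x. x - scaleC (complex_of_real r * cnj z) (T x)) \<circ> defect T)))"

end

theory Submission
  imports Defs
begin

text \<open>
  Write \<open>R\<^sub>w = (1 - w T)\<^sup>-\<^sup>1 = \<Sum> w\<^sup>n T\<^sup>n\<close> and \<open>\<Delta>\<close> for the defect operator. Expanding the trace in an
  orthonormal basis \<open>b\<close> of the range of \<open>\<Delta>\<close>, the integrand before the limit is the sum of the terms
  \<open>(1 - |w|\<^sup>2) \<parallel>R\<^sub>w \<Delta> b\<parallel>\<^sup>2\<close> at \<open>w\<close> the conjugate of \<open>r z\<close>. Each term is bounded by \<open>\<parallel>b\<parallel>\<^sup>2\<close>, and by Parseval its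
  circle average is \<open>(1 - r\<^sup>2) \<Sum> r\<^sup>2\<^sup>n \<parallel>T\<^sup>n \<Delta> b\<parallel>\<^sup>2\<close>, an Abel mean of a decreasing sequence, which tends to
  \<open>lim \<parallel>T\<^sup>n \<Delta> b\<parallel>\<^sup>2\<close>. So dominated convergence gives the result once the radial limits exist almost
  everywhere. With \<open>x = \<Delta> b\<close> and \<open>D = (1 - T\<^sup>* T)\<^sup>1\<^sup>/\<^sup>2\<close> one has
  \<open>(1 - |w|\<^sup>2) \<parallel>R\<^sub>w x\<parallel>\<^sup>2 = 2 Re \<langle>x, R\<^sub>w x\<rangle> - \<parallel>x\<parallel>\<^sup>2 - |w|\<^sup>2 \<parallel>D R\<^sub>w x\<parallel>\<^sup>2\<close>,
  and the power series of \<open>\<langle>x, R\<^sub>w x\<rangle>\<close> and \<open>D R\<^sub>w x\<close> have square summable coefficients by telescoping.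
  Fatou's theorem for such Hilbert space valued series follows from a weak type bound for the radial
  maximal function, obtained from the Poisson kernel and the Vitali covering lemma.
\<close>

subsection \<open>Complex inner product spaces\<close>

text \<open>The obstacle is that the vectors \<open>(T ^^ n) x\<close> need not be square summable,
  so the resolvent itself has no boundary values in general; only its weighted norm can be
  controlled. The two series that replace it are tame for different reasons. The coefficients for
  \<open>D\<close> record the norm lost under \<open>T\<close>. For the scalar series the factor
  \<Delta> in \<open>x = \<Delta> b\<close> is moved across the inner product, and what remains is
  bounded by the norm lost under \<open>adj T\<close>. Descriptions and choices in
  \<open>adj\<close>, \<open>op_sqrt\<close>, \<open>op_inv\<close> and \<open>trace\<close> say
  nothing until existence and uniqueness are known, hence Riesz, uniqueness of positive roots, the
  Neumann series and Parseval for arbitrary orthonormal bases. The two claims differ only in how the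
  sum of limits is read. For a partial isometry \<Delta> is a projection and fixes the given basis.
  For a general contraction, cyclicity of the trace identifies the trace at stage \<open>n\<close>
  with the sum of the squared norms of \<open>(T ^^ n) (\<Delta> b)\<close>.\<close>

lemma scaleC_zero_left [simp]: "scaleC 0 x = (0::'a::complex_vector)"
  using scaleR_scaleC[of 0 x] by simp

lemma scaleC_zero_right [simp]: "scaleC c 0 = (0::'a::complex_vector)"
  using scaleC_add_right[of c 0 0] by simp

lemma scaleC_minus_right: "scaleC c (- x) = - scaleC c (x::'a::complex_vector)"
  using scaleC_add_right[of c x "- x"] by (simp add: eq_neg_iff_add_eq_0 add.commute)

lemma scaleC_diff_right: "scaleC c (x - y) = scaleC c x - scaleC c (y::'a::complex_vector)"
  using scaleC_add_right[of c x "- y"] by (simp add: scaleC_minus_right)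

lemma scaleC_sum_right: "scaleC c (sum f A) = (\<Sum>i\<in>A. scaleC c (f i :: 'a::complex_vector))"
  by (induction A rule: infinite_finite_induct) (auto simp: scaleC_add_right)

lemma cinner_add_left: "cinner (x + y) z = cinner x z + cinner y (z::'a::complex_inner)"
  by (metis cinner_commute cinner_add_right complex_cnj_add)

lemma cinner_scaleC_left: "cinner (scaleC c x) y = cnj c * cinner x (y::'a::complex_inner)"
  by (metis cinner_commute cinner_scaleC_right complex_cnj_mult)

lemma cinner_zero_right [simp]: "cinner x 0 = (0::complex)"
  using cinner_add_right[of x 0 0] by simp

lemma cinner_zero_left [simp]: "cinner 0 x = (0::complex)"
  using cinner_add_left[of 0 0 x] by simp

lemma cinner_minus_right: "cinner x (- y) = - cinner x (y::'a::complex_inner)"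
  using cinner_add_right[of x y "- y"] by (simp add: eq_neg_iff_add_eq_0 add.commute)

lemma cinner_minus_left: "cinner (- x) y = - cinner x (y::'a::complex_inner)"
  using cinner_add_left[of x "- x" y] by (simp add: eq_neg_iff_add_eq_0 add.commute)

lemma cinner_diff_right: "cinner x (y - z) = cinner x y - cinner x (z::'a::complex_inner)"
  using cinner_add_right[of x y "- z"] by (simp add: cinner_minus_right)

lemma cinner_diff_left: "cinner (x - y) z = cinner x z - cinner y (z::'a::complex_inner)"
  using cinner_add_left[of x "- y" z] by (simp add: cinner_minus_left)

lemma cinner_sum_right: "cinner x (sum f A) = (\<Sum>i\<in>A. cinner x (f i :: 'a::complex_inner))"
  by (induction A rule: infinite_finite_induct) (auto simp: cinner_add_right)

lemma cinner_sum_left: "cinner (sum f A) x = (\<Sum>i\<in>A. cinner (f i :: 'a::complex_inner) x)"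
  by (induction A rule: infinite_finite_induct) (auto simp: cinner_add_left)

lemma cinner_scaleR_right: "cinner x (r *\<^sub>R y) = of_real r * cinner x (y::'a::complex_inner)"
  by (simp add: scaleR_scaleC cinner_scaleC_right)

lemma cinner_scaleR_left: "cinner (r *\<^sub>R x) y = of_real r * cinner x (y::'a::complex_inner)"
  by (simp add: scaleR_scaleC cinner_scaleC_left)

lemma cinner_self: "cinner x x = of_real ((norm (x::'a::complex_inner))\<^sup>2)"
  using cinner_ge_zero[of x] by (simp add: complex_eq_iff norm_eq_sqrt_cinner)

lemma norm_add_sq: "(norm (x + y))\<^sup>2 = (norm x)\<^sup>2 + 2 * Re (cinner x y) + (norm (y::'a::complex_inner))\<^sup>2"
proof -
  have "complex_of_real ((norm (x + y))\<^sup>2) = cinner (x + y) (x + y)"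
    by (simp add: cinner_self)
  also have "\<dots> = cinner x x + cinner y y + (cinner x y + cnj (cinner x y))"
    using cinner_commute[of y x] by (simp add: cinner_add_left cinner_add_right)
  also have "\<dots> = complex_of_real ((norm x)\<^sup>2 + 2 * Re (cinner x y) + (norm y)\<^sup>2)"
    by (simp add: cinner_self complex_add_cnj)
  finally show ?thesis
    using of_real_eq_iff by blast
qed

lemma norm_diff_sq: "(norm (x - y))\<^sup>2 = (norm x)\<^sup>2 - 2 * Re (cinner x y) + (norm (y::'a::complex_inner))\<^sup>2"
  using norm_add_sq[of x "- y"] by (simp add: cinner_minus_right)

lemma norm_scaleC: "norm (scaleC c x) = cmod c * norm (x::'a::complex_inner)"
proof -
  have "complex_of_real ((norm (scaleC c x))\<^sup>2) = cinner (scaleC c x) (scaleC c x)"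
    by (simp only: cinner_self)
  also have "\<dots> = c * cnj c * cinner x x"
    by (simp add: cinner_scaleC_left cinner_scaleC_right)
  also have "\<dots> = complex_of_real ((cmod c)\<^sup>2) * complex_of_real ((norm x)\<^sup>2)"
    by (simp only: complex_norm_square cinner_self)
  also have "\<dots> = complex_of_real ((cmod c * norm x)\<^sup>2)"
    by (simp add: power_mult_distrib)
  finally have "complex_of_real ((norm (scaleC c x))\<^sup>2) = complex_of_real ((cmod c * norm x)\<^sup>2)" .
  then have "(norm (scaleC c x))\<^sup>2 = (cmod c * norm x)\<^sup>2"
    using of_real_eq_iff by blast
  then show ?thesis
    by (simp add: power2_eq_iff_nonneg)
qed

lemma cinner_norm_le: "cmod (cinner x y) \<le> norm x * norm (y::'a::complex_inner)"
proof (cases "y = 0")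
  case False
  \<comment> \<open>The coefficient of the orthogonal projection of \<open>x\<close> on the line
    through \<open>y\<close>; nonnegativity of the squared distance to that line is the
    inequality.\<close>
  define c where "c = cinner y x / of_real ((norm y)\<^sup>2)"
  have "cinner x (scaleC c y) = of_real ((cmod (cinner x y))\<^sup>2 / (norm y)\<^sup>2)"
    using cinner_commute[of y x]
    by (simp add: c_def cinner_scaleC_right mult.commute flip: complex_norm_square of_real_power)
  moreover have "norm (scaleC c y) = cmod (cinner x y) / norm y"
    using cinner_commute[of y x] False
    by (simp add: norm_scaleC c_def norm_divide norm_mult power2_eq_square)
  ultimately have "0 \<le> (norm x)\<^sup>2 - (cmod (cinner x y))\<^sup>2 / (norm y)\<^sup>2"
    using norm_diff_sq[of x "scaleC c y"] zero_le_power2[of "norm (x - scaleC c y)"]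
    by (simp add: power_divide)
  then have "(cmod (cinner x y))\<^sup>2 \<le> (norm x * norm y)\<^sup>2"
    using False by (simp add: field_simps power_mult_distrib)
  then show ?thesis
    by (rule power2_le_imp_le) simp
qed simp

text \<open>Real bilinearity is what lets limits, series and continuity pass through the inner
  product; complex homogeneity is tracked separately.\<close>

lemma bounded_bilinear_cinner: "bounded_bilinear (cinner :: 'a::complex_inner \<Rightarrow> 'a \<Rightarrow> complex)"
proof
  show "\<exists>K. \<forall>(a::'a) b. cmod (cinner a b) \<le> norm a * norm b * K"
    by (rule exI[of _ 1]) (simp add: cinner_norm_le)
qed (auto simp: cinner_add_left cinner_add_right cinner_scaleR_left cinner_scaleR_right scaleR_conv_of_real)

lemma bounded_bilinear_scaleC: "bounded_bilinear (scaleC :: complex \<Rightarrow> 'a::complex_inner \<Rightarrow> 'a)"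
proof
  show "\<exists>K. \<forall>a (b::'a). norm (scaleC a b) \<le> norm a * norm b * K"
    by (rule exI[of _ 1]) (simp add: norm_scaleC)
qed (auto simp: scaleC_add_left scaleC_add_right scaleR_scaleC scaleC_scaleC mult.commute scaleR_conv_of_real)

lemmas continuous_on_scaleC = bounded_bilinear.continuous_on[OF bounded_bilinear_scaleC]
lemmas sums_cinner_right = bounded_linear.sums[OF bounded_bilinear.bounded_linear_right[OF bounded_bilinear_cinner]]
lemmas sums_scaleC_right = bounded_linear.sums[OF bounded_bilinear.bounded_linear_right[OF bounded_bilinear_scaleC]]

lemma cinner_ext: "(\<And>z. cinner z x = cinner z y) \<Longrightarrow> x = (y::'a::complex_inner)"
  using cinner_eq_zero_iff[of "x - y"] by (simp add: cinner_diff_right)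

instance chilbert_space \<subseteq> banach ..

section \<open>Vectors of minimal norm and the Riesz representation\<close>

lemma orthogonal_if_minimal:
  fixes u y :: "'a::complex_inner"
  assumes "\<And>c. norm u \<le> norm (u + scaleC c y)"
  shows "cinner y u = 0"
proof (cases "y = 0")
  case False
  \<comment> \<open>The best step along \<open>y\<close>: it lowers the squared norm by the squared
    modulus of \<open>cinner y u\<close> over that of \<open>y\<close>, so minimality makes the
    inner product vanish.\<close>
  define c where "c = - cinner y u / of_real ((norm y)\<^sup>2)"
  have "cinner u (scaleC c y) = of_real (- ((cmod (cinner y u))\<^sup>2 / (norm y)\<^sup>2))"
    using cinner_commute[of u y]
    by (simp add: c_def cinner_scaleC_right mult.commute flip: complex_norm_square of_real_power)
  moreover have "norm (scaleC c y) = cmod (cinner y u) / norm y"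
    using False by (simp add: norm_scaleC c_def norm_divide norm_mult power2_eq_square)
  moreover have "(norm u)\<^sup>2 \<le> (norm (u + scaleC c y))\<^sup>2"
    using assms[of c] by (simp add: power_mono)
  ultimately have "0 \<le> - ((cmod (cinner y u))\<^sup>2 / (norm y)\<^sup>2)"
    using norm_add_sq[of u "scaleC c y"] by (simp add: power_divide)
  then show ?thesis
    using False by (simp add: divide_le_0_iff)
qed simp

lemma parallelogram: "(norm (x + y))\<^sup>2 + (norm (x - y))\<^sup>2 = 2 * (norm x)\<^sup>2 + 2 * (norm (y::'a::complex_inner))\<^sup>2"
  by (simp add: norm_add_sq norm_diff_sq)

text \<open>A minimising sequence is Cauchy: midpoints stay in \<open>C\<close> and so have norm at
  least the infimum, and the parallelogram law then bounds the differences. General convex sets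
  cover both uses, an affine hyperplane and a shifted closed span.\<close>

lemma closed_convex_min_norm:
  fixes C :: "'a::chilbert_space set"
  assumes "closed C" "convex C" "C \<noteq> {}"
  obtains u where "u \<in> C" "\<And>v. v \<in> C \<Longrightarrow> norm u \<le> norm v"
proof -
  define d where "d = (INF v\<in>C. norm v)"
  have bdd: "bdd_below (norm ` C)"
    by (rule bdd_belowI[of _ 0]) auto
  have d_le: "d \<le> norm v" if "v \<in> C" for v
    unfolding d_def using bdd that by (rule cINF_lower)
  have d0: "0 \<le> d"
    unfolding d_def using assms(3) by (intro cINF_greatest) auto
  have "\<exists>v\<in>C. norm v < d + 1 / Suc n" for n
    using cINF_less_iff[OF assms(3) bdd, of "d + 1 / Suc n"] unfolding d_def[symmetric] by simp
  then obtain v where v: "\<And>n. v n \<in> C" "\<And>n. norm (v n) < d + 1 / Suc n"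
    by metis
  have lim: "(\<lambda>n. norm (v n)) \<longlonglongrightarrow> d"
  proof (rule tendsto_sandwich[OF eventuallyI eventuallyI tendsto_const])
    show "(\<lambda>n. d + 1 / real (Suc n)) \<longlonglongrightarrow> d"
      using LIMSEQ_inverse_real_of_nat_add[of d] by (simp add: inverse_eq_divide)
    show "norm (v n) \<le> d + 1 / real (Suc n)" for n
      using v(2)[of n] by simp
  qed (use d_le v in auto)
  have dist: "(norm (v m - v n))\<^sup>2 \<le> 2 * (norm (v m))\<^sup>2 + 2 * (norm (v n))\<^sup>2 - 4 * d\<^sup>2" for m n
  proof -
    have "(1/2) *\<^sub>R v m + (1/2) *\<^sub>R v n \<in> C"
      using assms(2) v(1) by (intro convexD) auto
    then have "d \<le> norm ((1/2) *\<^sub>R (v m + v n))"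
      using d_le by (simp add: scaleR_add_right)
    then have "(2 * d)\<^sup>2 \<le> (norm (v m + v n))\<^sup>2"
      using d0 by (intro power_mono) auto
    then show ?thesis
      using parallelogram[of "v m" "v n"] by (simp add: power_mult_distrib)
  qed
  have "Cauchy v"
  proof (rule CauchyI)
    fix e :: real assume "e > 0"
    have "(\<lambda>n. (norm (v n))\<^sup>2 - d\<^sup>2) \<longlonglongrightarrow> d\<^sup>2 - d\<^sup>2"
      using lim by (intro tendsto_intros)
    then have "\<forall>\<^sub>F n in sequentially. (norm (v n))\<^sup>2 - d\<^sup>2 < e\<^sup>2 / 4"
      using \<open>e > 0\<close> by (intro order_tendstoD(2)) auto
    then obtain N where N: "\<And>n. n \<ge> N \<Longrightarrow> (norm (v n))\<^sup>2 - d\<^sup>2 < e\<^sup>2 / 4"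
      by (auto simp: eventually_sequentially)
    show "\<exists>M. \<forall>m\<ge>M. \<forall>n\<ge>M. norm (v m - v n) < e"
    proof (intro exI allI impI)
      fix m n assume "m \<ge> N" "n \<ge> N"
      then have "(norm (v m - v n))\<^sup>2 < e\<^sup>2"
        using dist[of m n] N[of m] N[of n] by linarith
      then show "norm (v m - v n) < e"
        using \<open>e > 0\<close> by (simp add: power_less_imp_less_base)
    qed
  qed
  then obtain u where u: "v \<longlonglongrightarrow> u"
    by (auto simp: Cauchy_convergent_iff convergent_def)
  have "u \<in> C"
    using closed_sequentially[OF assms(1)] v(1) u by blast
  moreover have "norm u = d"
    using LIMSEQ_unique[OF tendsto_norm[OF u] lim] .
  ultimately show ?thesis
    using that d_le by blast
qed

text \<open>The point of least norm in the hyperplane \<open>\<phi> x = 1\<close> is orthogonal to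
  the kernel of \<open>\<phi>\<close>; suitably rescaled it represents
  \<open>\<phi>\<close>.\<close>

lemma riesz:
  fixes \<phi> :: "'a::chilbert_space \<Rightarrow> complex"
  assumes bl: "bounded_linear \<phi>" and hom: "\<And>c x. \<phi> (scaleC c x) = c * \<phi> x"
  obtains y where "\<And>x. \<phi> x = cinner y x"
proof (cases "\<forall>x. \<phi> x = 0")
  case True
  then show ?thesis
    using that[of 0] by simp
next
  case False
  interpret bounded_linear \<phi> by (rule bl)
  define C where "C = {x. \<phi> x = 1}"
  obtain x0 where "\<phi> x0 \<noteq> 0"
    using False by blast
  then have "scaleC (1 / \<phi> x0) x0 \<in> C"
    by (simp add: C_def hom)
  moreover have "closed C"
    unfolding C_def by (intro closed_Collect_eq continuous_intros linear_continuous_on bl)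
  moreover have "convex C"
    unfolding C_def by (auto simp: convex_def add scaleR scaleR_conv_of_real simp flip: of_real_add)
  ultimately obtain u where u: "u \<in> C" and umin: "\<And>v. v \<in> C \<Longrightarrow> norm u \<le> norm v"
    using closed_convex_min_norm[of C] by blast
  have orth: "cinner u y = 0" if "\<phi> y = 0" for y
  proof -
    have "cinner y u = 0"
      using u that by (intro orthogonal_if_minimal umin) (simp add: C_def add hom)
    then show ?thesis
      using cinner_commute[of u y] by simp
  qed
  have "u \<noteq> 0"
    using u zero by (auto simp: C_def)
  have "\<phi> x = cinner (scaleC (of_real (1 / (norm u)\<^sup>2)) u) x" for x
  proof -
    \<comment> \<open>Subtracting \<open>\<phi> x\<close> times \<open>u\<close> lands in the
      kernel, so pairing with \<open>u\<close> reads off \<open>\<phi> x\<close>.\<close>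
    have "cinner u (x - scaleC (\<phi> x) u) = 0"
      using u by (intro orth) (simp add: C_def diff hom)
    then show ?thesis
      using \<open>u \<noteq> 0\<close> by (simp add: cinner_diff_right cinner_scaleC_right cinner_scaleC_left cinner_self)
  qed
  then show ?thesis
    using that by blast
qed

subsection \<open>Bounded operators and adjoints\<close>

lemma bounded_clinearD:
  assumes "bounded_clinear f"
  shows "bounded_linear f" "f (scaleC c x) = scaleC c (f x)" "f (x + y) = f x + f y"
    "f (x - y) = f x - f y" "f 0 = 0" "f (r *\<^sub>R x) = r *\<^sub>R f x" "f (sum g A) = (\<Sum>i\<in>A. f (g i))"
  using assms linear_simps[of f] linear_sum[of f g A] bounded_linear.linear[of f]
  by (auto simp: bounded_clinear_def)

lemma bounded_clinearI:
  assumes "\<And>x y. f (x + y) = f x + f y" "\<And>c x. f (scaleC c x) = scaleC c (f x)"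
    "\<And>x. norm (f x) \<le> K * norm x"
  shows "bounded_clinear f"
  unfolding bounded_clinear_def
  by (auto intro!: bounded_linear_intro[where K = K] simp: assms scaleR_scaleC mult.commute[of _ K])

lemma bounded_clinear_compose:
  "bounded_clinear f \<Longrightarrow> bounded_clinear g \<Longrightarrow> bounded_clinear (\<lambda>x. f (g x))"
  by (auto simp: bounded_clinear_def intro: bounded_linear_compose)

lemma bounded_clinear_diff:
  "bounded_clinear f \<Longrightarrow> bounded_clinear g \<Longrightarrow> bounded_clinear (\<lambda>x. f x - g x)"
  by (auto simp: bounded_clinear_def scaleC_diff_right intro: bounded_linear_sub)

lemma bounded_clinear_id: "bounded_clinear (\<lambda>x. x)"
  by (simp add: bounded_clinear_def bounded_linear_ident)

lemma bounded_clinear_funpow: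
  fixes f :: "'a::complex_inner \<Rightarrow> 'a"
  assumes "bounded_clinear f"
  shows "bounded_clinear (f ^^ n)"
proof (induction n)
  case 0
  show ?case
    using bounded_clinear_id by (simp add: id_def)
next
  case (Suc n)
  then show ?case
    using bounded_clinear_compose[OF assms, of "f ^^ n"] by (simp add: comp_def)
qed

lemma adj_unique:
  assumes "\<And>x y. cinner (f x) y = cinner x (g y)"
  shows "adj f = g"
  unfolding adj_def
proof (rule the_equality)
  fix h assume h: "\<forall>x y. cinner (f x) y = cinner x (h y)"
  show "h = g"
    by (rule ext, rule cinner_ext) (metis assms h)
qed (simp add: assms)

text \<open>Riesz, applied to \<open>\<lambda>x. cinner y (f x)\<close> for each \<open>y\<close>,
  provides the function that \<open>adj_unique\<close> then identifies with
  \<open>adj f\<close>.\<close>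

lemma cinner_adj:
  fixes f :: "'a::chilbert_space \<Rightarrow> 'b::complex_inner"
  assumes "bounded_clinear f"
  shows "cinner (f x) y = cinner x (adj f y)"
proof -
  have "\<exists>g. \<forall>x. cinner (f x) y = cinner x g" for y
  proof -
    obtain g where g: "\<And>x. cinner y (f x) = cinner g x"
    proof (rule riesz[of "\<lambda>x. cinner y (f x)"])
      show "bounded_linear (\<lambda>x. cinner y (f x))"
        using bounded_linear_compose[OF bounded_bilinear.bounded_linear_right[OF bounded_bilinear_cinner]
          bounded_clinearD(1)[OF assms]] .
    qed (auto simp: bounded_clinearD[OF assms] cinner_scaleC_right)
    have "cinner (f x) y = cinner x g" for x
      using cinner_commute[of "f x" y] cinner_commute[of x g] g[of x] by simp
    then show ?thesis
      by blast
  qed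
  then obtain g where g: "\<And>x y. cinner (f x) y = cinner x (g y)"
    by metis
  from adj_unique[of f g, OF this] g show ?thesis
    by simp
qed

lemma cinner_adj':
  fixes f :: "'a::chilbert_space \<Rightarrow> 'b::complex_inner"
  assumes "bounded_clinear f"
  shows "cinner (adj f y) x = cinner y (f x)"
  using cinner_commute[of "adj f y" x] cinner_commute[of y "f x"] by (simp add: cinner_adj[OF assms])

lemma adj_linear:
  fixes f :: "'a::chilbert_space \<Rightarrow> 'b::complex_inner"
  assumes "bounded_clinear f"
  shows "adj f (x + y) = adj f x + adj f y" "adj f (scaleC c x) = scaleC c (adj f x)"
  by (rule cinner_ext; simp add: cinner_add_right cinner_scaleC_right flip: cinner_adj[OF assms])+

lemma contraction_adj:
  fixes T :: "'a::chilbert_space \<Rightarrow> 'a"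
  assumes "contraction T"
  shows "contraction (adj T)"
proof -
  have T: "bounded_clinear T" "\<And>x. norm (T x) \<le> norm x"
    using assms by (auto simp: contraction_def)
  have le: "norm (adj T y) \<le> norm y" for y
  proof (cases "adj T y = 0")
    case False
    have "complex_of_real ((norm (adj T y))\<^sup>2) = cinner (T (adj T y)) y"
      by (simp add: cinner_adj[OF T(1)] cinner_self)
    then have "(norm (adj T y))\<^sup>2 = cmod (cinner (T (adj T y)) y)"
      by (metis norm_of_real abs_of_nonneg zero_le_power2)
    also have "\<dots> \<le> norm (T (adj T y)) * norm y"
      by (rule cinner_norm_le)
    also have "\<dots> \<le> norm (adj T y) * norm y"
      by (intro mult_right_mono T(2)) auto
    finally show ?thesis
      using False by (simp add: power2_eq_square)
  qed simp
  then have "bounded_clinear (adj T)"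
    using bounded_clinearI[of "adj T" 1] adj_linear[OF T(1)] by simp
  with le show ?thesis
    by (simp add: contraction_def)
qed

lemma adj_adj:
  fixes T :: "'a::chilbert_space \<Rightarrow> 'a"
  assumes "bounded_clinear T"
  shows "adj (adj T) = T"
  by (rule adj_unique) (simp add: cinner_adj'[OF assms])

lemma norm_contraction_funpow_le: "contraction T \<Longrightarrow> norm ((T ^^ n) x) \<le> norm x"
  by (induction n) (auto simp: contraction_def intro: order_trans)

lemma cinner_adj_funpow:
  fixes T :: "'a::chilbert_space \<Rightarrow> 'a"
  assumes "bounded_clinear T"
  shows "cinner ((T ^^ n) x) y = cinner x ((adj T ^^ n) y)"
  by (induction n arbitrary: y) (simp_all add: cinner_adj[OF assms] funpow_swap1[of "adj T"])

subsection \<open>Orthonormal bases and the trace\<close>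

lemma cspan_superset: "x \<in> S \<Longrightarrow> x \<in> cspan S"
  unfolding cspan_def by (auto intro!: exI[of _ "{x}"] exI[of _ "\<lambda>_. 1"] simp: scaleC_one)

lemma cspan_sum:
  assumes "finite F" "F \<subseteq> S"
  shows "(\<Sum>x\<in>F. scaleC (c x) x) \<in> cspan S"
  using assms unfolding cspan_def by blast

text \<open>Padding with zero coefficients gives all vectors of a finite span one common index
  set.\<close>

lemma cspan_finite:
  assumes "finite S" "y \<in> cspan S"
  obtains c where "y = (\<Sum>x\<in>S. scaleC (c x) x)"
proof -
  obtain F c where F: "finite F" "F \<subseteq> S" "y = (\<Sum>x\<in>F. scaleC (c x) x)"
    using assms(2) unfolding cspan_def by blast
  have "y = (\<Sum>x\<in>S. scaleC (if x \<in> F then c x else 0) x)"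
    unfolding F(3) by (rule sum.mono_neutral_cong_left) (use F assms in auto)
  then show ?thesis
    by (rule that)
qed

lemma cspan_zero: "0 \<in> cspan S"
  using cspan_sum[of "{}" S] by simp

lemma cspan_mono: "S \<subseteq> S' \<Longrightarrow> cspan S \<subseteq> cspan S'"
  unfolding cspan_def by blast

lemma cspan_add:
  assumes "x \<in> cspan S" "y \<in> cspan S"
  shows "x + y \<in> cspan S"
proof -
  obtain F c where F: "finite F" "F \<subseteq> S" "x = (\<Sum>x\<in>F. scaleC (c x) x)"
    using assms(1) unfolding cspan_def by blast
  obtain G d where G: "finite G" "G \<subseteq> S" "y = (\<Sum>x\<in>G. scaleC (d x) x)"
    using assms(2) unfolding cspan_def by blast
  obtain c' where c': "x = (\<Sum>x\<in>F \<union> G. scaleC (c' x) x)"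
    by (rule cspan_finite[of "F \<union> G" x]) (use F G cspan_sum[of F "F \<union> G" c] in auto)
  obtain d' where d': "y = (\<Sum>x\<in>F \<union> G. scaleC (d' x) x)"
    by (rule cspan_finite[of "F \<union> G" y]) (use F G cspan_sum[of G "F \<union> G" d] in auto)
  have "x + y = (\<Sum>x\<in>F \<union> G. scaleC (c' x + d' x) x)"
    unfolding c' d' by (simp add: scaleC_add_left sum.distrib)
  then show ?thesis
    using F G cspan_sum[of "F \<union> G" S] by simp
qed

lemma cspan_scaleC:
  assumes "x \<in> cspan S"
  shows "scaleC c x \<in> cspan S"
proof -
  obtain F d where F: "finite F" "F \<subseteq> S" "x = (\<Sum>x\<in>F. scaleC (d x) x)"
    using assms unfolding cspan_def by blast
  have "scaleC c x = (\<Sum>x\<in>F. scaleC (c * d x) x)"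
    unfolding F(3) by (simp add: scaleC_sum_right scaleC_scaleC)
  then show ?thesis
    using F cspan_sum[of F S] by simp
qed

lemma orthonormalD:
  assumes "orthonormal B" "e \<in> B" "f \<in> B"
  shows "cinner e f = (if e = f then 1 else 0)"
  using assms by (auto simp: orthonormal_def cinner_self)

lemma cinner_orthonormal_sum:
  assumes "orthonormal B" "finite F" "F \<subseteq> B" "e \<in> F"
  shows "cinner e (\<Sum>f\<in>F. scaleC (c f) f) = c e"
proof -
  have "cinner e f = (if e = f then 1 else 0)" if "f \<in> F" for f
    using assms that by (intro orthonormalD[OF assms(1)]) auto
  then have "cinner e (\<Sum>f\<in>F. scaleC (c f) f) = (\<Sum>f\<in>F. c f * (if e = f then 1 else 0))"
    by (simp add: cinner_sum_right cinner_scaleC_right cong: sum.cong)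
  then show ?thesis
    using assms by (simp add: if_distrib cong: if_cong)
qed

lemma orthonormal_expand:
  assumes "orthonormal B" "finite B" "y \<in> cspan B"
  shows "y = (\<Sum>e\<in>B. scaleC (cinner e y) e)"
proof -
  obtain c where c: "y = (\<Sum>x\<in>B. scaleC (c x) x)"
    using assms cspan_finite by blast
  show ?thesis
    by (subst c, rule sum.cong) (auto simp: c cinner_orthonormal_sum[OF assms(1,2)])
qed

text \<open>Pythagoras: for the projection \<open>p\<close>, the residual \<open>x - p\<close> is
  orthogonal to the span of \<open>F\<close>, which contains \<open>p - y\<close>.\<close>

lemma orthonormal_best_approx:
  assumes "orthonormal B" "finite F" "F \<subseteq> B" "y \<in> cspan F"
  shows "norm (x - (\<Sum>e\<in>F. scaleC (cinner e x) e)) \<le> norm (x - y)"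
proof -
  define p where "p = (\<Sum>e\<in>F. scaleC (cinner e x) e)"
  obtain c where c: "y = (\<Sum>x\<in>F. scaleC (c x) x)"
    using assms cspan_finite by blast
  have orth: "cinner e (x - p) = 0" if "e \<in> F" for e
    using cinner_orthonormal_sum[OF assms(1-3) that, of "\<lambda>e. cinner e x"]
    by (simp add: cinner_diff_right p_def)
  have "p - y = (\<Sum>e\<in>F. scaleC (cinner e x - c e) e)"
    by (simp add: c p_def scaleC_add_left[of "_ - _" "_", simplified, symmetric] sum_subtractf[symmetric])
       (metis (no_types, lifting) add_diff_cancel_right' diff_add_cancel scaleC_add_left)
  then have "cinner (p - y) (x - p) = 0"
    by (simp add: cinner_sum_left cinner_scaleC_left orth)
  then have "(norm (p - y + (x - p)))\<^sup>2 = (norm (p - y))\<^sup>2 + (norm (x - p))\<^sup>2"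
    unfolding norm_add_sq by simp
  then have "(norm (x - p))\<^sup>2 \<le> (norm (x - y))\<^sup>2"
    by simp
  then show ?thesis
    unfolding p_def by (rule power2_le_imp_le) simp
qed

lemma orthonormal_insert:
  assumes "orthonormal B" "r \<noteq> 0" "\<And>e. e \<in> B \<Longrightarrow> cinner e r = 0"
  shows "orthonormal (insert (scaleC (of_real (1 / norm r)) r) B)"
proof -
  have "cinner r e = 0" if "e \<in> B" for e
    using assms(3)[OF that] cinner_commute[of r e] by simp
  then show ?thesis
    using assms unfolding orthonormal_def
    by (auto simp: norm_scaleC cinner_scaleC_left cinner_scaleC_right norm_divide)
qed

text \<open>A vector whose residual vanishes adds nothing to the basis; otherwise the normalised
  residual is adjoined.\<close>

lemma gram_schmidt:
  fixes F :: "'a::complex_inner set"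
  assumes "finite F"
  obtains B where "finite B" "orthonormal B" "F \<subseteq> cspan B"
proof -
  have "\<exists>B. finite B \<and> orthonormal B \<and> F \<subseteq> cspan B"
    using assms
  proof (induction F)
    case empty
    show ?case by (rule exI[of _ "{}"]) (simp add: orthonormal_def)
  next
    case (insert x F)
    then obtain B where B: "finite B" "orthonormal B" "F \<subseteq> cspan B"
      by blast
    define p where "p = (\<Sum>e\<in>B. scaleC (cinner e x) e)"
    show ?case
    proof (cases "x = p")
      case True
      have "p \<in> cspan B"
        unfolding p_def using B by (intro cspan_sum) auto
      with True show ?thesis
        using B by (intro exI[of _ B]) simp
    next
      case False
      define b where "b = scaleC (of_real (1 / norm (x - p))) (x - p)"
      have orth: "cinner e (x - p) = 0" if "e \<in> B" for e
        using cinner_orthonormal_sum[OF B(2,1) subset_refl that, of "\<lambda>e. cinner e x"]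
        by (simp add: cinner_diff_right p_def)
      have "orthonormal (insert b B)"
        unfolding b_def using False B orth by (intro orthonormal_insert) auto
      moreover have "p \<in> cspan (insert b B)"
        unfolding p_def using B by (intro cspan_sum) auto
      then have "scaleC (of_real (norm (x - p))) b + p \<in> cspan (insert b B)"
        by (intro cspan_add[OF cspan_scaleC[OF cspan_superset]]) auto
      then have "x \<in> cspan (insert b B)"
        using False by (simp add: b_def scaleC_scaleC scaleC_one)
      ultimately show ?thesis
        using B cspan_mono[of B "insert b B"] by (intro exI[of _ "insert b B"]) auto
    qed
  qed
  then show ?thesis
    using that by blast
qed

lemma cspan_subset:
  assumes "F \<subseteq> cspan B"
  shows "cspan F \<subseteq> cspan B"
proof
  fix y assume "y \<in> cspan F"
  then obtain G c where G: "finite G" "G \<subseteq> F" "y = (\<Sum>x\<in>G. scaleC (c x) x)"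
    unfolding cspan_def by blast
  from G(1,2) have "(\<Sum>x\<in>G. scaleC (c x) x) \<in> cspan B"
    by (induction G) (use assms in \<open>auto intro: cspan_zero cspan_add cspan_scaleC\<close>)
  then show "y \<in> cspan B"
    using G by simp
qed

text \<open>The span of \<open>B\<close> may be larger than the range of \<open>A\<close>;
  containment is all that the trace formulas ask for.\<close>

lemma finite_rank_orthonormal:
  assumes "finite_rank A"
  obtains B where "finite B" "orthonormal B" "range A \<subseteq> cspan B"
proof -
  obtain F where F: "finite F" "range A \<subseteq> cspan F"
    using assms unfolding finite_rank_def by blast
  obtain B where "finite B" "orthonormal B" "F \<subseteq> cspan B"
    using gram_schmidt[OF F(1)] .
  with F(2) cspan_subset[of F B] that show ?thesis
    by blast
qed

text \<open>Makes the \<open>SOME\<close> in \<open>trace\<close> meaningful. For a maximal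
  orthonormal set \<open>B\<close> and any \<open>x\<close>, the shortest vector of the form
  \<open>x - y\<close> with \<open>y\<close> in the closed span is orthogonal to \<open>B\<close>.
  If it were nonzero, its normalisation would belong to \<open>B\<close> by maximality and so be
  orthogonal to itself.\<close>

lemma is_onb_exists: "\<exists>B::'a::chilbert_space set. is_onb B"
proof -
  have "\<exists>M\<in>Collect orthonormal. \<forall>X\<in>Collect orthonormal. M \<subseteq> X \<longrightarrow> X = (M::'a set)"
  proof (rule subset_Zorn_nonempty)
    show "Collect orthonormal \<noteq> ({}::'a set set)"
      by (auto intro!: exI[of _ "{}"] simp: orthonormal_def)
  next
    fix C :: "'a set set" assume "C \<noteq> {}" and C: "subset.chain (Collect orthonormal) C"
    show "\<Union>C \<in> Collect orthonormal"
      unfolding orthonormal_def mem_Collect_eq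
    proof (intro conjI ballI impI)
      fix e assume "e \<in> \<Union>C"
      with C show "norm e = 1"
        by (auto simp: subset_chain_def orthonormal_def)
    next
      fix e f assume ef: "e \<in> \<Union>C" "f \<in> \<Union>C" "e \<noteq> f"
      then obtain X where "X \<in> C" "e \<in> X" "f \<in> X"
        using C unfolding subset_chain_def by blast
      with C ef show "cinner e f = 0"
        by (auto simp: subset_chain_def orthonormal_def)
    qed
  qed
  then obtain B :: "'a set" where B: "orthonormal B"
    and Bmax: "\<And>X. orthonormal X \<Longrightarrow> B \<subseteq> X \<Longrightarrow> X = B"
    by blast
  have "x \<in> closure (cspan B)" for x
  proof -
    define C where "C = (\<lambda>y. x - y) ` closure (cspan B)"
    have "convex (cspan B)"
      by (auto simp: convex_def scaleR_scaleC intro: cspan_add cspan_scaleC)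
    then have "convex C"
      using convex_translation[OF convex_negations[OF convex_closure], of "cspan B" x]
      by (simp add: C_def image_image)
    moreover have "closed C"
      using closed_translation[OF closed_negations[OF closed_closure], of x "cspan B"]
      by (simp add: C_def image_image)
    moreover have "C \<noteq> {}"
      unfolding C_def using cspan_zero[of B] closure_subset[of "cspan B"] by blast
    ultimately obtain u where u: "u \<in> C" and umin: "\<And>v. v \<in> C \<Longrightarrow> norm u \<le> norm v"
      using closed_convex_min_norm by blast
    obtain y where y: "y \<in> closure (cspan B)" "u = x - y"
      using u unfolding C_def by blast
    have orth: "cinner e u = 0" if "e \<in> B" for e
    proof (rule orthogonal_if_minimal)
      fix c
      obtain s where s: "\<And>n. s n \<in> cspan B" "s \<longlonglongrightarrow> y"
        using y(1) closure_sequential by blast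
      have "(\<lambda>n. s n + scaleC (- c) e) \<longlonglongrightarrow> y + scaleC (- c) e"
        by (intro tendsto_intros s)
      moreover have "s n + scaleC (- c) e \<in> cspan B" for n
        by (intro cspan_add cspan_scaleC s cspan_superset that)
      ultimately have "y + scaleC (- c) e \<in> closure (cspan B)"
        unfolding closure_sequential by (intro exI[of _ "\<lambda>n. s n + scaleC (- c) e"] conjI allI)
      then have "x - (y + scaleC (- c) e) \<in> C"
        unfolding C_def by blast
      moreover have "scaleC (- c) e = - scaleC c e"
        using scaleC_add_left[of c "- c" e] by (simp add: eq_neg_iff_add_eq_0 add.commute)
      ultimately show "norm u \<le> norm (u + scaleC c e)"
        using umin by (simp add: y(2) diff_add_eq algebra_simps)
    qed
    show ?thesis
    proof (cases "u = 0")
      case False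
      define b where "b = scaleC (of_real (1 / norm u)) u"
      have "orthonormal (insert b B)"
        unfolding b_def using B orth False by (intro orthonormal_insert)
      then have "b \<in> B"
        using Bmax[of "insert b B"] by blast
      then have "cinner b u = 0"
        by (rule orth)
      then show ?thesis
        using False by (simp add: b_def cinner_scaleC_left cinner_eq_zero_iff)
    qed (use y in simp)
  qed
  then show ?thesis
    using B unfolding is_onb_def by blast
qed

text \<open>Density of the span gives a finite \<open>F\<close> whose span approximates
  \<open>u\<close> well. By best approximation every larger finite subset does at least as well,
  which is convergence along finite subsets, for uncountable \<open>B\<close> too.\<close>

lemma parseval_onb:
  assumes "is_onb B"
  shows "((\<lambda>e. cinner v e * cinner e u) has_sum cinner v u) B"
  unfolding has_sum_def tendsto_iff eventually_finite_subsets_at_top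
proof (intro allI impI)
  fix \<epsilon> :: real assume "\<epsilon> > 0"
  \<comment> \<open>The summand 1 keeps the quotient meaningful when \<open>v = 0\<close>.\<close>
  define \<delta> where "\<delta> = \<epsilon> / (norm v + 1)"
  have "\<delta> > 0"
    using \<open>\<epsilon> > 0\<close> by (simp add: \<delta>_def add_nonneg_pos)
  have on: "orthonormal B"
    using assms by (simp add: is_onb_def)
  have "u \<in> closure (cspan B)"
    using assms by (simp add: is_onb_def)
  then obtain y where y: "y \<in> cspan B" "dist y u < \<delta>"
    using \<open>\<delta> > 0\<close> unfolding closure_approachable by blast
  obtain F c where F: "finite F" "F \<subseteq> B" "y = (\<Sum>x\<in>F. scaleC (c x) x)"
    using y(1) unfolding cspan_def by blast
  have "dist (\<Sum>e\<in>G. cinner v e * cinner e u) (cinner v u) < \<epsilon>"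
    if G: "finite G" "F \<subseteq> G" "G \<subseteq> B" for G
  proof -
    define p where "p = (\<Sum>e\<in>G. scaleC (cinner e u) e)"
    have "norm (u - p) \<le> norm (u - y)"
      unfolding p_def
      by (rule orthonormal_best_approx[OF on]) (use G F cspan_sum[of F G] in auto)
    then have up: "norm (u - p) < \<delta>"
      using y(2) by (simp add: dist_norm norm_minus_commute)
    have "(\<Sum>e\<in>G. cinner v e * cinner e u) - cinner v u = - cinner v (u - p)"
      by (simp add: p_def cinner_diff_right cinner_sum_right cinner_scaleC_right mult.commute)
    then have "dist (\<Sum>e\<in>G. cinner v e * cinner e u) (cinner v u) \<le> norm v * norm (u - p)"
      by (simp add: dist_norm cinner_norm_le)
    also have "\<dots> \<le> norm v * \<delta>"
      using up by (intro mult_left_mono) auto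
    also have "\<dots> < \<epsilon>"
      using \<open>\<epsilon> > 0\<close> add_nonneg_pos[OF norm_ge_zero zero_less_one, of v]
      by (simp add: \<delta>_def field_simps)
    finally show ?thesis .
  qed
  then show "\<exists>X. finite X \<and> X \<subseteq> B \<and> (\<forall>Y. finite Y \<and> X \<subseteq> Y \<and> Y \<subseteq> B \<longrightarrow>
      dist (\<Sum>e\<in>Y. cinner v e * cinner e u) (cinner v u) < \<epsilon>)"
    using F by blast
qed

lemma has_sum_sum:
  fixes f :: "'b \<Rightarrow> 'a \<Rightarrow> complex"
  assumes "\<And>j. j \<in> J \<Longrightarrow> (f j has_sum s j) A"
  shows "((\<lambda>x. \<Sum>j\<in>J. f j x) has_sum (\<Sum>j\<in>J. s j)) A"
  using assms by (induction J rule: infinite_finite_induct) (auto intro!: has_sum_add)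

text \<open>By Parseval each rank one summand contributes \<open>cinner (v j) (u j)\<close> in every
  orthonormal basis, so the basis picked by \<open>SOME\<close> does not matter.\<close>

lemma trace_finite_rank:
  fixes A :: "'a::chilbert_space \<Rightarrow> 'a"
  assumes "\<And>x. A x = (\<Sum>j\<in>J. scaleC (cinner (v j) x) (u j))"
  shows "trace A = (\<Sum>j\<in>J. cinner (v j) (u j))"
proof -
  define B :: "'a set" where "B = (SOME B. is_onb B)"
  have B: "is_onb B"
    unfolding B_def using is_onb_exists by (rule someI_ex)
  have "((\<lambda>e. \<Sum>j\<in>J. cinner (v j) e * cinner e (u j)) has_sum (\<Sum>j\<in>J. cinner (v j) (u j))) B"
    by (intro has_sum_sum parseval_onb B)
  moreover have "cinner e (A e) = (\<Sum>j\<in>J. cinner (v j) e * cinner e (u j))" for e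
    by (simp add: assms cinner_sum_right cinner_scaleC_right)
  ultimately show ?thesis
    unfolding trace_def B_def[symmetric] by (simp add: infsumI)
qed

subsection \<open>Positive square roots\<close>

text \<open>The coefficient of \<open>x ^ n\<close> in the Taylor series of
  \<open>sqrt (1 - x)\<close>.\<close>

definition sqrt_coeff :: "nat \<Rightarrow> real" where
  "sqrt_coeff n = (- 1) ^ n * ((1 / 2) gchoose n)"

lemma sqrt_coeff_0: "sqrt_coeff 0 = 1"
  by (simp add: sqrt_coeff_def)

lemma sqrt_coeff_Suc: "sqrt_coeff (Suc n) = sqrt_coeff n * (real n - 1 / 2) / real (Suc n)"
proof -
  have "((1 / 2 :: real) gchoose Suc n) = ((1 / 2) gchoose n) * (1 / 2 - real n) / real (Suc n)"
    using gbinomial_mult_1[of "1 / 2 :: real" n] by (simp add: field_simps)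
  then have "(- 1) ^ Suc n * ((1 / 2 :: real) gchoose Suc n)
      = (- 1) ^ Suc n * (((1 / 2) gchoose n) * (1 / 2 - real n) / real (Suc n))"
    by (rule arg_cong)
  also have "\<dots> = (- 1) ^ n * ((1 / 2) gchoose n) * (real n - 1 / 2) / real (Suc n)"
    by (simp add: field_simps)
  finally show ?thesis
    unfolding sqrt_coeff_def .
qed

lemma sqrt_coeff_nonpos: "n > 0 \<Longrightarrow> sqrt_coeff n \<le> 0"
proof (induction n)
  case (Suc n)
  show ?case
  proof (cases "n = 0")
    case False
    with Suc show ?thesis
      unfolding sqrt_coeff_Suc by (intro divide_nonpos_nonneg mult_nonpos_nonneg) auto
  qed (simp add: sqrt_coeff_Suc sqrt_coeff_0)
qed simp

text \<open>The closed form reveals the sign: for \<open>n > 0\<close> both factors are nonpositive.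
  Nonnegative partial sums then yield absolute summability and also positivity of the operator
  series.\<close>

lemma sum_sqrt_coeff: "(\<Sum>k\<le>n. sqrt_coeff k) = sqrt_coeff n * (1 - 2 * real n)"
proof (induction n)
  case (Suc n)
  have "sqrt_coeff n * (1 - 2 * real n) = - 2 * real (Suc n) * sqrt_coeff (Suc n)"
    by (simp add: sqrt_coeff_Suc field_simps)
  with Suc show ?case
    by (simp add: algebra_simps)
qed (simp add: sqrt_coeff_0)

lemma sum_sqrt_coeff_nonneg: "0 \<le> (\<Sum>k\<le>n. sqrt_coeff k)"
proof (cases "n = 0")
  case False
  then show ?thesis
    unfolding sum_sqrt_coeff by (intro mult_nonpos_nonpos sqrt_coeff_nonpos) auto
qed (simp add: sqrt_coeff_0)

text \<open>Only the coefficient at 0 is positive, so taking absolute values amounts to negating,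
  with a correction of 2 at \<open>k = 0\<close>; the partial sums thus stay below 2.\<close>

lemma summable_abs_sqrt_coeff: "summable (\<lambda>n. \<bar>sqrt_coeff n\<bar>)"
proof (rule bounded_imp_summable[where B = 2])
  fix n
  have "(\<Sum>k\<le>n. \<bar>sqrt_coeff k\<bar>) = (\<Sum>k\<le>n. (if k = 0 then 2 else 0) - sqrt_coeff k)"
    by (intro sum.cong refl) (simp add: sqrt_coeff_0 sqrt_coeff_nonpos)
  then show "(\<Sum>k\<le>n. \<bar>sqrt_coeff k\<bar>) \<le> 2"
    using sum_sqrt_coeff_nonneg[of n] by (simp add: sum_subtractf)
qed simp

text \<open>Vandermonde with \<open>1 / 2 + 1 / 2 = 1\<close>: squaring the series of
  \<open>sqrt (1 - x)\<close> returns the polynomial \<open>1 - x\<close>.\<close>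

lemma sqrt_coeff_convolution:
  "(\<Sum>k\<le>n. sqrt_coeff k * sqrt_coeff (n - k)) = (if n = 0 then 1 else if n = 1 then - 1 else 0)"
proof -
  have "(\<Sum>k\<le>n. sqrt_coeff k * sqrt_coeff (n - k)) =
      (\<Sum>k = 0..n. (- 1) ^ n * (((1 / 2) gchoose k) * ((1 / 2) gchoose (n - k))))"
  proof (rule sum.cong)
    fix k assume "k \<in> {0..n}"
    then have "(- 1 :: real) ^ n = (- 1) ^ k * (- 1) ^ (n - k)"
      by (simp flip: power_add)
    then show "sqrt_coeff k * sqrt_coeff (n - k)
        = (- 1) ^ n * (((1 / 2) gchoose k) * ((1 / 2) gchoose (n - k)))"
      by (simp only: sqrt_coeff_def mult_ac)
  qed auto
  also have "\<dots> = (- 1) ^ n * (1 gchoose n)"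
    by (simp add: gbinomial_Vandermonde flip: sum_distrib_left)
  also have "(1::real) gchoose n = of_nat (1 choose n)"
    using binomial_gbinomial[of 1 n, where ?'a = real] by simp
  finally show ?thesis
    by (cases n) (auto simp: binomial_eq_0)
qed

text \<open>Both sides sum one array over pairs \<open>(n, m)\<close>, by rows and by diagonals.
  Domination by \<open>a n * b m * K\<close> makes the array absolutely summable, which justifies
  the rearrangement.\<close>

lemma suminf_Cauchy_product_scaleR:
  fixes v :: "nat \<Rightarrow> 'a::banach" and a b :: "nat \<Rightarrow> real"
  assumes a: "summable (\<lambda>n. \<bar>a n\<bar>)" and b: "summable (\<lambda>n. \<bar>b n\<bar>)" and v: "\<And>n. norm (v n) \<le> K"
  shows "(\<Sum>n. a n *\<^sub>R (\<Sum>m. b m *\<^sub>R v (n + m))) = (\<Sum>k. (\<Sum>i\<le>k. a i * b (k - i)) *\<^sub>R v k)"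
proof -
  have sum_on: "(\<lambda>n. c n) summable_on UNIV" if "summable (\<lambda>n. \<bar>c n\<bar>)" for c :: "nat \<Rightarrow> real"
    using that by (intro norm_summable_imp_summable_on) simp
  have K: "0 \<le> K"
    using v[of 0] norm_ge_zero order_trans by blast
  define f where "f = (\<lambda>(n, m). (a n * b m) *\<^sub>R v (n + m))"
  have "(\<lambda>p. norm (case p of (n, m) \<Rightarrow> a n * b m * K)) summable_on UNIV \<times> UNIV"
    unfolding Infinite_Sum.abs_summable_on_Sigma_iff
  proof (intro conjI ballI)
    show "(\<lambda>m. norm (case (n, m) of (n, m) \<Rightarrow> a n * b m * K)) summable_on UNIV" for n
      using a b sum_on[of "\<lambda>m. \<bar>b m\<bar>"]
      by (auto simp: abs_mult mult.assoc intro!: summable_on_cmult_right summable_on_cmult_left)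
    have "(\<lambda>n. \<bar>a n\<bar> * (infsum (\<lambda>m. \<bar>b m\<bar>) UNIV * \<bar>K\<bar>)) summable_on UNIV"
      using a sum_on[of "\<lambda>m. \<bar>a m\<bar>"] by (intro summable_on_cmult_left) simp
    moreover have "infsum (\<lambda>m. norm (case (n, m) of (n, m) \<Rightarrow> a n * b m * K)) UNIV
        = \<bar>a n\<bar> * (infsum (\<lambda>m. \<bar>b m\<bar>) UNIV * \<bar>K\<bar>)" for n
      by (simp add: abs_mult mult.assoc infsum_cmult_right' infsum_cmult_left')
    ultimately show "(\<lambda>n. norm (infsum (\<lambda>m. norm (case (n, m) of (n, m) \<Rightarrow> a n * b m * K)) UNIV)) summable_on UNIV"
      by (simp add: abs_mult infsum_nonneg)
  qed
  then have abs_f: "(\<lambda>p. norm (f p)) summable_on UNIV \<times> UNIV"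
  proof (rule Infinite_Sum.abs_summable_on_comparison_test)
    fix p :: "nat \<times> nat"
    show "norm (f p) \<le> norm (case p of (n, m) \<Rightarrow> a n * b m * K)"
      using K by (auto simp: f_def abs_mult split: prod.split intro!: mult_left_mono v)
  qed
  have f: "f summable_on UNIV \<times> UNIV"
    using abs_f by (rule Infinite_Sum.abs_summable_summable)
  have *: "infsum g UNIV = suminf g" if "(\<lambda>n. norm (g n)) summable_on UNIV" for g :: "nat \<Rightarrow> 'a"
  proof -
    have "summable (\<lambda>n. norm (g n))"
      using that summable_on_imp_summable by blast
    then show ?thesis
      by (intro infsumI norm_summable_imp_has_sum summable_sums[OF summable_norm_cancel])
  qed
  have inner: "infsum (\<lambda>m. f (n, m)) UNIV = a n *\<^sub>R (\<Sum>m. b m *\<^sub>R v (n + m))" for n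
  proof -
    have sm: "summable (\<lambda>m. norm (b m *\<^sub>R v (n + m)))"
      using v by (intro summable_comparison_test'[OF summable_mult2[OF b, of K]])
        (auto intro!: mult_left_mono)
    have "(\<lambda>m. norm (f (n, m))) summable_on UNIV"
      using abs_f unfolding Infinite_Sum.abs_summable_on_Sigma_iff by simp
    then have "infsum (\<lambda>m. f (n, m)) UNIV = (\<Sum>m. a n *\<^sub>R (b m *\<^sub>R v (n + m)))"
      by (subst *) (auto simp: f_def)
    also have "\<dots> = a n *\<^sub>R (\<Sum>m. b m *\<^sub>R v (n + m))"
      by (rule suminf_scaleR_right[symmetric, OF summable_norm_cancel[OF sm]])
    finally show ?thesis .
  qed
  have "(\<lambda>n. norm (infsum (\<lambda>m. f (n, m)) UNIV)) summable_on UNIV"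
  proof (rule Infinite_Sum.abs_summable_on_comparison_test')
    show "(\<lambda>n. infsum (\<lambda>m. norm (f (n, m))) UNIV) summable_on UNIV"
      using abs_f unfolding Infinite_Sum.abs_summable_on_Sigma_iff by (auto intro: Infinite_Sum.abs_summable_summable)
    show "norm (infsum (\<lambda>m. f (n, m)) UNIV) \<le> infsum (\<lambda>m. norm (f (n, m))) UNIV" for n
      using abs_f unfolding Infinite_Sum.abs_summable_on_Sigma_iff by (intro norm_infsum_bound) auto
  qed
  then have "(\<Sum>n. a n *\<^sub>R (\<Sum>m. b m *\<^sub>R v (n + m))) = infsum (\<lambda>n. infsum (\<lambda>m. f (n, m)) UNIV) UNIV"
    using *[of "\<lambda>n. infsum (\<lambda>m. f (n, m)) UNIV"] by (simp add: inner)
  also have "\<dots> = infsum f (UNIV \<times> UNIV)"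
    by (rule infsum_Sigma_banach[OF f])
  finally have lhs: "(\<Sum>n. a n *\<^sub>R (\<Sum>m. b m *\<^sub>R v (n + m))) = infsum f (UNIV \<times> UNIV)" .
  \<comment> \<open>Enumerates the pairs along the diagonals \<open>n + m = k\<close>; the truncated
    subtraction is harmless since \<open>i \<le> k\<close> on the domain used.\<close>
  define h where "h = (\<lambda>(k::nat, i::nat). (i, k - i))"
  have inj: "inj_on h (Sigma UNIV (\<lambda>k. {..k}))"
    by (auto simp: inj_on_def h_def)
  have img: "h ` (Sigma UNIV (\<lambda>k. {..k})) = UNIV \<times> UNIV"
  proof -
    have "(n, m) \<in> h ` (Sigma UNIV (\<lambda>k. {..k}))" for n m
      by (rule image_eqI[of _ _ "(n + m, n)"]) (auto simp: h_def)
    then show ?thesis by auto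
  qed
  have abs_fh: "(\<lambda>p. norm ((f \<circ> h) p)) summable_on (Sigma UNIV (\<lambda>k. {..k}))"
    using abs_f summable_on_reindex[OF inj, of "\<lambda>x. norm (f x)"] by (simp add: img comp_def)
  have fh: "(f \<circ> h) summable_on (Sigma UNIV (\<lambda>k. {..k}))"
    using abs_fh by (rule Infinite_Sum.abs_summable_summable)
  have inner': "infsum (\<lambda>i. (f \<circ> h) (k, i)) {..k} = (\<Sum>i\<le>k. a i * b (k - i)) *\<^sub>R v k" for k
    by (simp add: f_def h_def scaleR_sum_left)
  have "infsum f (UNIV \<times> UNIV) = infsum (f \<circ> h) (Sigma UNIV (\<lambda>k. {..k}))"
    using infsum_reindex[OF inj, of f] by (simp add: img)
  also have "\<dots> = infsum (\<lambda>k. infsum (\<lambda>i. (f \<circ> h) (k, i)) {..k}) UNIV"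
    by (rule infsum_Sigma_banach[OF fh, symmetric])
  also have "\<dots> = (\<Sum>k. (\<Sum>i\<le>k. a i * b (k - i)) *\<^sub>R v k)"
    unfolding inner'
  proof (rule *)
    have "(\<lambda>k. infsum (\<lambda>i. norm ((f \<circ> h) (k, i))) {..k}) summable_on UNIV"
      using abs_fh unfolding Infinite_Sum.abs_summable_on_Sigma_iff by (auto intro: Infinite_Sum.abs_summable_summable)
    then show "(\<lambda>k. norm ((\<Sum>i\<le>k. a i * b (k - i)) *\<^sub>R v k)) summable_on UNIV"
    proof (rule Infinite_Sum.abs_summable_on_comparison_test')
      fix k
      have "norm (\<Sum>i\<le>k. (f \<circ> h) (k, i)) \<le> (\<Sum>i\<le>k. norm ((f \<circ> h) (k, i)))"
        by (rule norm_sum)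
      then show "norm ((\<Sum>i\<le>k. a i * b (k - i)) *\<^sub>R v k) \<le> infsum (\<lambda>i. norm ((f \<circ> h) (k, i))) {..k}"
        using inner'[of k] by simp
    qed
  qed
  finally show ?thesis
    using lhs by simp
qed

text \<open>A candidate for the square root of \<open>1 - X\<close>. Absolute summability of the
  coefficients makes it converge for every contraction, also one of norm 1.\<close>

definition sqrt_series :: "('a::chilbert_space \<Rightarrow> 'a) \<Rightarrow> 'a \<Rightarrow> 'a" where
  "sqrt_series X x = (\<Sum>n. sqrt_coeff n *\<^sub>R (X ^^ n) x)"

lemma contraction_funpow_linear:
  fixes X :: "'a::complex_inner \<Rightarrow> 'a"
  assumes "contraction X"
  shows "bounded_clinear (X ^^ n)"
  using assms bounded_clinear_funpow unfolding contraction_def by blast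

lemma summable_norm_sqrt_series:
  assumes "contraction X"
  shows "summable (\<lambda>n. norm (sqrt_coeff n *\<^sub>R (X ^^ n) x))"
  by (rule summable_comparison_test'[OF summable_mult2[OF summable_abs_sqrt_coeff, of "norm x"], of 0])
     (auto intro!: mult_left_mono norm_contraction_funpow_le assms)

lemma sqrt_series_sums:
  assumes "contraction X"
  shows "(\<lambda>n. sqrt_coeff n *\<^sub>R (X ^^ n) x) sums sqrt_series X x"
  unfolding sqrt_series_def by (rule summable_sums[OF summable_norm_cancel[OF summable_norm_sqrt_series[OF assms]]])

lemma bounded_clinear_sqrt_series:
  assumes X: "contraction X"
  shows "bounded_clinear (sqrt_series X)"
proof (rule bounded_clinearI)
  note lin = bounded_clinearD[OF contraction_funpow_linear[OF X]]
  show "sqrt_series X (x + y) = sqrt_series X x + sqrt_series X y" for x y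
    using sums_add[OF sqrt_series_sums[OF X, of x] sqrt_series_sums[OF X, of y]]
    by (intro sums_unique2[OF sqrt_series_sums[OF X]]) (simp add: lin scaleR_add_right)
  show "sqrt_series X (scaleC c x) = scaleC c (sqrt_series X x)" for c x
    using sums_scaleC_right[OF sqrt_series_sums[OF X, of x], of c]
    by (intro sums_unique2[OF sqrt_series_sums[OF X]])
       (simp add: lin scaleR_scaleC scaleC_scaleC mult.commute)
  fix x
  have "norm (sqrt_series X x) \<le> (\<Sum>n. norm (sqrt_coeff n *\<^sub>R (X ^^ n) x))"
    unfolding sqrt_series_def by (intro summable_norm summable_norm_sqrt_series X)
  also have "\<dots> \<le> (\<Sum>n. \<bar>sqrt_coeff n\<bar> * norm x)"
    by (intro suminf_le summable_norm_sqrt_series X summable_mult2 summable_abs_sqrt_coeff)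
       (auto intro!: mult_left_mono norm_contraction_funpow_le X)
  also have "\<dots> = (\<Sum>n. \<bar>sqrt_coeff n\<bar>) * norm x"
    by (intro suminf_mult2[symmetric] summable_abs_sqrt_coeff)
  finally show "norm (sqrt_series X x) \<le> (\<Sum>n. \<bar>sqrt_coeff n\<bar>) * norm x" .
qed

lemma sqrt_series_square:
  assumes X: "contraction X"
  shows "sqrt_series X (sqrt_series X x) = x - X x"
proof -
  have "(X ^^ n) (sqrt_series X x) = (\<Sum>m. sqrt_coeff m *\<^sub>R (X ^^ (n + m)) x)" for n
    using bounded_linear.sums[OF bounded_clinearD(1)[OF contraction_funpow_linear[OF X]] sqrt_series_sums[OF X], of n x]
    by (simp add: bounded_clinearD[OF contraction_funpow_linear[OF X]] funpow_add sums_iff)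
  then have "sqrt_series X (sqrt_series X x) =
      (\<Sum>n. sqrt_coeff n *\<^sub>R (\<Sum>m. sqrt_coeff m *\<^sub>R (X ^^ (n + m)) x))"
    by (simp add: sqrt_series_def[of X "sqrt_series X x"])
  also have "\<dots> = (\<Sum>k. (\<Sum>i\<le>k. sqrt_coeff i * sqrt_coeff (k - i)) *\<^sub>R (X ^^ k) x)"
    by (intro suminf_Cauchy_product_scaleR[where K = "norm x"] summable_abs_sqrt_coeff
        norm_contraction_funpow_le X)
  also have "\<dots> = (\<Sum>k\<in>{0,1}. (\<Sum>i\<le>k. sqrt_coeff i * sqrt_coeff (k - i)) *\<^sub>R (X ^^ k) x)"
    by (intro suminf_finite) (auto simp: sqrt_coeff_convolution)
  also have "\<dots> = x - X x"
    unfolding sqrt_coeff_convolution by simp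
  finally show ?thesis .
qed

text \<open>The quadratic forms of the powers of \<open>X\<close> are at most
  \<open>(norm x)\<^sup>2\<close>, with equality at the power 0, and all later coefficients are
  nonpositive. So the partial sums are at least \<open>(norm x)\<^sup>2\<close> times the
  nonnegative partial sums of the coefficients.\<close>

lemma positive_op_sqrt_series:
  assumes X: "contraction X" and sa: "\<And>x y. cinner (X x) y = cinner x (X y)"
  shows "positive_op (sqrt_series X)"
  unfolding positive_op_def
proof
  fix x
  have sa_n: "cinner ((X ^^ n) x) y = cinner x ((X ^^ n) y)" for n x y
  proof (induction n arbitrary: y)
    case (Suc n)
    then show ?case
      by (simp add: sa) (simp add: funpow_swap1)
  qed simp
  have im: "Im (cinner x ((X ^^ n) x)) = 0" for n
    using sa_n[of n x x] cinner_commute[of "(X ^^ n) x" x] by (simp add: complex_eq_iff)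
  have "(\<lambda>n. cinner x (sqrt_coeff n *\<^sub>R (X ^^ n) x)) sums cinner x (sqrt_series X x)"
    by (intro sums_cinner_right sqrt_series_sums X)
  then have s: "(\<lambda>n. complex_of_real (sqrt_coeff n) * cinner x ((X ^^ n) x)) sums cinner x (sqrt_series X x)"
    by (simp add: cinner_scaleR_right)
  have "(\<lambda>n. 0) sums Im (cinner x (sqrt_series X x))"
    using sums_Im[OF s] by (simp add: im)
  then have "Im (cinner x (sqrt_series X x)) = 0"
    using sums_unique2 sums_zero by blast
  moreover have "0 \<le> Re (cinner x (sqrt_series X x))"
  proof (rule LIMSEQ_le_const)
    show "(\<lambda>N. \<Sum>n\<le>N. sqrt_coeff n * Re (cinner x ((X ^^ n) x))) \<longlonglongrightarrow> Re (cinner x (sqrt_series X x))"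
      using sums_Re[OF s] by (simp add: im sums_def_le)
    have "0 \<le> (\<Sum>n\<le>N. sqrt_coeff n * Re (cinner x ((X ^^ n) x)))" for N
    proof -
      have "0 \<le> (\<Sum>n\<le>N. sqrt_coeff n) * (norm x)\<^sup>2"
        by (intro mult_nonneg_nonneg sum_sqrt_coeff_nonneg) simp
      also have "\<dots> = (\<Sum>n\<le>N. sqrt_coeff n * (norm x)\<^sup>2)"
        by (rule sum_distrib_right)
      also have "\<dots> \<le> (\<Sum>n\<le>N. sqrt_coeff n * Re (cinner x ((X ^^ n) x)))"
      proof (rule sum_mono)
        fix n
        have "Re (cinner x ((X ^^ n) x)) \<le> norm x * norm ((X ^^ n) x)"
          using complex_Re_le_cmod cinner_norm_le order_trans by blast
        also have "\<dots> \<le> norm x * norm x"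
          by (intro mult_left_mono norm_contraction_funpow_le X) auto
        finally have *: "Re (cinner x ((X ^^ n) x)) \<le> (norm x)\<^sup>2"
          by (simp add: power2_eq_square)
        show "sqrt_coeff n * (norm x)\<^sup>2 \<le> sqrt_coeff n * Re (cinner x ((X ^^ n) x))"
        proof (cases "n = 0")
          case True
          then show ?thesis by (simp add: cinner_self)
        next
          case False
          then show ?thesis
            using * by (intro mult_left_mono_neg sqrt_coeff_nonpos) auto
        qed
      qed
      finally show ?thesis .
    qed
    then show "\<exists>N0. \<forall>N\<ge>N0. 0 \<le> (\<Sum>n\<le>N. sqrt_coeff n * Re (cinner x ((X ^^ n) x)))"
      by blast
  qed
  ultimately show "Im (cinner x (sqrt_series X x)) = 0 \<and> 0 \<le> Re (cinner x (sqrt_series X x))"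
    by blast
qed

text \<open>Supplies, term by term, the commutation that uniqueness of positive roots relies
  on.\<close>

lemma sqrt_series_commute:
  assumes X: "contraction X" and R: "bounded_clinear R" and comm: "\<And>x. R (X x) = X (R x)"
  shows "R (sqrt_series X x) = sqrt_series X (R x)"
proof -
  have "R ((X ^^ n) x) = (X ^^ n) (R x)" for n
    by (induction n) (simp_all add: comm)
  then have "(\<lambda>n. sqrt_coeff n *\<^sub>R (X ^^ n) (R x)) sums R (sqrt_series X x)"
    using bounded_linear.sums[OF bounded_clinearD(1)[OF R] sqrt_series_sums[OF X, of x]]
    by (simp add: bounded_clinearD(6)[OF R])
  then show ?thesis
    using sums_unique2 sqrt_series_sums[OF X] by blast
qed

text \<open>Polarisation: reality of the form at \<open>x + y\<close> and at
  \<open>x + scaleC \<i> y\<close> settles the imaginary and the real part.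
  \<open>positive_op\<close> speaks only of the form, so self-adjointness has to be derived.\<close>

lemma positive_op_selfadjoint:
  assumes "bounded_clinear S" "positive_op S"
  shows "cinner (S x) y = cinner x (S y)"
proof -
  note lin = bounded_clinearD[OF assms(1)]
  have im: "Im (cinner z (S z)) = 0" for z
    using assms(2) by (simp add: positive_op_def)
  have "Im (cinner x (S y)) + Im (cinner y (S x)) = 0"
    using im[of "x + y"] im[of x] im[of y] by (simp add: lin cinner_add_left cinner_add_right)
  moreover have "Re (cinner x (S y)) - Re (cinner y (S x)) = 0"
    using im[of "x + scaleC \<i> y"] im[of x] im[of y]
    by (simp add: lin cinner_add_left cinner_add_right cinner_scaleC_left cinner_scaleC_right)
  ultimately show ?thesis
    using cinner_commute[of "S x" y] by (simp add: complex_eq_iff)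
qed

lemma positive_op_zero:
  assumes S: "bounded_clinear S" "positive_op S" and "cinner y (S y) = 0"
  shows "S y = 0"
proof -
  note lin = bounded_clinearD[OF S(1)]
  define w where "w = S y"
  define c where "c = Re (cinner w (S w))"
  have c: "0 \<le> c"
    using S(2) by (simp add: positive_op_def c_def)
  \<comment> \<open>Nonnegativity is tested at \<open>y + t *\<^sub>R w\<close>, where the form is
    \<open>2 * t * (norm w)\<^sup>2 + t\<^sup>2 * c\<close>. This is nearly the minimising
    \<open>t\<close>; \<open>c + 1\<close> in place of \<open>c\<close> avoids a zero
    denominator.\<close>
  define t where "t = - ((norm w)\<^sup>2 / (c + 1))"
  have "cinner y (S w) = of_real ((norm w)\<^sup>2)"
    using positive_op_selfadjoint[OF S, of y w] by (simp add: cinner_self flip: w_def)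
  then have "Re (cinner (y + t *\<^sub>R w) (S (y + t *\<^sub>R w))) = 2 * t * (norm w)\<^sup>2 + t\<^sup>2 * c"
    using assms(3)
    by (simp add: lin cinner_add_left cinner_add_right cinner_scaleR_left cinner_scaleR_right
        cinner_self c_def power2_eq_square algebra_simps flip: w_def)
  then have "0 \<le> 2 * t * (norm w)\<^sup>2 + t\<^sup>2 * c"
    using S(2) by (metis positive_op_def)
  also have "\<dots> = - (((norm w)\<^sup>2)\<^sup>2 * (c + 2) / (c + 1)\<^sup>2)"
    using c by (simp add: t_def power2_eq_square divide_simps) (simp add: algebra_simps)
  finally have "((norm w)\<^sup>2)\<^sup>2 * (c + 2) / (c + 1)\<^sup>2 \<le> 0"
    by simp
  with c have "norm w = 0"
    by (simp add: divide_le_0_iff mult_le_0_iff)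
  then show ?thesis
    by (simp add: w_def)
qed

text \<open>For \<open>y = S x - R x\<close>, commutation turns equality of the squares into
  \<open>S y + R y = 0\<close>. Both nonnegative forms therefore vanish at \<open>y\<close>, hence
  \<open>S y = 0\<close> and \<open>R y = 0\<close>, and moving \<open>S - R\<close> across
  \<open>cinner y y\<close> gives \<open>y = 0\<close>.\<close>

lemma positive_sqrt_unique:
  assumes S: "bounded_clinear S" "positive_op S" and R: "bounded_clinear R" "positive_op R"
    and sq: "\<And>x. S (S x) = R (R x)" and comm: "\<And>x. R (S x) = S (R x)"
  shows "R x = S x"
proof -
  note linS = bounded_clinearD[OF S(1)] and linR = bounded_clinearD[OF R(1)]
  define y where "y = S x - R x"
  have eq: "S y + R y = 0"
    by (simp add: y_def linS linR sq comm)
  have "cinner y (S y) + cinner y (R y) = 0"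
    using eq cinner_add_right[of y "S y" "R y"] by simp
  moreover have "Im (cinner y (S y)) = 0 \<and> 0 \<le> Re (cinner y (S y))"
    "Im (cinner y (R y)) = 0 \<and> 0 \<le> Re (cinner y (R y))"
    using S R by (auto simp: positive_op_def)
  ultimately have "cinner y (S y) = 0" "cinner y (R y) = 0"
    by (auto simp: complex_eq_iff)
  then have "S y = 0" "R y = 0"
    using positive_op_zero S R by blast+
  then have "cinner y y = 0"
    unfolding y_def using positive_op_selfadjoint[OF S, of x y] positive_op_selfadjoint[OF R, of x y]
    by (simp add: y_def[symmetric]) (simp add: y_def cinner_diff_left)
  then show ?thesis
    by (simp add: cinner_eq_zero_iff y_def)
qed

text \<open>Any root of \<open>1 - X\<close> commutes with its own square, hence with
  \<open>X\<close>, hence with the series, so all positive roots equal the series. Stated for an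
  arbitrary root \<open>R\<close> because it is used both with the series and with a projection that
  is its own root.\<close>

lemma op_sqrt_eqI:
  fixes X :: "'a::chilbert_space \<Rightarrow> 'a"
  assumes X: "contraction X" "\<And>x y. cinner (X x) y = cinner x (X y)"
    and R: "bounded_clinear R" "positive_op R" "\<And>x. R (R x) = x - X x"
  shows "op_sqrt (\<lambda>x. x - X x) = R"
proof -
  have *: "R' = sqrt_series X" if R': "bounded_clinear R'" "positive_op R'" "R' \<circ> R' = (\<lambda>x. x - X x)" for R'
  proof
    fix x
    have sq: "R' (R' x) = x - X x" for x
      using R'(3) by (simp add: fun_eq_iff)
    have "R' (x - X x) = R' x - X (R' x)" for x
      using sq[of "R' x"] sq[of x] by simp
    then have comm: "R' (X x) = X (R' x)" for x
      by (simp add: bounded_clinearD[OF R'(1)])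
    show "R' x = sqrt_series X x"
      by (rule positive_sqrt_unique[OF bounded_clinear_sqrt_series[OF X(1)] positive_op_sqrt_series[OF X] R'(1,2)])
         (simp_all add: sqrt_series_square[OF X(1)] sq sqrt_series_commute[OF X(1) R'(1) comm])
  qed
  have "R = sqrt_series X"
    by (rule *) (use R in \<open>auto simp: fun_eq_iff\<close>)
  with * have "R' = R" if "bounded_clinear R' \<and> positive_op R' \<and> R' \<circ> R' = (\<lambda>x. x - X x)" for R'
    using that by metis
  then show ?thesis
    unfolding op_sqrt_def by (intro the_equality) (use R in \<open>auto simp: fun_eq_iff\<close>)
qed

section \<open>The defect operator of a contraction\<close>

lemma contraction_T_adj:
  fixes T :: "'a::chilbert_space \<Rightarrow> 'a"
  assumes T: "contraction T"
  shows "contraction (\<lambda>x. T (adj T x))" "cinner (T (adj T x)) y = cinner x (T (adj T y))"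
proof -
  have b: "bounded_clinear T" "bounded_clinear (adj T)"
    using T contraction_adj by (auto simp: contraction_def)
  show "contraction (\<lambda>x. T (adj T x))"
    using T contraction_adj[OF T] bounded_clinear_compose[OF b]
    by (auto simp: contraction_def intro: order_trans)
  show "cinner (T (adj T x)) y = cinner x (T (adj T y))"
    by (simp add: cinner_adj[OF b(1)] cinner_adj'[OF b(1)])
qed

lemma defect_contraction:
  fixes T :: "'a::chilbert_space \<Rightarrow> 'a"
  assumes T: "contraction T"
  shows "bounded_clinear (defect T)" "cinner (defect T x) y = cinner x (defect T y)"
    "defect T (defect T x) = x - T (adj T x)"
proof -
  note X = contraction_T_adj[OF T]
  have eq: "defect T = sqrt_series (\<lambda>x. T (adj T x))"
    unfolding defect_def
    by (rule op_sqrt_eqI[OF X bounded_clinear_sqrt_series positive_op_sqrt_series sqrt_series_square]) (use X in auto)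
  show "bounded_clinear (defect T)" "defect T (defect T x) = x - T (adj T x)"
    using X by (simp_all add: eq bounded_clinear_sqrt_series sqrt_series_square)
  show "cinner (defect T x) y = cinner x (defect T y)"
    unfolding eq by (rule positive_op_selfadjoint[OF bounded_clinear_sqrt_series positive_op_sqrt_series]) (use X in auto)
qed

text \<open>The source of the telescoping sums: the defect records exactly the squared norm lost
  under \<open>adj T\<close>.\<close>

lemma norm_defect_sq:
  fixes T :: "'a::chilbert_space \<Rightarrow> 'a"
  assumes T: "contraction T"
  shows "(norm (defect T x))\<^sup>2 = (norm x)\<^sup>2 - (norm (adj T x))\<^sup>2"
proof -
  have b: "bounded_clinear T"
    using T by (simp add: contraction_def)
  have "complex_of_real ((norm (defect T x))\<^sup>2) = cinner x (defect T (defect T x))"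
    using defect_contraction(2)[OF T, of x "defect T x"] by (simp only: cinner_self)
  also have "\<dots> = cinner x x - cinner (adj T x) (adj T x)"
    by (simp add: defect_contraction(3)[OF T] cinner_diff_right cinner_adj'[OF b])
  also have "\<dots> = complex_of_real ((norm x)\<^sup>2 - (norm (adj T x))\<^sup>2)"
    by (simp add: cinner_self)
  finally show ?thesis
    using of_real_eq_iff by blast
qed

subsection \<open>The resolvent as a Neumann series\<close>

lemma summable_neumann:
  fixes T :: "'a::chilbert_space \<Rightarrow> 'a"
  assumes "contraction T" "cmod w < 1"
  shows "summable (\<lambda>n. norm (scaleC (w ^ n) ((T ^^ n) x)))"
proof (rule summable_comparison_test'[of "\<lambda>n. cmod w ^ n * norm x" 0])
  show "summable (\<lambda>n. cmod w ^ n * norm x)"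
    using assms(2) by (intro summable_mult2 summable_geometric) simp
  show "norm (norm (scaleC (w ^ n) ((T ^^ n) x))) \<le> cmod w ^ n * norm x" for n
    by (simp add: norm_scaleC norm_power mult_left_mono norm_contraction_funpow_le assms)
qed

text \<open>\<open>op_inv\<close> ranges over all functions, linear or not, and a two-sided inverse
  is unique among them; so it suffices to check the Neumann series from both sides.\<close>

lemma op_inv_neumann:
  fixes T :: "'a::chilbert_space \<Rightarrow> 'a"
  assumes T: "contraction T" and w: "cmod w < 1"
  shows "op_inv (\<lambda>x. x - scaleC w (T x)) = (\<lambda>x. \<Sum>n. scaleC (w ^ n) ((T ^^ n) x))"
    and "op_inv (\<lambda>x. x - scaleC w (T x)) x - scaleC w (T (op_inv (\<lambda>x. x - scaleC w (T x)) x)) = x"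
    and "op_inv (\<lambda>x. x - scaleC w (T x)) (x - scaleC w (T x)) = x"
proof -
  define R where "R = (\<lambda>x. \<Sum>n. scaleC (w ^ n) ((T ^^ n) x))"
  define A where "A = (\<lambda>x. x - scaleC w (T x))"
  have bT: "bounded_clinear T"
    using T by (simp add: contraction_def)
  note lin = bounded_clinearD[OF bT] and linn = bounded_clinearD[OF contraction_funpow_linear[OF T]]
  have R: "(\<lambda>n. scaleC (w ^ n) ((T ^^ n) x)) sums R x" for x
    unfolding R_def by (rule summable_sums[OF summable_norm_cancel[OF summable_neumann[OF T w]]])
  have sh: "(\<lambda>n. scaleC (w ^ Suc n) ((T ^^ Suc n) x)) sums (R x - x)" for x
    using R[of x] by (subst sums_Suc_iff) (simp add: scaleC_one)
  have "(\<lambda>n. scaleC w (T (scaleC (w ^ n) ((T ^^ n) x)))) sums scaleC w (T (R x))" for x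
    by (intro sums_scaleC_right bounded_linear.sums[OF lin(1)] R)
  then have "(\<lambda>n. scaleC (w ^ Suc n) ((T ^^ Suc n) x)) sums scaleC w (T (R x))" for x
    by (simp add: lin scaleC_scaleC)
  then have "scaleC w (T (R x)) = R x - x" for x
    using sums_unique2[OF sh] by metis
  then have 1: "A (R x) = x" for x
    by (simp add: A_def)
  have "(\<lambda>n. scaleC (w ^ n) ((T ^^ n) x) - scaleC (w ^ Suc n) ((T ^^ Suc n) x)) sums (R x - (R x - x))" for x
    by (intro sums_diff R sh)
  then have "(\<lambda>n. scaleC (w ^ n) ((T ^^ n) (A x))) sums x" for x
    by (simp add: A_def linn scaleC_diff_right scaleC_scaleC funpow_swap1 mult.commute)
  then have 2: "R (A x) = x" for x
    using sums_unique2[OF R] by blast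
  have "op_inv A = R"
    unfolding op_inv_def
  proof (rule the_equality)
    show "A \<circ> R = id \<and> R \<circ> A = id"
      using 1 2 by (simp add: fun_eq_iff)
    show "B = R" if "A \<circ> B = id \<and> B \<circ> A = id" for B
    proof
      fix x
      show "B x = R x"
        using that 1[of x] by (metis comp_apply id_apply)
    qed
  qed
  then show "op_inv (\<lambda>x. x - scaleC w (T x)) = (\<lambda>x. \<Sum>n. scaleC (w ^ n) ((T ^^ n) x))"
    "op_inv (\<lambda>x. x - scaleC w (T x)) x - scaleC w (T (op_inv (\<lambda>x. x - scaleC w (T x)) x)) = x"
    "op_inv (\<lambda>x. x - scaleC w (T x)) (x - scaleC w (T x)) = x"
    using 1[of x] 2[of x] by (simp_all add: A_def R_def)
qed

subsection \<open>Hilbert space valued power series on the unit disc\<close>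

text \<open>Scalars are made a Hilbert space so that scalar power series, such as the geometric
  series behind the Poisson kernel, fall under the vector valued results.\<close>

instantiation complex :: complex_vector
begin
definition scaleC_complex :: "complex \<Rightarrow> complex \<Rightarrow> complex" where
  "scaleC_complex a b = a * b"
instance
  by standard (auto simp: scaleC_complex_def algebra_simps scaleR_conv_of_real)
end

instantiation complex :: complex_inner
begin
definition cinner_complex :: "complex \<Rightarrow> complex \<Rightarrow> complex" where
  "cinner_complex a b = cnj a * b"
instance
proof
  fix x y :: complex
  show "cinner x y = cnj (cinner y x)"
    by (simp add: cinner_complex_def)
  have *: "cinner x x = of_real ((cmod x)\<^sup>2)"
    by (simp add: cinner_complex_def complex_norm_square mult.commute flip: of_real_power)
  show "Im (cinner x x) = 0 \<and> 0 \<le> Re (cinner x x)" "cinner x x = 0 \<longleftrightarrow> x = 0"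
    "norm x = sqrt (Re (cinner x x))"
    unfolding * by simp_all
qed (auto simp: cinner_complex_def scaleC_complex_def algebra_simps)
end

instance complex :: chilbert_space ..

text \<open>With the coefficients \<open>(T ^^ n) x\<close> and \<open>cmod w < 1\<close> this is
  the resolvent of a contraction \<open>T\<close> applied to \<open>x\<close>.\<close>

definition vps :: "(nat \<Rightarrow> 'a::chilbert_space) \<Rightarrow> complex \<Rightarrow> 'a" where
  "vps a w = (\<Sum>n. scaleC (w ^ n) (a n))"

lemma norm_vps_term_le:
  assumes "cmod w \<le> 1"
  shows "norm (scaleC (w ^ n) (a n)) \<le> norm (a n :: 'a::complex_inner)"
  using assms by (simp add: norm_scaleC norm_power mult_left_le_one_le power_le_one)

lemma summable_norm_vps:
  assumes "summable (\<lambda>n. norm (a n))" "cmod w \<le> 1"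
  shows "summable (\<lambda>n. norm (scaleC (w ^ n) (a n :: 'a::chilbert_space)))"
  by (rule summable_comparison_test'[OF assms(1), of 0]) (simp add: norm_vps_term_le assms)

lemma vps_sums:
  assumes "summable (\<lambda>n. norm (a n))" "cmod w \<le> 1"
  shows "(\<lambda>n. scaleC (w ^ n) (a n)) sums vps a w"
  unfolding vps_def by (rule summable_sums[OF summable_norm_cancel[OF summable_norm_vps[OF assms]]])

lemma continuous_on_vps:
  assumes "summable (\<lambda>n. norm (a n))"
  shows "continuous_on (cball 0 1) (vps a)"
proof (rule uniform_limit_theorem)
  show "uniform_limit (cball 0 1) (\<lambda>N w. \<Sum>n<N. scaleC (w ^ n) (a n)) (vps a) sequentially"
    unfolding vps_def by (rule Weierstrass_m_test[OF _ assms]) (simp add: norm_vps_term_le)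
  show "\<forall>\<^sub>F N in sequentially. continuous_on (cball 0 1) (\<lambda>w. \<Sum>n<N. scaleC (w ^ n) (a n))"
    by (intro always_eventually allI continuous_on_sum continuous_on_scaleC continuous_intros)
qed simp

lemma continuous_on_vps_comp:
  assumes "summable (\<lambda>n. norm (a n))" "continuous_on S g" "\<And>x. x \<in> S \<Longrightarrow> cmod (g x) \<le> 1"
  shows "continuous_on S (\<lambda>x. vps a (g x))"
  by (rule continuous_on_compose2[OF continuous_on_vps[OF assms(1)] assms(2)]) (use assms(3) in auto)

text \<open>The negative exponent makes this the conjugate of the point \<open>z\<close> in
  \<open>curvature\<close>, because the resolvent of \<open>T\<close> occurs there at
  \<open>r * cnj z\<close>.\<close>

definition ucirc :: "real \<Rightarrow> complex" where
  "ucirc t = exp (- (2 * of_real pi * \<i> * of_real t))"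

lemma norm_ucirc [simp]: "cmod (ucirc t) = 1"
  by (simp add: ucirc_def)

lemma continuous_on_ucirc [continuous_intros]:
  "continuous_on S f \<Longrightarrow> continuous_on S (\<lambda>x. ucirc (f x))"
  unfolding ucirc_def by (intro continuous_intros)

lemma ucirc_add: "ucirc (s + t) = ucirc s * ucirc t"
  by (simp add: ucirc_def algebra_simps flip: exp_add)

text \<open>The period is left arbitrary: Parseval is later used on \<open>{-1/2..1/2}\<close>,
  \<open>{1/2..3/2}\<close> and \<open>{0..1}\<close>.\<close>

lemma ucirc_orthonormal:
  "((\<lambda>t. cnj (ucirc t ^ m) * ucirc t ^ n) has_integral (if m = n then 1 else 0)) {x..x + 1}"
proof (cases "m = n")
  case True
  have "cnj (ucirc t ^ n) * ucirc t ^ n = 1" for t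
    using complex_norm_square[of "ucirc t ^ n"] by (simp add: norm_power mult.commute)
  then show ?thesis
    using True has_integral_const_real[of "1::complex" x "x + 1"] by simp
next
  case False
  define c :: complex where "c = 2 * of_real pi * \<i> * (of_nat m - of_nat n)"
  have "c \<noteq> 0"
    using False by (simp add: c_def)
  have eq: "cnj (ucirc t ^ m) * ucirc t ^ n = exp (c * of_real t)" for t
  proof -
    have "cnj (ucirc t ^ m) = exp (of_nat m * (2 * of_real pi * \<i> * of_real t))"
      by (simp add: ucirc_def exp_cnj exp_of_nat_mult)
    moreover have "ucirc t ^ n = exp (of_nat n * - (2 * of_real pi * \<i> * of_real t))"
      by (simp add: ucirc_def flip: exp_of_nat_mult)
    ultimately show ?thesis
      by (simp add: c_def algebra_simps flip: exp_add)
  qed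
  have "((\<lambda>t. exp (c * of_real t)) has_integral
      (exp (c * of_real (x + 1)) / c - exp (c * of_real x) / c)) {x..x + 1}"
  proof (rule fundamental_theorem_of_calculus)
    fix t
    have "((\<lambda>z. exp (c * z) / c) has_field_derivative exp (c * of_real t)) (at (of_real t))"
      using \<open>c \<noteq> 0\<close> by (auto intro!: derivative_eq_intros)
    then show "((\<lambda>t. exp (c * of_real t) / c) has_vector_derivative exp (c * of_real t)) (at t within {x..x + 1})"
      by (rule has_vector_derivative_real_field)
  qed simp
  moreover have "exp (c * of_real (x + 1)) = exp (c * of_real x)"
  proof -
    have "c = 2 * of_real pi * \<i> * of_int (int m - int n)"
      by (simp add: c_def)
    then have "exp c = 1"
      by (simp only: exp_eq_1) (auto intro!: exI[of _ "int m - int n"])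
    then show ?thesis
      by (simp add: algebra_simps exp_add)
  qed
  ultimately show ?thesis
    unfolding eq using False by simp
qed

lemma has_integral_norm_trig_poly:
  "((\<lambda>t. (norm (\<Sum>n<N. scaleC (ucirc t ^ n) (a n :: 'a::complex_inner)))\<^sup>2)
     has_integral (\<Sum>n<N. (norm (a n))\<^sup>2)) {x..x + 1}"
proof -
  have "((\<lambda>t. \<Sum>m<N. \<Sum>n<N. cnj (ucirc t ^ m) * ucirc t ^ n * cinner (a m) (a n)) has_integral
     (\<Sum>m<N. \<Sum>n<N. (if m = n then 1 else 0) * cinner (a m) (a n))) {x..x + 1}"
    by (intro has_integral_sum finite_lessThan has_integral_mult_left ucirc_orthonormal)
  also have "(\<Sum>m<N. \<Sum>n<N. (if m = n then 1 else 0) * cinner (a m) (a n))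
      = complex_of_real (\<Sum>n<N. (norm (a n))\<^sup>2)"
    by (simp add: if_distrib[of "\<lambda>x. x * _"] cinner_self cong: if_cong)
  also have "(\<lambda>t. \<Sum>m<N. \<Sum>n<N. cnj (ucirc t ^ m) * ucirc t ^ n * cinner (a m) (a n)) =
      (\<lambda>t. complex_of_real ((norm (\<Sum>n<N. scaleC (ucirc t ^ n) (a n)))\<^sup>2))"
    by (simp only: cinner_self[symmetric] cinner_sum_left)
       (simp only: cinner_sum_right cinner_scaleC_left cinner_scaleC_right mult_ac)
  finally have "((\<lambda>t. complex_of_real ((norm (\<Sum>n<N. scaleC (ucirc t ^ n) (a n)))\<^sup>2))
      has_integral complex_of_real (\<Sum>n<N. (norm (a n))\<^sup>2)) {x..x + 1}" .
  from has_integral_linear[OF this bounded_linear_Re] show ?thesis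
    by (simp only: o_def Re_complex_of_real)
qed

text \<open>Trigonometric partial sums are dominated by the square of the sum of the coefficient
  norms. Convergence of their integrals delivers summability of the squares along the way.\<close>

lemma vps_parseval:
  assumes a: "summable (\<lambda>n. norm (a n))"
  shows "((\<lambda>t. (norm (vps a (ucirc t)))\<^sup>2) has_integral (\<Sum>n. (norm (a n))\<^sup>2)) {x..x + 1}"
    and "summable (\<lambda>n. (norm (a n))\<^sup>2)"
proof -
  define f where "f = (\<lambda>N t. (norm (\<Sum>n<N. scaleC (ucirc t ^ n) (a n)))\<^sup>2)"
  define g where "g = (\<lambda>t. (norm (vps a (ucirc t)))\<^sup>2)"
  have f: "f N integrable_on {x..x + 1}" "integral {x..x + 1} (f N) = (\<Sum>n<N. (norm (a n))\<^sup>2)" for N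
    using has_integral_norm_trig_poly[where N = N and a = a and x = x] unfolding f_def by (auto simp: has_integral_iff)
  have bound: "norm (f N t) \<le> (\<Sum>n. norm (a n))\<^sup>2" for N t
  proof -
    have "norm (\<Sum>n<N. scaleC (ucirc t ^ n) (a n)) \<le> (\<Sum>n<N. norm (a n))"
      by (rule sum_norm_le) (simp add: norm_vps_term_le)
    also have "\<dots> \<le> (\<Sum>n. norm (a n))"
      by (rule sum_le_suminf[OF a]) auto
    finally show ?thesis
      by (simp add: f_def power_mono)
  qed
  have conv: "(\<lambda>N. f N t) \<longlonglongrightarrow> g t" for t
    unfolding f_def g_def
    using vps_sums[OF a, of "ucirc t"] by (intro tendsto_intros) (simp add: sums_def)
  have g: "g integrable_on {x..x + 1}"
    and lim: "(\<lambda>N. integral {x..x + 1} (f N)) \<longlonglongrightarrow> integral {x..x + 1} g"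
    using dominated_convergence[of f "{x..x + 1}" "\<lambda>_. (\<Sum>n. norm (a n))\<^sup>2" g, OF f(1) _ bound conv]
    by (auto intro: integrable_const_ivl)
  have "(\<lambda>n. (norm (a n))\<^sup>2) sums integral {x..x + 1} g"
    using lim by (simp add: f(2) sums_def)
  with g show "((\<lambda>t. (norm (vps a (ucirc t)))\<^sup>2) has_integral (\<Sum>n. (norm (a n))\<^sup>2)) {x..x + 1}"
    "summable (\<lambda>n. (norm (a n))\<^sup>2)"
    unfolding g_def by (auto simp: has_integral_iff sums_iff)
qed

subsection \<open>The Poisson kernel\<close>

definition poisson :: "real \<Rightarrow> real \<Rightarrow> real" where
  "poisson r h = (1 - r\<^sup>2) / (cmod (1 - of_real r * ucirc h))\<^sup>2"

lemma poisson_denom: "(cmod (1 - of_real r * ucirc h))\<^sup>2 = 1 - 2 * r * cos (2 * pi * h) + r\<^sup>2"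
proof -
  have eq: "(1 - r * c)\<^sup>2 + (r * s)\<^sup>2 = 1 - 2 * r * c + r\<^sup>2 * (c\<^sup>2 + s\<^sup>2)" for c s :: real
    by (simp add: power2_eq_square algebra_simps)
  have "ucirc h = cis (- (2 * pi * h))"
    by (simp add: ucirc_def cis_conv_exp mult_ac)
  then have "(cmod (1 - of_real r * ucirc h))\<^sup>2
      = (1 - r * cos (2 * pi * h))\<^sup>2 + (r * sin (2 * pi * h))\<^sup>2"
    by (simp add: cmod_power2)
  also have "\<dots> = 1 - 2 * r * cos (2 * pi * h) + r\<^sup>2 * ((cos (2 * pi * h))\<^sup>2 + (sin (2 * pi * h))\<^sup>2)"
    by (rule eq)
  finally show ?thesis
    by simp
qed

lemma one_minus_ucirc_nonzero:
  assumes "0 \<le> r" "r < 1"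
  shows "1 - of_real r * ucirc h \<noteq> 0"
proof
  assume "1 - of_real r * ucirc h = 0"
  then have "cmod (of_real r * ucirc h) = 1"
    by (metis eq_iff_diff_eq_0 norm_one)
  then show False
    using assms by (simp add: norm_mult)
qed

lemma poisson_nonneg: "0 \<le> r \<Longrightarrow> r < 1 \<Longrightarrow> 0 \<le> poisson r h"
  by (simp add: poisson_def power_le_one)

lemma poisson_minus: "poisson r (- h) = poisson r h"
  by (simp add: poisson_def poisson_denom)

lemma continuous_on_poisson:
  assumes "0 \<le> r" "r < 1"
  shows "continuous_on S (poisson r)"
  unfolding poisson_def[abs_def]
  using one_minus_ucirc_nonzero[OF assms] by (intro continuous_intros) auto

lemma poisson_antimono:
  assumes "0 \<le> r" "r < 1" "0 \<le> x" "x \<le> y" "y \<le> 1 / 2"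
  shows "poisson r y \<le> poisson r x"
proof -
  have "cos (2 * pi * y) \<le> cos (2 * pi * x)"
    using assms by (intro cos_monotone_0_pi_le) auto
  then have "2 * r * cos (2 * pi * y) \<le> 2 * r * cos (2 * pi * x)"
    using assms by (intro mult_left_mono) auto
  moreover have "0 < (cmod (1 - of_real r * ucirc x))\<^sup>2" "0 < (cmod (1 - of_real r * ucirc y))\<^sup>2"
    using one_minus_ucirc_nonzero[OF assms(1,2)] by auto
  ultimately show ?thesis
    using assms unfolding poisson_def poisson_denom by (intro divide_left_mono) (auto simp: power_le_one)
qed

text \<open>Parseval for the geometric series with coefficients \<open>r ^ n\<close>: its boundary
  function is \<open>1 / (1 - r * ucirc h)\<close>, and the squared coefficients add up to
  \<open>1 / (1 - r\<^sup>2)\<close>.\<close>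

lemma has_integral_poisson:
  assumes "0 \<le> r" "r < 1"
  shows "(poisson r has_integral 1) {-1/2..1/2}"
proof -
  have r2: "r\<^sup>2 < 1"
    using assms by (simp add: power2_eq_square mult_strict_mono'[of r 1 r 1, simplified])
  have a: "summable (\<lambda>n. norm (complex_of_real r ^ n))"
    using assms by (simp add: norm_power summable_geometric)
  have "vps (\<lambda>n. complex_of_real r ^ n) (ucirc t) = 1 / (1 - of_real r * ucirc t)" for t
    using suminf_geometric[of "of_real r * ucirc t"] assms
    by (simp add: vps_def scaleC_complex_def norm_mult power_mult_distrib mult.commute)
  moreover have "(\<lambda>n. (r\<^sup>2) ^ n) sums (1 / (1 - r\<^sup>2))"
    using r2 by (intro geometric_sums) simp
  then have "(\<Sum>n. (norm (complex_of_real r ^ n))\<^sup>2) = 1 / (1 - r\<^sup>2)"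
    using assms by (simp add: norm_power sums_iff flip: power_mult) (simp add: mult.commute)
  ultimately have "((\<lambda>t. (1 - r\<^sup>2) * (cmod (1 / (1 - of_real r * ucirc t)))\<^sup>2) has_integral (1 - r\<^sup>2) * (1 / (1 - r\<^sup>2))) {-1/2..-1/2+1}"
    using vps_parseval(1)[OF a, of "-1/2"] by (intro has_integral_mult_right) simp
  then show ?thesis
    using r2 by (simp add: poisson_def[abs_def] norm_divide power_divide)
qed

text \<open>Multiplying by the boundary values of \<open>(1 - r w)\<^sup>-\<^sup>1\<close>, whose squared modulus is the Poisson
  kernel up to the factor \<open>1 - r\<^sup>2\<close>, reduces the bound to the evaluation estimate in the Hardy space.\<close>
lemma poisson_subharmonic:
  fixes c :: "nat \<Rightarrow> 'a::chilbert_space"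
  assumes c: "summable (\<lambda>n. norm (c n))" and r: "0 \<le> r" "r < 1"
  shows "(norm (vps c (of_real r)))\<^sup>2 \<le> integral {-1/2..1/2} (\<lambda>h. poisson r h * (norm (vps c (ucirc h)))\<^sup>2)"
proof -
  have r2: "r\<^sup>2 < 1"
    using r by (simp add: power2_eq_square mult_strict_mono'[of r 1 r 1, simplified])
  \<comment> \<open>The coefficients of the quotient of \<open>vps c w\<close> by
    \<open>1 - r * w\<close>; the recursion compares coefficients after multiplying out.\<close>
  define d where "d = rec_nat (c 0) (\<lambda>n v. r *\<^sub>R v + c (Suc n))"
  have d: "d 0 = c 0" "d (Suc n) = r *\<^sub>R d n + c (Suc n)" for n
    by (simp_all add: d_def)
  \<comment> \<open>The extra term \<open>r * norm (d n)\<close> is what the recursion consumes at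
    the next index; without it the induction would not close.\<close>
  have "(1 - r) * (\<Sum>k\<le>n. norm (d k)) + r * norm (d n) \<le> (\<Sum>k\<le>n. norm (c k))" for n
  proof (induction n)
    case (Suc n)
    have "norm (d (Suc n)) \<le> r * norm (d n) + norm (c (Suc n))"
      unfolding d using norm_triangle_ineq[of "r *\<^sub>R d n"] r by simp
    with Suc show ?case
      by (simp add: algebra_simps)
  qed (simp add: d algebra_simps)
  moreover have "(\<Sum>k\<le>n. norm (c k)) \<le> (\<Sum>k. norm (c k))" for n
    by (rule sum_le_suminf[OF c]) auto
  ultimately have "(1 - r) * (\<Sum>k\<le>n. norm (d k)) \<le> (\<Sum>k. norm (c k))" for n
    using mult_nonneg_nonneg[OF r(1) norm_ge_zero[of "d n"]] by (meson add_increasing2 add_le_same_cancel1 order_trans le_add_same_cancel1)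
  then have "(\<Sum>k\<le>n. norm (d k)) \<le> (\<Sum>k. norm (c k)) / (1 - r)" for n
    using r by (simp add: field_simps)
  then have dsum: "summable (\<lambda>n. norm (d n))"
    by (intro bounded_imp_summable) auto
  have fact: "scaleC (1 - of_real r * w) (vps d w) = vps c w" if w: "cmod w \<le> 1" for w
  proof -
    have "(\<lambda>n. scaleC (w ^ Suc n) (d (Suc n))) sums (vps d w - d 0)"
      using vps_sums[OF dsum w] by (subst sums_Suc_iff) (simp add: scaleC_one)
    moreover have "(\<lambda>n. scaleC (w ^ Suc n) (c (Suc n))) sums (vps c w - c 0)"
      using vps_sums[OF c w] by (subst sums_Suc_iff) (simp add: scaleC_one)
    moreover have "(\<lambda>n. scaleC (of_real r * w) (scaleC (w ^ n) (d n))) sums scaleC (of_real r * w) (vps d w)"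
      by (intro sums_scaleC_right vps_sums dsum w)
    ultimately have "(\<lambda>n. scaleC (w ^ Suc n) (d (Suc n)) - (scaleC (of_real r * w) (scaleC (w ^ n) (d n))
        + scaleC (w ^ Suc n) (c (Suc n)))) sums (vps d w - d 0 - (scaleC (of_real r * w) (vps d w) + (vps c w - c 0)))"
      by (intro sums_diff sums_add)
    moreover have "scaleC (w ^ Suc n) (d (Suc n)) - (scaleC (of_real r * w) (scaleC (w ^ n) (d n))
        + scaleC (w ^ Suc n) (c (Suc n))) = 0" for n
      by (simp add: d scaleR_scaleC scaleC_add_right scaleC_scaleC mult_ac)
    ultimately have "vps d w - d 0 - (scaleC (of_real r * w) (vps d w) + (vps c w - c 0)) = 0"
      by (simp add: sums_iff)
    then have "vps d w = scaleC (of_real r * w) (vps d w) + vps c w"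
      by (simp add: d algebra_simps)
    moreover have "vps d w = scaleC (1 - of_real r * w) (vps d w) + scaleC (of_real r * w) (vps d w)"
      by (simp add: scaleC_one flip: scaleC_add_left)
    ultimately show ?thesis
      by (metis add.commute add_left_cancel)
  qed
  define S where "S = (\<Sum>n. (norm (d n))\<^sup>2)"
  note pd = vps_parseval[OF dsum]
  have "poisson r h * (norm (vps c (ucirc h)))\<^sup>2 = (1 - r\<^sup>2) * (norm (vps d (ucirc h)))\<^sup>2" for h
    using one_minus_ucirc_nonzero[OF r, of h] fact[of "ucirc h", symmetric]
    by (simp add: poisson_def norm_scaleC power_mult_distrib)
  then have int: "integral {-1/2..1/2} (\<lambda>h. poisson r h * (norm (vps c (ucirc h)))\<^sup>2) = (1 - r\<^sup>2) * S"
    using pd(1)[of "-1/2"] by (simp add: S_def has_integral_iff)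
  \<comment> \<open>Evaluation at the point \<open>r\<close> is bounded by Cauchy-Schwarz against
    the sequence \<open>r ^ n\<close>, with limits taken only at the end.\<close>
  have "norm (\<Sum>n<N. scaleC (of_real r ^ n) (d n)) \<le> sqrt (S / (1 - r\<^sup>2))" for N
  proof (rule real_le_rsqrt)
    have "norm (\<Sum>n<N. scaleC (of_real r ^ n) (d n)) \<le> (\<Sum>n<N. r ^ n * norm (d n))"
      by (rule sum_norm_le) (use r in \<open>simp add: norm_scaleC norm_power\<close>)
    then have "(norm (\<Sum>n<N. scaleC (of_real r ^ n) (d n)))\<^sup>2 \<le> (\<Sum>n<N. r ^ n * norm (d n))\<^sup>2"
      by (rule power_mono) simp
    also have "\<dots> \<le> (\<Sum>n<N. (r ^ n)\<^sup>2) * (\<Sum>n<N. (norm (d n))\<^sup>2)"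
      by (rule Cauchy_Schwarz_ineq_sum)
    also have "\<dots> \<le> (1 / (1 - r\<^sup>2)) * S"
    proof (rule mult_mono)
      have "(\<lambda>n. (r\<^sup>2) ^ n) sums (1 / (1 - r\<^sup>2))"
        using r2 by (intro geometric_sums) simp
      then have "(\<Sum>n<N. (r\<^sup>2) ^ n) \<le> 1 / (1 - r\<^sup>2)"
        using sum_le_suminf[of "\<lambda>n. (r\<^sup>2) ^ n" "{..<N}"] by (simp add: sums_iff)
      then show "(\<Sum>n<N. (r ^ n)\<^sup>2) \<le> 1 / (1 - r\<^sup>2)"
        by (simp add: power_mult[symmetric] mult.commute)
      show "(\<Sum>n<N. (norm (d n))\<^sup>2) \<le> S"
        unfolding S_def by (rule sum_le_suminf[OF pd(2)]) auto
    qed (use r2 in \<open>auto intro: sum_nonneg\<close>)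
    finally show "(norm (\<Sum>n<N. scaleC (of_real r ^ n) (d n)))\<^sup>2 \<le> S / (1 - r\<^sup>2)"
      by simp
  qed
  moreover have "(\<lambda>N. norm (\<Sum>n<N. scaleC (of_real r ^ n) (d n))) \<longlonglongrightarrow> norm (vps d (of_real r))"
    using vps_sums[OF dsum, of "of_real r"] r by (intro tendsto_norm) (simp add: sums_def)
  ultimately have "norm (vps d (of_real r)) \<le> sqrt (S / (1 - r\<^sup>2))"
    by (intro LIMSEQ_le_const2) auto
  then have "(norm (vps d (of_real r)))\<^sup>2 \<le> (sqrt (S / (1 - r\<^sup>2)))\<^sup>2"
    by (rule power_mono) simp
  also have "\<dots> = S / (1 - r\<^sup>2)"
    using r2 unfolding S_def by (intro real_sqrt_pow2 divide_nonneg_pos suminf_nonneg pd(2)) auto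
  finally have D: "(norm (vps d (of_real r)))\<^sup>2 \<le> S / (1 - r\<^sup>2)" .
  \<comment> \<open>At \<open>w = r\<close> the multiplier is \<open>1 - r\<^sup>2\<close>. Its
    square outweighs the factor \<open>1 / (1 - r\<^sup>2)\<close> of the evaluation estimate and
    leaves precisely the factor in the Poisson integral.\<close>
  have "vps c (of_real r) = scaleC (of_real (1 - r\<^sup>2)) (vps d (of_real r))"
    using fact[of "of_real r"] r by (simp add: power2_eq_square)
  then have "norm (vps c (of_real r)) = (1 - r\<^sup>2) * norm (vps d (of_real r))"
    using r2 by (simp only: norm_scaleC norm_of_real)
  then have "(norm (vps c (of_real r)))\<^sup>2 = (1 - r\<^sup>2)\<^sup>2 * (norm (vps d (of_real r)))\<^sup>2"
    by (simp add: power_mult_distrib)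
  also have "\<dots> \<le> (1 - r\<^sup>2)\<^sup>2 * (S / (1 - r\<^sup>2))"
    by (intro mult_left_mono D) simp
  also have "\<dots> = (1 - r\<^sup>2) * S"
    using r2 by (simp add: power2_eq_square)
  finally show ?thesis
    unfolding int .
qed

subsection \<open>The radial maximal function\<close>

lemma integral_symmetric_interval:
  fixes f :: "real \<Rightarrow> real"
  assumes "continuous_on UNIV f" "0 \<le> h"
  shows "integral {-h..h} f = integral {0..h} (\<lambda>s. f s + f (- s))"
proof -
  have int: "f integrable_on {a..b}" "(\<lambda>s. f (- s)) integrable_on {a..b}" for a b
    using assms(1) by (auto intro!: integrable_continuous_real continuous_on_compose2[OF assms(1)] continuous_intros
        intro: continuous_on_subset)
  have "integral {-h..h} f = integral {-h..0} f + integral {0..h} f"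
    using assms(2) int by (intro Henstock_Kurzweil_Integration.integral_combine[symmetric]) auto
  also have "integral {-h..0} f = integral {0..h} (\<lambda>s. f (- s))"
    using Henstock_Kurzweil_Integration.integral_reflect_real[where a = 0 and b = h and f = "\<lambda>s. f (- s)"] by simp
  finally show ?thesis
    using int by (simp add: Henstock_Kurzweil_Integration.integral_add add.commute)
qed

text \<open>The second mean value theorem replaces the usual decomposition of the decreasing kernel
  into an average of box kernels.\<close>
lemma poisson_average_le:
  fixes f :: "real \<Rightarrow> real"
  assumes r: "0 \<le> r" "r < 1" and f: "continuous_on UNIV f"
    and avg: "\<And>h. 0 < h \<Longrightarrow> h \<le> 1 / 2 \<Longrightarrow> integral {-h..h} f \<le> 2 * h * \<kappa>"
  shows "integral {-1/2..1/2} (\<lambda>h. poisson r h * f h) \<le> \<kappa>"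
proof -
  \<comment> \<open>Slack of the hypothesis after folding at 0: \<open>avg\<close> says that every
    initial integral of \<open>g\<close> is nonnegative, and the goal becomes nonnegativity of
    \<open>g\<close> integrated against the kernel.\<close>
  define g where "g = (\<lambda>s. 2 * \<kappa> - (f s + f (- s)))"
  have fm: "continuous_on S f" "continuous_on S (\<lambda>s. f (- s))" for S
    using f by (auto intro!: continuous_on_compose2[OF f] continuous_intros intro: continuous_on_subset)
  have g: "continuous_on S g" for S
    unfolding g_def by (intro continuous_intros fm)
  note P = continuous_on_poisson[OF r]
  have \<Psi>: "0 \<le> integral {0..h} g" if "0 \<le> h" "h \<le> 1 / 2" for h
  proof (cases "h = 0")
    case False
    have "integral {0..h} g = integral {0..h} (\<lambda>_. 2 * \<kappa>) - integral {0..h} (\<lambda>s. f s + f (- s))"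
      unfolding g_def by (intro Henstock_Kurzweil_Integration.integral_diff integrable_continuous_real continuous_intros fm)
    also have "\<dots> = 2 * h * \<kappa> - integral {-h..h} f"
      using that by (simp add: integral_symmetric_interval[OF f])
    finally show ?thesis
      using avg[of h] that False by simp
  qed simp
  \<comment> \<open>The theorem is applied to the increasing function \<open>- poisson r\<close>.
    Regrouping at \<open>c\<close> leaves the initial integrals up to \<open>c\<close> and up to
    \<open>1/2\<close> with the weights \<open>poisson r 0 - poisson r (1/2)\<close> and
    \<open>poisson r (1/2)\<close>, both nonnegative.\<close>
  obtain c where c: "c \<in> {0..1/2}" and
    eq: "integral {0..1/2} (\<lambda>x. - poisson r x * g x)
      = - poisson r 0 * integral {0..c} g + - poisson r (1/2) * integral {c..1/2} g"
  proof (rule second_mean_value_theorem[of g 0 "1/2" "\<lambda>x. - poisson r x"])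
    show "g integrable_on {0..1/2}"
      by (intro integrable_continuous_real g)
    show "- poisson r x \<le> - poisson r y" if "0 \<le> x" "x \<le> y" "y \<le> 1 / 2" for x y
      using poisson_antimono[OF r that] by simp
  qed auto
  have split: "integral {0..c} g + integral {c..1/2} g = integral {0..1/2} g"
    using c by (intro Henstock_Kurzweil_Integration.integral_combine integrable_continuous_real g) auto
  have "integral {0..1/2} (\<lambda>x. poisson r x * g x)
      = (poisson r 0 - poisson r (1/2)) * integral {0..c} g + poisson r (1/2) * integral {0..1/2} g"
    using eq by (simp add: algebra_simps flip: split)
  moreover have "poisson r (1/2) \<le> poisson r 0"
    by (rule poisson_antimono[OF r]) auto
  ultimately have nonneg: "0 \<le> integral {0..1/2} (\<lambda>x. poisson r x * g x)"
    using c \<Psi>[of c] \<Psi>[of "1/2"] poisson_nonneg[OF r, of "1/2"] by (auto intro!: add_nonneg_nonneg mult_nonneg_nonneg)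
  have sym: "integral {-1/2..1/2} (\<lambda>h. poisson r h * F h) = integral {0..1/2} (\<lambda>s. poisson r s * (F s + F (- s)))"
    if "continuous_on UNIV F" for F
    using integral_symmetric_interval[of "\<lambda>h. poisson r h * F h" "1/2"] that P
    by (simp add: poisson_minus algebra_simps continuous_on_mult)
  have P1: "integral {-1/2..1/2} (poisson r) = 1"
    using has_integral_poisson[OF r] by (simp add: has_integral_iff)
  have "integral {0..1/2} (\<lambda>x. poisson r x * g x)
      = integral {0..1/2} (\<lambda>s. poisson r s * (\<kappa> + \<kappa>) - poisson r s * (f s + f (- s)))"
    by (simp add: g_def algebra_simps)
  also have "\<dots> = integral {0..1/2} (\<lambda>s. poisson r s * (\<kappa> + \<kappa>)) - integral {0..1/2} (\<lambda>s. poisson r s * (f s + f (- s)))"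
    by (intro Henstock_Kurzweil_Integration.integral_diff integrable_continuous_real continuous_intros P fm)
  also have "\<dots> = integral {-1/2..1/2} (\<lambda>h. poisson r h * \<kappa>) - integral {-1/2..1/2} (\<lambda>h. poisson r h * f h)"
    using sym[of "\<lambda>_. \<kappa>"] by (simp only: sym[OF f] continuous_on_const)
  also have "\<dots> = \<kappa> - integral {-1/2..1/2} (\<lambda>h. poisson r h * f h)"
    using P1 by simp
  finally show ?thesis
    using nonneg by simp
qed

text \<open>Reading integrals of \<open>\<phi>\<close> as values of a measure gives countable
  additivity over the disjoint balls of the covering argument.\<close>

lemma emeasure_density_Icc:
  fixes \<phi> :: "real \<Rightarrow> real"
  assumes "continuous_on UNIV \<phi>" "\<And>t. 0 \<le> \<phi> t"
  shows "emeasure (density lborel (\<lambda>t. ennreal (\<phi> t))) {a..b} = ennreal (integral {a..b} \<phi>)"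
proof -
  have "\<phi> \<in> borel_measurable borel"
    using assms(1) by (rule borel_measurable_continuous_onI)
  then have "emeasure (density lborel (\<lambda>t. ennreal (\<phi> t))) {a..b} = (\<integral>\<^sup>+t. ennreal (\<phi> t) * indicator {a..b} t \<partial>lborel)"
    by (intro emeasure_density) auto
  also have "\<dots> = ennreal (integral {a..b} \<phi>)"
    using assms by (intro nn_integral_has_integral_lebesgue')
      (auto intro!: integrable_integral integrable_continuous_real intro: continuous_on_subset)
  finally show ?thesis .
qed

text \<open>Vitali selects disjoint balls whose fivefold enlargements cover the bad points. An
  enlarged ball of original radius \<open>r\<close> has length \<open>10 * r\<close>, below
  \<open>5 / \<kappa>\<close> times the integral over the original ball. Centres in
  \<open>{0..1}\<close> and radii at most \<open>1/2\<close> keep the original balls in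
  \<open>{-1/2..3/2}\<close>. The conclusion offers a measurable superset \<open>U\<close>, so
  measurability of the bad set is left open.\<close>

lemma maximal_weak_type:
  fixes \<phi> :: "real \<Rightarrow> real"
  assumes \<phi>: "continuous_on UNIV \<phi>" "\<And>t. 0 \<le> \<phi> t" and "\<kappa> > 0"
  obtains U where "U \<in> sets lborel" "emeasure lborel U \<le> ennreal (5 / \<kappa> * integral {-1/2..3/2} \<phi>)"
    "{t\<in>{0..1}. \<exists>h. 0 < h \<and> h \<le> 1 / 2 \<and> integral {t-h..t+h} \<phi> > 2 * h * \<kappa>} \<subseteq> U"
proof -
  define S where "S = {t\<in>{0..1}. \<exists>h. 0 < h \<and> h \<le> 1 / 2 \<and> integral {t-h..t+h} \<phi> > 2 * h * \<kappa>}"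
  define \<nu> where "\<nu> = density lborel (\<lambda>t. ennreal (\<phi> t))"
  have "\<forall>t\<in>S. \<exists>h. 0 < h \<and> h \<le> 1 / 2 \<and> integral {t-h..t+h} \<phi> > 2 * h * \<kappa>"
    unfolding S_def by blast
  then obtain r where r: "\<And>t. t \<in> S \<Longrightarrow> 0 < r t" "\<And>t. t \<in> S \<Longrightarrow> r t \<le> 1 / 2"
    "\<And>t. t \<in> S \<Longrightarrow> integral {t - r t..t + r t} \<phi> > 2 * r t * \<kappa>"
    by metis
  obtain C where C: "countable C" "C \<subseteq> S"
     "pairwise (\<lambda>i j. disjnt (cball i (r i)) (cball j (r j))) C"
     "S \<subseteq> (\<Union>i\<in>C. cball i (5 * r i))"
  proof (rule Vitali_covering_lemma_cballs[where K = S and S = S and a = "\<lambda>t. t" and r = r and B = "1 / 2"])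
    show "S \<subseteq> (\<Union>i\<in>S. cball i (r i))"
      using r(1) by fastforce
  qed (use r in auto)
  define I where "I = (\<lambda>k n. if n \<in> to_nat_on C ` C then cball (from_nat_into C n) (k * r (from_nat_into C n)) else {})"
  have I_cases: "(\<exists>t\<in>C. n = to_nat_on C t \<and> (\<forall>k. I k n = cball t (k * r t))) \<or> (\<forall>k. I k n = {})" for n
    using C(1) by (auto simp: I_def)
  have "disjoint_family (I 1)"
    unfolding disjoint_family_on_def
  proof (intro ballI impI)
    fix m n :: nat assume "m \<noteq> n"
    then show "I 1 m \<inter> I 1 n = {}"
      using I_cases[of m] I_cases[of n] C(3) unfolding pairwise_def disjnt_def by fastforce
  qed
  moreover have [measurable]: "I k n \<in> sets borel" for k n
    by (auto simp: I_def)
  ultimately have "(\<Sum>n. emeasure \<nu> (I 1 n)) = emeasure \<nu> (\<Union>n. I 1 n)"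
    by (intro suminf_emeasure) (auto simp: \<nu>_def)
  also have "\<dots> \<le> emeasure \<nu> {-1/2..3/2}"
  proof (rule emeasure_mono)
    have "I 1 n \<subseteq> {-1/2..3/2}" for n
    proof -
      have "cball t (r t) \<subseteq> {-1/2..3/2}" if "t \<in> C" for t
      proof -
        have "t \<in> S"
          using that C(2) by blast
        then have "0 \<le> t" "t \<le> 1" "r t \<le> 1 / 2"
          using r(2) by (auto simp: S_def)
        then show ?thesis
          by (auto simp: cball_eq_atLeastAtMost)
      qed
      then show ?thesis
        using I_cases[of n] by (metis empty_subsetI mult_1)
    qed
    then show "(\<Union>n. I 1 n) \<subseteq> {-1/2..3/2}"
      by blast
  qed (simp add: \<nu>_def)
  also have "\<dots> = ennreal (integral {-1/2..3/2} \<phi>)"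
    unfolding \<nu>_def by (rule emeasure_density_Icc[OF \<phi>])
  finally have total: "(\<Sum>n. emeasure \<nu> (I 1 n)) \<le> ennreal (integral {-1/2..3/2} \<phi>)" .
  have each: "emeasure lborel (I 5 n) \<le> ennreal (5 / \<kappa>) * emeasure \<nu> (I 1 n)" for n
    using I_cases[of n]
  proof
    assume "\<exists>t\<in>C. n = to_nat_on C t \<and> (\<forall>k. I k n = cball t (k * r t))"
    then obtain t where t: "t \<in> S" "\<And>k. I k n = cball t (k * r t)"
      using C(2) by blast
    have "emeasure lborel (I 5 n) = ennreal (10 * r t)"
      using r(1)[OF t(1)] by (simp add: t(2) cball_eq_atLeastAtMost)
    also have "\<dots> \<le> ennreal (5 / \<kappa> * integral {t - r t..t + r t} \<phi>)"
    proof (rule ennreal_leI)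
      have "10 * r t = 5 / \<kappa> * (2 * r t * \<kappa>)"
        using \<open>\<kappa> > 0\<close> by simp
      also have "\<dots> \<le> 5 / \<kappa> * integral {t - r t..t + r t} \<phi>"
        using r(3)[OF t(1)] \<open>\<kappa> > 0\<close> by (intro mult_left_mono) auto
      finally show "10 * r t \<le> 5 / \<kappa> * integral {t - r t..t + r t} \<phi>" .
    qed
    also have "\<dots> = ennreal (5 / \<kappa>) * ennreal (integral {t - r t..t + r t} \<phi>)"
      using \<open>\<kappa> > 0\<close> by (intro ennreal_mult') auto
    also have "ennreal (integral {t - r t..t + r t} \<phi>) = emeasure \<nu> (I 1 n)"
      by (simp add: t(2) cball_eq_atLeastAtMost \<nu>_def emeasure_density_Icc[OF \<phi>])
    finally show ?thesis .
  qed simp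
  have "emeasure lborel (\<Union>n. I 5 n) \<le> (\<Sum>n. emeasure lborel (I 5 n))"
    by (rule emeasure_subadditive_countably) auto
  also have "\<dots> \<le> (\<Sum>n. ennreal (5 / \<kappa>) * emeasure \<nu> (I 1 n))"
    by (intro suminf_le each) auto
  also have "\<dots> = ennreal (5 / \<kappa>) * (\<Sum>n. emeasure \<nu> (I 1 n))"
    by simp
  also have "\<dots> \<le> ennreal (5 / \<kappa>) * ennreal (integral {-1/2..3/2} \<phi>)"
    by (intro mult_left_mono total) simp
  also have "\<dots> = ennreal (5 / \<kappa> * integral {-1/2..3/2} \<phi>)"
    using \<open>\<kappa> > 0\<close> by (intro ennreal_mult'[symmetric]) auto
  finally have "emeasure lborel (\<Union>n. I 5 n) \<le> ennreal (5 / \<kappa> * integral {-1/2..3/2} \<phi>)" .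
  moreover have "S \<subseteq> (\<Union>n. I 5 n)"
  proof
    fix t assume "t \<in> S"
    then obtain i where i: "i \<in> C" "t \<in> cball i (5 * r i)"
      using C(4) by blast
    then have "I 5 (to_nat_on C i) = cball i (5 * r i)"
      using C(1) by (simp add: I_def)
    with i show "t \<in> (\<Union>n. I 5 n)"
      by blast
  qed
  ultimately show ?thesis
    using that[of "\<Union>n. I 5 n"] by (simp add: S_def)
qed

text \<open>At a point outside the exceptional set all symmetric averages of the boundary function
  are at most \<open>\<kappa>\<close>. Its Poisson integrals are then at most
  \<open>\<kappa>\<close> too, and they dominate the squared norm on the whole radius.\<close>

lemma radial_maximal_interior:
  fixes a :: "nat \<Rightarrow> 'a::chilbert_space"
  assumes a: "summable (\<lambda>n. norm (a n))" and "\<kappa> > 0"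
  defines "V \<equiv> {t\<in>{0..1}. \<exists>r. 0 \<le> r \<and> r < 1 \<and> (norm (vps a (of_real r * ucirc t)))\<^sup>2 > \<kappa>}"
  shows "V \<in> sets lborel" "emeasure lborel V \<le> ennreal (10 / \<kappa> * (\<Sum>n. (norm (a n))\<^sup>2))"
proof -
  have cont: "continuous_on S (\<lambda>t. (norm (vps a (of_real r * ucirc t)))\<^sup>2)" if "0 \<le> r" "r \<le> 1" for r S
    using that by (intro continuous_intros continuous_on_vps_comp a) (auto simp: norm_mult)
  \<comment> \<open>An uncountable union over radii is still measurable, since each member is open
    by continuity.\<close>
  have "V = {0..1} \<inter> (\<Union>r\<in>{0..<1}. {t. \<kappa> < (norm (vps a (of_real r * ucirc t)))\<^sup>2})"
    unfolding V_def by auto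
  moreover have "open (\<Union>r\<in>{0..<1}. {t. \<kappa> < (norm (vps a (of_real r * ucirc t)))\<^sup>2})"
    by (intro open_UN ballI open_Collect_less continuous_intros cont) auto
  ultimately show V: "V \<in> sets lborel"
    by simp
  define \<phi> where "\<phi> = (\<lambda>t. (norm (vps a (ucirc t)))\<^sup>2)"
  have \<phi>: "continuous_on S \<phi>" for S
    using cont[of 1 S] by (simp add: \<phi>_def)
  obtain U where U: "U \<in> sets lborel" "emeasure lborel U \<le> ennreal (5 / \<kappa> * integral {-1/2..3/2} \<phi>)"
    "{t\<in>{0..1}. \<exists>h. 0 < h \<and> h \<le> 1 / 2 \<and> integral {t-h..t+h} \<phi> > 2 * h * \<kappa>} \<subseteq> U"
    by (rule maximal_weak_type[OF \<phi> _ \<open>\<kappa> > 0\<close>]) (auto simp: \<phi>_def)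
  have "V \<subseteq> U"
  proof (rule subsetI, rule ccontr)
    fix t assume t: "t \<in> V" "t \<notin> U"
    obtain r where r: "0 \<le> r" "r < 1" "(norm (vps a (of_real r * ucirc t)))\<^sup>2 > \<kappa>"
      using t(1) unfolding V_def by blast
    \<comment> \<open>Rotation by \<open>t\<close>, so that the Poisson estimate applies at the real
      point \<open>r\<close>.\<close>
    define c where "c = (\<lambda>n. scaleC (ucirc t ^ n) (a n))"
    have vps_c: "vps c w = vps a (w * ucirc t)" for w
      by (simp add: vps_def c_def scaleC_scaleC power_mult_distrib)
    have c: "summable (\<lambda>n. norm (c n))"
      using a by (simp add: c_def norm_scaleC norm_power)
    have "\<not> integral {t-h..t+h} \<phi> > 2 * h * \<kappa>" if "0 < h" "h \<le> 1 / 2" for h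
      using t U(3) that unfolding V_def by blast
    then have "integral {-h..h} (\<lambda>s. \<phi> (t + s)) \<le> 2 * h * \<kappa>" if "0 < h" "h \<le> 1 / 2" for h
      using that integral_shift_Icc_real[of "-h" h \<phi> t] by (force simp: o_def add.commute)
    then have "integral {-1/2..1/2} (\<lambda>h. poisson r h * \<phi> (t + h)) \<le> \<kappa>"
      by (intro poisson_average_le r continuous_on_compose2[OF \<phi>[of UNIV]] continuous_intros) auto
    moreover have "\<phi> (t + h) = (norm (vps c (ucirc h)))\<^sup>2" for h
      by (simp add: \<phi>_def vps_c ucirc_add mult.commute)
    ultimately have "(norm (vps c (of_real r)))\<^sup>2 \<le> \<kappa>"
      using poisson_subharmonic[OF c r(1,2)] by simp
    with r(3) show False
      by (simp add: vps_c)
  qed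
  \<comment> \<open>The interval holds exactly two periods, which doubles the covering constant 5 to
    10.\<close>
  have "integral {-1/2..1/2} \<phi> + integral {1/2..3/2} \<phi> = integral {-1/2..3/2} \<phi>"
    by (intro Henstock_Kurzweil_Integration.integral_combine integrable_continuous_real \<phi>) auto
  moreover have "integral {-1/2..1/2} \<phi> = (\<Sum>n. (norm (a n))\<^sup>2)" "integral {1/2..3/2} \<phi> = (\<Sum>n. (norm (a n))\<^sup>2)"
    using vps_parseval(1)[OF a, of "-1/2"] vps_parseval(1)[OF a, of "1/2"]
    by (auto simp: \<phi>_def has_integral_iff)
  ultimately have "5 / \<kappa> * integral {-1/2..3/2} \<phi> = 10 / \<kappa> * (\<Sum>n. (norm (a n))\<^sup>2)"
    by simp
  then show "emeasure lborel V \<le> ennreal (10 / \<kappa> * (\<Sum>n. (norm (a n))\<^sup>2))"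
    using emeasure_mono[OF \<open>V \<subseteq> U\<close> U(1)] U(2) by (metis order_trans)
qed

lemma summable_norm_scaled_if_square_summable:
  fixes a :: "nat \<Rightarrow> 'a::complex_inner"
  assumes "summable (\<lambda>n. (norm (a n))\<^sup>2)" "0 \<le> \<rho>" "\<rho> < 1"
  shows "summable (\<lambda>n. norm (scaleC (of_real \<rho> ^ n) (a n)))"
proof -
  obtain B where B: "\<And>n. (norm (a n))\<^sup>2 \<le> B"
    using summable_imp_bounded[OF assms(1)] by (auto simp: bounded_iff)
  have "norm (a n) \<le> sqrt B" for n
    by (rule real_le_rsqrt[OF B])
  then show ?thesis
    using assms(2,3)
    by (intro summable_comparison_test'[OF summable_mult2[OF summable_geometric, of \<rho> "sqrt B"], of 0])
       (auto simp: norm_scaleC norm_power intro!: mult_left_mono)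
qed

lemma vps_scaled: "vps (\<lambda>n. scaleC (\<rho> ^ n) (a n)) w = vps a (\<rho> * w)"
  by (simp add: vps_def scaleC_scaleC power_mult_distrib mult.commute)

text \<open>Dilating by \<open>\<rho> k < 1\<close> makes the coefficients absolutely summable
  without enlarging their squares. The level sets of the dilates increase to \<open>V\<close>, and
  continuity of measure from below preserves the constant.\<close>

lemma radial_maximal:
  fixes a :: "nat \<Rightarrow> 'a::chilbert_space"
  assumes a: "summable (\<lambda>n. (norm (a n))\<^sup>2)" and "\<kappa> > 0"
  defines "V \<equiv> {t\<in>{0..1}. \<exists>r. 0 \<le> r \<and> r < 1 \<and> (norm (vps a (of_real r * ucirc t)))\<^sup>2 > \<kappa>}"
  shows "V \<in> sets lborel" "emeasure lborel V \<le> ennreal (10 / \<kappa> * (\<Sum>n. (norm (a n))\<^sup>2))"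
proof -
  define \<rho> where "\<rho> = (\<lambda>k. 1 - 1 / (real k + 1))"
  have \<rho>: "0 \<le> \<rho> k" "\<rho> k < 1" for k
    by (simp_all add: \<rho>_def)
  have \<rho>_mono: "\<rho> k \<le> \<rho> l" if "k \<le> l" for k l
    using that by (simp add: \<rho>_def frac_le)
  define b where "b = (\<lambda>k n. scaleC (of_real (\<rho> k) ^ n) (a n))"
  have b: "summable (\<lambda>n. norm (b k n))" for k
    unfolding b_def by (rule summable_norm_scaled_if_square_summable[OF a \<rho>])
  define W where "W = (\<lambda>k. {t\<in>{0..1}. \<exists>r. 0 \<le> r \<and> r < 1 \<and> (norm (vps (b k) (of_real r * ucirc t)))\<^sup>2 > \<kappa>})"
  \<comment> \<open>Radii are rescaled by \<open>\<rho> k\<close>. Since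
    \<open>\<rho> 0 = 0\<close>, index 0 is excluded, which is why \<open>Suc k\<close> appears
    below.\<close>
  have W_iff: "t \<in> W k \<longleftrightarrow> t \<in> {0..1} \<and> (\<exists>r. 0 \<le> r \<and> r < \<rho> k \<and> (norm (vps a (of_real r * ucirc t)))\<^sup>2 > \<kappa>)"
    if "k > 0" for t k
  proof -
    have pos: "\<rho> k > 0"
      using that by (simp add: \<rho>_def)
    have "(\<exists>r. 0 \<le> r \<and> r < 1 \<and> (norm (vps a (of_real (\<rho> k) * (of_real r * ucirc t))))\<^sup>2 > \<kappa>)
       \<longleftrightarrow> (\<exists>r. 0 \<le> r \<and> r < \<rho> k \<and> (norm (vps a (of_real r * ucirc t)))\<^sup>2 > \<kappa>)" (is "?L \<longleftrightarrow> ?R")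
    proof
      assume ?L
      then obtain r where "0 \<le> r" "r < 1" "(norm (vps a (of_real (\<rho> k) * (of_real r * ucirc t))))\<^sup>2 > \<kappa>"
        by blast
      with pos show ?R
        by (intro exI[of _ "\<rho> k * r"]) (auto simp: mult.assoc)
    next
      assume ?R
      then obtain r where "0 \<le> r" "r < \<rho> k" "(norm (vps a (of_real r * ucirc t)))\<^sup>2 > \<kappa>"
        by blast
      with pos show ?L
        by (intro exI[of _ "r / \<rho> k"]) (auto simp: mult.assoc[symmetric])
    qed
    then show ?thesis
      by (simp add: W_def b_def vps_scaled)
  qed
  have W: "W k \<in> sets lborel" for k
    unfolding W_def by (rule radial_maximal_interior(1)[OF b \<open>\<kappa> > 0\<close>])
  have "(\<Sum>n. (norm (b k n))\<^sup>2) \<le> (\<Sum>n. (norm (a n))\<^sup>2)" for k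
  proof (rule suminf_le)
    show "(norm (b k n))\<^sup>2 \<le> (norm (a n))\<^sup>2" for n
      using \<rho>[of k] by (intro power_mono) (auto simp: b_def norm_scaleC norm_power mult_left_le_one_le power_le_one)
    show "summable (\<lambda>n. (norm (b k n))\<^sup>2)"
      by (rule vps_parseval(2)[OF b])
  qed (rule a)
  then have le: "ennreal (10 / \<kappa> * (\<Sum>n. (norm (b k n))\<^sup>2)) \<le> ennreal (10 / \<kappa> * (\<Sum>n. (norm (a n))\<^sup>2))" for k
    using \<open>\<kappa> > 0\<close> by (intro ennreal_leI mult_left_mono) auto
  have em: "emeasure lborel (W k) \<le> ennreal (10 / \<kappa> * (\<Sum>n. (norm (a n))\<^sup>2))" for k
    unfolding W_def by (rule order_trans[OF radial_maximal_interior(2)[OF b \<open>\<kappa> > 0\<close>] le])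
  have "V = (\<Union>k. W (Suc k))"
  proof (rule set_eqI)
    fix t
    have "\<exists>k. r < \<rho> (Suc k)" if "r < 1" for r
    proof -
      obtain n where "1 / (1 - r) < real n"
        using reals_Archimedean2 by blast
      with that have "1 / (real n + 2) < 1 - r"
        by (simp add: field_simps)
      then show ?thesis
        by (intro exI[of _ n]) (simp add: \<rho>_def add.commute)
    qed
    moreover have "r < 1" if "r < \<rho> k" for r k
      using that \<rho>(2)[of k] by simp
    ultimately show "t \<in> V \<longleftrightarrow> t \<in> (\<Union>k. W (Suc k))"
      unfolding V_def by (auto simp: W_iff) metis+
  qed
  moreover have "incseq (\<lambda>k. W (Suc k))"
    unfolding incseq_def
  proof (intro allI impI subsetI)
    fix m n :: nat and t assume "m \<le> n" "t \<in> W (Suc m)"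
    then show "t \<in> W (Suc n)"
      using \<rho>_mono[of "Suc m" "Suc n"] by (auto simp: W_iff)
  qed
  moreover have "range (\<lambda>k. W (Suc k)) \<subseteq> sets lborel"
    by (intro image_subsetI W)
  ultimately have "emeasure lborel V = (SUP k. emeasure lborel (W (Suc k)))"
    using SUP_emeasure_incseq[of "\<lambda>k. W (Suc k)" lborel] by simp
  also have "\<dots> \<le> ennreal (10 / \<kappa> * (\<Sum>n. (norm (a n))\<^sup>2))"
    by (intro SUP_least em)
  finally show "emeasure lborel V \<le> ennreal (10 / \<kappa> * (\<Sum>n. (norm (a n))\<^sup>2))" .
  show "V \<in> sets lborel"
    unfolding \<open>V = (\<Union>k. W (Suc k))\<close> using W by blast
qed

subsection \<open>Radial limits\<close>

text \<open>Existence of a limit is expressed without naming it, as both the null set argument and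
  the measurability argument need.\<close>

lemma convergent_at_left_iff_Cauchy:
  fixes f :: "real \<Rightarrow> 'a::banach"
  shows "(\<exists>l. (f \<longlongrightarrow> l) (at_left 1)) \<longleftrightarrow>
    (\<forall>e>0. \<exists>b<1. \<forall>r s. b < r \<and> r < 1 \<and> b < s \<and> s < 1 \<longrightarrow> dist (f r) (f s) < e)"
proof
  assume "\<exists>l. (f \<longlongrightarrow> l) (at_left 1)"
  then obtain l where l: "(f \<longlongrightarrow> l) (at_left 1)"
    by blast
  show "\<forall>e>0. \<exists>b<1. \<forall>r s. b < r \<and> r < 1 \<and> b < s \<and> s < 1 \<longrightarrow> dist (f r) (f s) < e"
  proof (intro allI impI)
    fix e :: real assume "e > 0"
    then have "\<forall>\<^sub>F r in at_left 1. dist (f r) l < e / 2"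
      using l by (intro tendstoD) auto
    then obtain b where b: "b < 1" "\<And>r. b < r \<Longrightarrow> r < 1 \<Longrightarrow> dist (f r) l < e / 2"
      unfolding eventually_at_left_field by blast
    then show "\<exists>b<1. \<forall>r s. b < r \<and> r < 1 \<and> b < s \<and> s < 1 \<longrightarrow> dist (f r) (f s) < e"
    proof (intro exI conjI allI impI)
      fix r s assume "b < r \<and> r < 1 \<and> b < s \<and> s < 1"
      then show "dist (f r) (f s) < e"
        by (intro dist_triangle_half_l[OF b(2) b(2)]) auto
    qed (rule b(1))
  qed
next
  assume C: "\<forall>e>0. \<exists>b<1. \<forall>r s. b < r \<and> r < 1 \<and> b < s \<and> s < 1 \<longrightarrow> dist (f r) (f s) < e"
  define X where "X = (\<lambda>n. 1 - 1 / (real n + 2))"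
  have X1: "X n < 1" for n
    by (simp add: X_def)
  have X: "X \<longlonglongrightarrow> 1"
    unfolding X_def by real_asymp
  have ev: "\<forall>\<^sub>F n in sequentially. b < X n" if "b < 1" for b
    using X that by (rule order_tendstoD(1))
  have "Cauchy (\<lambda>n. f (X n))"
  proof (rule metric_CauchyI)
    fix e :: real assume "e > 0"
    then obtain b where b: "b < 1" "\<And>r s. b < r \<Longrightarrow> r < 1 \<Longrightarrow> b < s \<Longrightarrow> s < 1 \<Longrightarrow> dist (f r) (f s) < e"
      using C by blast
    then show "\<exists>M. \<forall>m\<ge>M. \<forall>n\<ge>M. dist (f (X m)) (f (X n)) < e"
      using ev[OF b(1)] X1 unfolding eventually_sequentially by blast
  qed
  then obtain l where l: "(\<lambda>n. f (X n)) \<longlonglongrightarrow> l"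
    by (auto simp: Cauchy_convergent_iff convergent_def)
  have "(f \<longlongrightarrow> l) (at_left 1)"
  proof (rule tendstoI)
    fix e :: real assume "e > 0"
    then obtain b where b: "b < 1" "\<And>r s. b < r \<Longrightarrow> r < 1 \<Longrightarrow> b < s \<Longrightarrow> s < 1 \<Longrightarrow> dist (f r) (f s) < e / 2"
      using C[rule_format, of "e / 2"] by auto
    have "\<forall>\<^sub>F n in sequentially. b < X n \<and> dist (f (X n)) l < e / 2"
      using ev[OF b(1)] tendstoD[OF l, of "e / 2"] \<open>e > 0\<close> by (auto intro: eventually_conj)
    then obtain n where n: "b < X n" "dist (f (X n)) l < e / 2"
      by (auto simp: eventually_sequentially)
    have "dist (f r) l < e" if "b < r" "r < 1" for r
      using b(2)[OF that n(1) X1] n(2) dist_triangle_less_add[of "f r" "f (X n)" "e / 2" l "e / 2"]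
      by (simp add: dist_commute)
    then show "\<forall>\<^sub>F r in at_left 1. dist (f r) l < e"
      using b(1) unfolding eventually_at_left_field by blast
  qed
  then show "\<exists>l. (f \<longlongrightarrow> l) (at_left 1)"
    by blast
qed

lemma vps_split_head:
  fixes a :: "nat \<Rightarrow> 'a::chilbert_space"
  assumes a: "summable (\<lambda>n. (norm (a n))\<^sup>2)" and w: "cmod w < 1"
  shows "vps a w = (\<Sum>n<N. scaleC (w ^ n) (a n)) + vps (\<lambda>n. if n < N then 0 else a n) w"
proof -
  obtain B where B: "\<And>n. (norm (a n))\<^sup>2 \<le> B"
    using summable_imp_bounded[OF a] by (auto simp: bounded_iff)
  have "norm (a n) \<le> sqrt B" for n
    by (rule real_le_rsqrt[OF B])
  then have "summable (\<lambda>n. norm (scaleC (w ^ n) (a n)))"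
    using w by (intro summable_comparison_test'[OF summable_mult2[OF summable_geometric, of "cmod w" "sqrt B"], of 0])
      (auto simp: norm_scaleC norm_power intro!: mult_left_mono)
  then have s: "summable (\<lambda>n. scaleC (w ^ n) (a n))"
    by (rule summable_norm_cancel)
  have "(\<lambda>n. if n < N then scaleC (w ^ n) (a n) else 0) sums (\<Sum>n<N. scaleC (w ^ n) (a n))"
    using sums_If_finite_set[of "{..<N}" "\<lambda>n. scaleC (w ^ n) (a n)"] by simp
  from sums_diff[OF summable_sums[OF s] this]
  have "(\<lambda>n. scaleC (w ^ n) (a n) - (if n < N then scaleC (w ^ n) (a n) else 0))
      sums (vps a w - (\<Sum>n<N. scaleC (w ^ n) (a n)))"
    unfolding vps_def .
  moreover have "(\<lambda>n. scaleC (w ^ n) (a n) - (if n < N then scaleC (w ^ n) (a n) else 0)) =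
      (\<lambda>n. scaleC (w ^ n) (if n < N then 0 else a n))"
    by auto
  ultimately show ?thesis
    by (simp add: vps_def sums_iff)
qed

text \<open>Head and tail: the polynomial head is continuous at the boundary, and the maximal
  function of the tail exceeds a given level only on a set whose measure tends to 0 with the tail
  sum.\<close>

lemma radial_limit_AE:
  fixes a :: "nat \<Rightarrow> 'a::chilbert_space"
  assumes a: "summable (\<lambda>n. (norm (a n))\<^sup>2)"
  shows "AE t in lborel. t \<in> {0..1} \<longrightarrow> (\<exists>l. ((\<lambda>r. vps a (of_real r * ucirc t)) \<longlongrightarrow> l) (at_left 1))"
proof -
  define tl where "tl = (\<lambda>N n. if n < N then 0 else a n)"
  define \<epsilon> where "\<epsilon> = (\<lambda>j. 1 / (real j + 1))"
  have \<epsilon>: "\<epsilon> j > 0" for j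
    by (simp add: \<epsilon>_def)
  define V where "V = (\<lambda>j N. {t\<in>{0..1}. \<exists>r. 0 \<le> r \<and> r < 1 \<and> (norm (vps (tl N) (of_real r * ucirc t)))\<^sup>2 > (\<epsilon> j)\<^sup>2})"
  have tl: "summable (\<lambda>n. (norm (tl N n))\<^sup>2)" for N
    by (rule summable_comparison_test'[OF a, of 0]) (simp add: tl_def)
  have V: "V j N \<in> sets lborel" "emeasure lborel (V j N) \<le> ennreal (10 / (\<epsilon> j)\<^sup>2 * (\<Sum>n. (norm (tl N n))\<^sup>2))" for j N
    using radial_maximal[OF tl, of "(\<epsilon> j)\<^sup>2" N] \<epsilon>[of j] unfolding V_def by auto
  have "(\<lambda>N. \<Sum>n. (norm (tl N n))\<^sup>2) \<longlonglongrightarrow> 0"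
  proof -
    have "(\<Sum>n. (norm (tl N n))\<^sup>2) = (\<Sum>n. (norm (a n))\<^sup>2) - (\<Sum>n<N. (norm (a n))\<^sup>2)" for N
    proof -
      have "(\<lambda>n. if n < N then (norm (a n))\<^sup>2 else 0) sums (\<Sum>n<N. (norm (a n))\<^sup>2)"
        using sums_If_finite_set[of "{..<N}" "\<lambda>n. (norm (a n))\<^sup>2"] by simp
      from sums_diff[OF summable_sums[OF a] this]
      have "(\<lambda>n. (norm (a n))\<^sup>2 - (if n < N then (norm (a n))\<^sup>2 else 0)) sums ((\<Sum>n. (norm (a n))\<^sup>2) - (\<Sum>n<N. (norm (a n))\<^sup>2))" .
      moreover have "(\<lambda>n. (norm (a n))\<^sup>2 - (if n < N then (norm (a n))\<^sup>2 else 0)) = (\<lambda>n. (norm (tl N n))\<^sup>2)"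
        by (auto simp: tl_def)
      ultimately show ?thesis
        by (simp add: sums_iff)
    qed
    moreover have "(\<lambda>N. (\<Sum>n. (norm (a n))\<^sup>2) - (\<Sum>n<N. (norm (a n))\<^sup>2)) \<longlonglongrightarrow> (\<Sum>n. (norm (a n))\<^sup>2) - (\<Sum>n. (norm (a n))\<^sup>2)"
      by (intro tendsto_intros summable_LIMSEQ a)
    ultimately show ?thesis
      by simp
  qed
  then have tail0: "(\<lambda>N. ennreal (10 / (\<epsilon> j)\<^sup>2 * (\<Sum>n. (norm (tl N n))\<^sup>2))) \<longlonglongrightarrow> 0" for j
    using tendsto_ennrealI[OF tendsto_mult_right_zero, of _ _ "10 / (\<epsilon> j)\<^sup>2"] by simp
  \<comment> \<open>Intersecting over \<open>N\<close> suffices: for the Cauchy criterion at level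
    \<open>\<epsilon> j\<close> a point needs just one cut at which its tail stays small along the
    radius.\<close>
  have null: "(\<Inter>N. V j N) \<in> null_sets lborel" for j
  proof (rule null_setsI)
    show meas: "(\<Inter>N. V j N) \<in> sets lborel"
      using V(1) by (intro sets.countable_INT) auto
    have "emeasure lborel (\<Inter>N. V j N) \<le> ennreal (10 / (\<epsilon> j)\<^sup>2 * (\<Sum>n. (norm (tl N n))\<^sup>2))" for N
      using emeasure_mono[of "\<Inter>N. V j N" "V j N" lborel] V[of j N] by (meson INT_lower UNIV_I order_trans)
    then have "emeasure lborel (\<Inter>N. V j N) \<le> 0"
      by (intro LIMSEQ_le_const[OF tail0[of j]]) auto
    then show "emeasure lborel (\<Inter>N. V j N) = 0"
      by simp
  qed
  have "AE t in lborel. \<forall>j. t \<notin> (\<Inter>N. V j N)"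
    unfolding AE_all_countable using AE_not_in[OF null] by blast
  then show ?thesis
  proof (rule AE_mp, intro AE_I2 impI)
    fix t assume t: "\<forall>j. t \<notin> (\<Inter>N. V j N)" "t \<in> {0..1}"
    show "\<exists>l. ((\<lambda>r. vps a (of_real r * ucirc t)) \<longlongrightarrow> l) (at_left 1)"
      unfolding convergent_at_left_iff_Cauchy
    proof (intro allI impI)
      fix e :: real assume "e > 0"
      obtain j where j: "\<epsilon> j < e / 3"
        using reals_Archimedean[of "e / 3"] \<open>e > 0\<close> by (auto simp: \<epsilon>_def inverse_eq_divide add.commute)
      obtain N where N: "t \<notin> V j N"
        using t(1) by blast
      define P where "P = (\<lambda>r. \<Sum>n<N. scaleC ((of_real r * ucirc t) ^ n) (a n))"
      have small: "norm (vps (tl N) (of_real r * ucirc t)) \<le> \<epsilon> j" if "0 \<le> r" "r < 1" for r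
      proof -
        have "(norm (vps (tl N) (of_real r * ucirc t)))\<^sup>2 \<le> (\<epsilon> j)\<^sup>2"
        proof (rule ccontr)
          assume "\<not> (norm (vps (tl N) (of_real r * ucirc t)))\<^sup>2 \<le> (\<epsilon> j)\<^sup>2"
          then have "t \<in> V j N"
            unfolding V_def using that t(2) by (auto intro!: exI[of _ r])
          then show False
            using N by simp
        qed
        then show ?thesis
          by (rule power2_le_imp_le[OF _ less_imp_le[OF \<epsilon>]])
      qed
      have split: "vps a (of_real r * ucirc t) = P r + vps (tl N) (of_real r * ucirc t)" if "0 \<le> r" "r < 1" for r
        unfolding P_def tl_def using that by (intro vps_split_head[OF a]) (simp add: norm_mult)
      have "continuous_on UNIV P"
        unfolding P_def by (intro continuous_on_sum continuous_on_scaleC continuous_intros)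
      then have "isCont P 1"
        by (simp add: continuous_on_eq_continuous_at)
      then have "(P \<longlongrightarrow> P 1) (at_left 1)"
        unfolding isCont_def by (rule filterlim_mono) (auto simp: at_le)
      then obtain b where b: "b < 1" "\<And>r s. b < r \<Longrightarrow> r < 1 \<Longrightarrow> b < s \<Longrightarrow> s < 1 \<Longrightarrow> dist (P r) (P s) < e / 3"
        using convergent_at_left_iff_Cauchy[of P] \<open>e > 0\<close> by (metis divide_pos_pos zero_less_numeral)
      show "\<exists>b<1. \<forall>r s. b < r \<and> r < 1 \<and> b < s \<and> s < 1 \<longrightarrow>
          dist (vps a (of_real r * ucirc t)) (vps a (of_real s * ucirc t)) < e"
      proof (intro exI[of _ "max 0 b"] conjI allI impI)
        fix r s assume rs: "max 0 b < r \<and> r < 1 \<and> max 0 b < s \<and> s < 1"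
        define u v where "u = vps (tl N) (of_real r * ucirc t)" and "v = vps (tl N) (of_real s * ucirc t)"
        have "dist (vps a (of_real r * ucirc t)) (vps a (of_real s * ucirc t)) = norm ((P r - P s) + (u - v))"
          using rs split[of r] split[of s] by (simp only: dist_norm u_def[symmetric] v_def[symmetric]) (simp add: algebra_simps)
        also have "\<dots> \<le> norm (P r - P s) + (norm u + norm v)"
          by (meson add_left_mono norm_triangle_ineq norm_triangle_ineq4 order_trans)
        also have "\<dots> < e"
          using b(2)[of r s] small[of r] small[of s] rs j by (simp add: dist_norm u_def v_def)
        finally show "dist (vps a (of_real r * ucirc t)) (vps a (of_real s * ucirc t)) < e" .
      qed (use b in auto)
    qed
  qed
qed

text \<open>Rationals approach \<open>r\<close> from the right, so continuity carries the bound
  over. It reduces a condition on all radii to countably many.\<close>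

lemma le_on_interval_if_le_on_rationals:
  fixes g :: "real \<Rightarrow> real"
  assumes "continuous_on {a<..<b} g" "\<And>q. a < of_rat q \<Longrightarrow> of_rat q < b \<Longrightarrow> g (of_rat q) \<le> e"
    and "a < r" "r < b"
  shows "g r \<le> e"
proof (rule ccontr)
  assume "\<not> g r \<le> e"
  have "isCont g r"
    using assms continuous_on_interior[of "{a<..<b}" g r] by simp
  then have "(g \<longlongrightarrow> g r) (at_right r)"
    by (simp add: isCont_def filterlim_at_split)
  then have "\<forall>\<^sub>F x in at_right r. e < g x"
    using \<open>\<not> g r \<le> e\<close> by (intro order_tendstoD(1)) auto
  then obtain c where c: "r < c" "\<And>x. r < x \<Longrightarrow> x < c \<Longrightarrow> e < g x"
    unfolding eventually_at_right_field by blast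
  obtain q where "r < of_rat q" "of_rat q < min b c"
    using of_rat_dense[of r "min b c"] c assms by auto
  then show False
    using c(2)[of "of_rat q"] assms(2)[of q] assms(3) by auto
qed

text \<open>Off the set where the limit exists, \<open>Lim\<close> is a fixed arbitrary value, so measurability has to be
  shown for the actual set of convergence (\<open>lborel\<close> is not complete).\<close>
lemma borel_measurable_Lim_at_left:
  fixes f :: "real \<Rightarrow> real \<Rightarrow> complex"
  assumes meas: "\<And>r. 0 < r \<Longrightarrow> r < 1 \<Longrightarrow> f r \<in> borel_measurable borel"
    and cont: "\<And>t. continuous_on {0<..<1} (\<lambda>r. f r t)"
  shows "(\<lambda>t. Lim (at_left 1) (\<lambda>r. f r t)) \<in> borel_measurable borel"
proof -
  \<comment> \<open>Cut off so that measurability holds for every rational radius, also one outside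
    the unit interval.\<close>
  define g where "g = (\<lambda>r t. if 0 < r \<and> r < 1 then f r t else 0)"
  have [measurable]: "g r \<in> borel_measurable borel" for r
    using meas[of r] by (cases "0 < r"; cases "r < 1") (simp_all add: g_def)
  \<comment> \<open>The Cauchy criterion with tolerances, neighbourhoods and radii from countable
    sets, hence Borel.\<close>
  define S where "S = {t. \<forall>k::nat. \<exists>n::nat. \<forall>p q::rat. 1 - 1 / (real n + 1) < of_rat p \<longrightarrow> of_rat p < (1::real) \<longrightarrow>
      1 - 1 / (real n + 1) < of_rat q \<longrightarrow> of_rat q < (1::real) \<longrightarrow> dist (g (of_rat p) t) (g (of_rat q) t) \<le> 1 / (real k + 1)}"
  have S: "S \<in> sets borel"
    unfolding S_def by measurable
  have S_iff: "t \<in> S \<longleftrightarrow> (\<exists>l. ((\<lambda>r. f r t) \<longlongrightarrow> l) (at_left 1))" for t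
  proof
    assume t: "t \<in> S"
    show "\<exists>l. ((\<lambda>r. f r t) \<longlongrightarrow> l) (at_left 1)"
      unfolding convergent_at_left_iff_Cauchy
    proof (intro allI impI)
      fix e :: real assume "e > 0"
      obtain k where k: "1 / (real k + 1) < e"
        using reals_Archimedean[of e] \<open>e > 0\<close> by (auto simp: inverse_eq_divide add.commute)
      obtain n where n: "\<And>p q. 1 - 1 / (real n + 1) < of_rat p \<Longrightarrow> of_rat p < (1::real) \<Longrightarrow>
          1 - 1 / (real n + 1) < of_rat q \<Longrightarrow> of_rat q < (1::real) \<Longrightarrow> dist (g (of_rat p) t) (g (of_rat q) t) \<le> 1 / (real k + 1)"
        using t unfolding S_def by blast
      define b where "b = 1 - 1 / (real n + 1)"
      have b: "0 \<le> b" "b < 1"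
        by (auto simp: b_def)
      have c: "continuous_on {b<..<1} (\<lambda>r. f r t)"
        by (rule continuous_on_subset[OF cont]) (use b in auto)
      have gf: "g x t = f x t" if "b < x" "x < 1" for x
        using that b by (simp add: g_def)
      \<comment> \<open>Passing from rational to real radii is done one variable at a time, by
        continuity in that variable.\<close>
      have 1: "dist (f (of_rat p) t) (f (of_rat q) t) \<le> 1 / (real k + 1)"
        if "b < of_rat p" "of_rat p < (1::real)" "b < of_rat q" "of_rat q < (1::real)" for p q
        using n[of p q, folded b_def, OF that] by (simp only: gf that)
      have 2: "dist (f r t) (f (of_rat q) t) \<le> 1 / (real k + 1)"
        if "b < r" "r < 1" "b < of_rat q" "of_rat q < (1::real)" for r q
        by (rule le_on_interval_if_le_on_rationals[of b 1 "\<lambda>r. dist (f r t) (f (of_rat q) t)"])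
           (use that 1 in \<open>auto intro!: continuous_intros c\<close>)
      have 3: "dist (f r t) (f s t) \<le> 1 / (real k + 1)" if "b < r" "r < 1" "b < s" "s < 1" for r s
        by (rule le_on_interval_if_le_on_rationals[of b 1 "\<lambda>s. dist (f r t) (f s t)"])
           (use that 2 in \<open>auto intro!: continuous_intros c\<close>)
      then show "\<exists>b<1. \<forall>r s. b < r \<and> r < 1 \<and> b < s \<and> s < 1 \<longrightarrow> dist (f r t) (f s t) < e"
        using b k by (intro exI[of _ b]) force
    qed
  next
    assume "\<exists>l. ((\<lambda>r. f r t) \<longlongrightarrow> l) (at_left 1)"
    then have C: "\<forall>e>0. \<exists>b<1. \<forall>r s. b < r \<and> r < 1 \<and> b < s \<and> s < 1 \<longrightarrow> dist (f r t) (f s t) < e"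
      by (simp only: convergent_at_left_iff_Cauchy)
    show "t \<in> S"
      unfolding S_def mem_Collect_eq
    proof
      fix k :: nat
      obtain b where b: "b < 1" "\<And>r s. b < r \<Longrightarrow> r < 1 \<Longrightarrow> b < s \<Longrightarrow> s < 1 \<Longrightarrow> dist (f r t) (f s t) < 1 / (real k + 1)"
        using C[rule_format, of "1 / (real k + 1)"] by auto
      obtain n where "1 / (real n + 1) < 1 - b"
        using reals_Archimedean[of "1 - b"] b(1) by (auto simp: inverse_eq_divide add.commute)
      moreover have "0 \<le> 1 - 1 / (real n + 1)"
        by simp
      ultimately have "0 < x \<and> b < x" if "1 - 1 / (real n + 1) < x" for x
        using that by linarith
      then have *: "g x t = f x t \<and> b < x" if "1 - 1 / (real n + 1) < x" "x < 1" for x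
        using that unfolding g_def by simp
      show "\<exists>n::nat. \<forall>p q::rat. 1 - 1 / (real n + 1) < of_rat p \<longrightarrow> of_rat p < (1::real) \<longrightarrow>
          1 - 1 / (real n + 1) < of_rat q \<longrightarrow> of_rat q < (1::real) \<longrightarrow> dist (g (of_rat p) t) (g (of_rat q) t) \<le> 1 / (real k + 1)"
        by (intro exI[of _ n] allI impI) (use * b(2) in \<open>metis less_imp_le\<close>)
    qed
  qed
  define X where "X = (\<lambda>n. 1 - 1 / (real n + 2))"
  have X01: "0 < X n" "X n < 1" for n
    by (simp_all add: X_def)
  have X: "filterlim X (at_left 1) sequentially"
    unfolding X_def by real_asymp
  \<comment> \<open>Where no limit exists, the description in \<open>Lim\<close> has an
    unsatisfiable predicate; its value is this constant, the same for every such
    \<open>t\<close>.\<close>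
  define c :: complex where "c = (THE l. False)"
  have "Lim (at_left 1) (\<lambda>r. f r t) = (if t \<in> S then lim (\<lambda>n. g (X n) t) else c)" for t
  proof (cases "t \<in> S")
    case True
    then obtain l where l: "((\<lambda>r. f r t) \<longlongrightarrow> l) (at_left 1)"
      using S_iff by blast
    then have "(\<lambda>n. f (X n) t) \<longlonglongrightarrow> l"
      using X by (rule filterlim_compose)
    then have "(\<lambda>n. g (X n) t) \<longlonglongrightarrow> l"
      by (simp add: g_def X01)
    then show ?thesis
      using True tendsto_Lim[OF _ l] by (simp add: limI)
  next
    case False
    then have "((\<lambda>r. f r t) \<longlongrightarrow> l) (at_left 1) \<longleftrightarrow> False" for l
      using S_iff by blast
    then show ?thesis
      using False by (simp add: t2_space_class.Lim_def c_def)
  qed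
  moreover have "(\<lambda>t. if t \<in> S then lim (\<lambda>n. g (X n) t) else c) \<in> borel_measurable borel"
    using S by measurable
  ultimately show ?thesis
    by simp
qed

text \<open>The weights \<open>(1 - \<rho> n) * \<rho> n ^ k\<close> have total mass 1, and every
  term is at least \<open>L\<close>, which gives the lower bound. For the upper bound
  \<open>\<beta> k\<close> is replaced by \<open>\<beta> N\<close>, at a cost of at most
  \<open>\<beta> 0 - \<beta> N\<close> for each of the first \<open>N\<close> indices; the factor
  \<open>1 - \<rho> n\<close> removes that cost in the limit.\<close>

lemma Abel_limit_decseq:
  fixes \<beta> :: "nat \<Rightarrow> real"
  assumes dec: "decseq \<beta>" and lim: "\<beta> \<longlonglongrightarrow> L"
    and \<rho>: "\<And>n. 0 \<le> \<rho> n" "\<And>n. \<rho> n < 1" "\<rho> \<longlonglongrightarrow> 1"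
  shows "(\<lambda>n. (1 - \<rho> n) * (\<Sum>k. \<rho> n ^ k * \<beta> k)) \<longlonglongrightarrow> L"
proof (rule LIMSEQ_I)
  fix e :: real assume "e > 0"
  have \<beta>L: "L \<le> \<beta> k" for k
    using dec lim by (rule decseq_ge)
  have \<beta>0: "\<beta> k \<le> \<beta> 0" for k
    using dec by (simp add: decseqD)
  obtain N where N: "\<beta> N < L + e / 2"
    using order_tendstoD(2)[OF lim, of "L + e / 2"] \<open>e > 0\<close> by (auto simp: eventually_sequentially)
  have geo: "(\<lambda>k. \<rho> n ^ k) sums (1 / (1 - \<rho> n))" for n
    using \<rho>(1,2)[of n] by (intro geometric_sums) simp
  have sm: "summable (\<lambda>k. \<rho> n ^ k * \<beta> k)" for n
  proof (rule summable_comparison_test'[of "\<lambda>k. \<rho> n ^ k * (\<bar>L\<bar> + \<bar>\<beta> 0\<bar>)" 0])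
    show "summable (\<lambda>k. \<rho> n ^ k * (\<bar>L\<bar> + \<bar>\<beta> 0\<bar>))"
      using geo[of n] by (intro summable_mult2) (simp add: sums_iff)
    have "\<bar>\<beta> k\<bar> \<le> \<bar>L\<bar> + \<bar>\<beta> 0\<bar>" for k
      using \<beta>L[of k] \<beta>0[of k] by linarith
    then show "norm (\<rho> n ^ k * \<beta> k) \<le> \<rho> n ^ k * (\<bar>L\<bar> + \<bar>\<beta> 0\<bar>)" for k
      using \<rho>(1)[of n] by (simp add: abs_mult mult_left_mono)
  qed
  have lower: "L \<le> (1 - \<rho> n) * (\<Sum>k. \<rho> n ^ k * \<beta> k)" for n
  proof -
    have "(\<Sum>k. \<rho> n ^ k * L) \<le> (\<Sum>k. \<rho> n ^ k * \<beta> k)"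
      using geo[of n] \<rho>(1)[of n] by (intro suminf_le sm mult_left_mono \<beta>L summable_mult2) (auto simp: sums_iff)
    then have "L / (1 - \<rho> n) \<le> (\<Sum>k. \<rho> n ^ k * \<beta> k)"
      using sums_mult2[OF geo[of n], of L] by (simp add: sums_iff)
    then show ?thesis
      using \<rho>(2)[of n] by (simp add: field_simps)
  qed
  have upper: "(1 - \<rho> n) * (\<Sum>k. \<rho> n ^ k * \<beta> k) \<le> (1 - \<rho> n) * (real N * (\<beta> 0 - \<beta> N)) + \<beta> N" for n
  proof -
    have "(\<lambda>k. if k < N then \<beta> 0 - \<beta> N else 0) sums (\<Sum>k<N. \<beta> 0 - \<beta> N)"
      using sums_If_finite_set[of "{..<N}" "\<lambda>k. \<beta> 0 - \<beta> N"] by simp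
    then have s: "(\<lambda>k. (if k < N then \<beta> 0 - \<beta> N else 0) + \<rho> n ^ k * \<beta> N) sums
        (real N * (\<beta> 0 - \<beta> N) + 1 / (1 - \<rho> n) * \<beta> N)"
      using sums_add[OF _ sums_mult2[OF geo[of n], of "\<beta> N"]] by fastforce
    have "\<rho> n ^ k * \<beta> k \<le> (if k < N then \<beta> 0 - \<beta> N else 0) + \<rho> n ^ k * \<beta> N" for k
    proof (cases "k < N")
      case True
      have "\<rho> n ^ k * (\<beta> k - \<beta> N) \<le> 1 * (\<beta> 0 - \<beta> N)"
        using \<rho>(1,2)[of n] \<beta>0[of k] dec True
        by (intro mult_mono) (auto simp: power_le_one decseq_def)
      with True show ?thesis
        by (simp add: algebra_simps)
    next
      case False
      then show ?thesis
        using \<rho>(1)[of n] dec by (auto simp: decseq_def intro!: mult_left_mono)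
    qed
    then have "(\<Sum>k. \<rho> n ^ k * \<beta> k) \<le> real N * (\<beta> 0 - \<beta> N) + 1 / (1 - \<rho> n) * \<beta> N"
      using s by (metis (no_types, lifting) sm suminf_le sums_iff)
    then have "(1 - \<rho> n) * (\<Sum>k. \<rho> n ^ k * \<beta> k) \<le> (1 - \<rho> n) * (real N * (\<beta> 0 - \<beta> N) + 1 / (1 - \<rho> n) * \<beta> N)"
      using \<rho>(2)[of n] by (intro mult_left_mono) auto
    also have "\<dots> = (1 - \<rho> n) * (real N * (\<beta> 0 - \<beta> N)) + \<beta> N"
      using \<rho>(2)[of n] by (simp add: field_simps)
    finally show ?thesis .
  qed
  have "(\<lambda>n. (1 - \<rho> n) * (real N * (\<beta> 0 - \<beta> N)) + \<beta> N) \<longlonglongrightarrow> (1 - 1) * (real N * (\<beta> 0 - \<beta> N)) + \<beta> N"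
    by (intro tendsto_intros \<rho>(3))
  then have "\<forall>\<^sub>F n in sequentially. (1 - \<rho> n) * (real N * (\<beta> 0 - \<beta> N)) + \<beta> N < L + e"
    using N \<open>e > 0\<close> by (intro order_tendstoD(2)) auto
  then obtain M where M: "\<And>n. n \<ge> M \<Longrightarrow> (1 - \<rho> n) * (real N * (\<beta> 0 - \<beta> N)) + \<beta> N < L + e"
    by (auto simp: eventually_sequentially)
  then show "\<exists>no. \<forall>n\<ge>no. norm ((1 - \<rho> n) * (\<Sum>k. \<rho> n ^ k * \<beta> k) - L) < e"
  proof (intro exI allI impI)
    fix n assume "M \<le> n"
    then show "norm ((1 - \<rho> n) * (\<Sum>k. \<rho> n ^ k * \<beta> k) - L) < e"
      using lower[of n] upper[of n] M[of n] unfolding real_norm_def abs_less_iff by linarith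
  qed
qed

subsection \<open>The curvature\<close>

lemma op_inv_eq_vps:
  fixes T :: "'a::chilbert_space \<Rightarrow> 'a"
  assumes "contraction T" "cmod w < 1"
  shows "op_inv (\<lambda>x. x - scaleC w (T x)) x = vps (\<lambda>n. (T ^^ n) x) w"
  unfolding op_inv_neumann(1)[OF assms] vps_def ..

text \<open>Substituting the resolvent equations of \<open>u\<close> and \<open>v\<close> for
  \<open>x\<close> and \<open>y\<close> turns both sides into the same expression in
  \<open>u\<close>, \<open>v\<close> and \<open>T\<close>.\<close>

lemma cinner_op_inv:
  fixes T :: "'a::chilbert_space \<Rightarrow> 'a"
  assumes T: "contraction T" and w: "cmod w < 1"
  shows "cinner (op_inv (\<lambda>x. x - scaleC w (T x)) x) y = cinner x (op_inv (\<lambda>x. x - scaleC (cnj w) (adj T x)) y)"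
proof -
  have b: "bounded_clinear T"
    using T by (simp add: contraction_def)
  define u where "u = op_inv (\<lambda>x. x - scaleC w (T x)) x"
  define v where "v = op_inv (\<lambda>x. x - scaleC (cnj w) (adj T x)) y"
  have u: "u - scaleC w (T u) = x"
    unfolding u_def by (rule op_inv_neumann(2)[OF T w])
  have v: "v - scaleC (cnj w) (adj T v) = y"
    unfolding v_def using w by (intro op_inv_neumann(2) contraction_adj T) simp
  have "cinner u y = cinner x v"
    unfolding u[symmetric] v[symmetric]
    by (simp add: cinner_diff_left cinner_diff_right cinner_scaleC_left cinner_scaleC_right cinner_adj[OF b])
  then show ?thesis
    by (simp add: u_def v_def)
qed

text \<open>The operator is the adjoint of \<open>R \<circ> defect T\<close> composed with
  \<open>R \<circ> defect T\<close>, so its matrix entries are inner products. Its range lies in the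
  span of \<open>B\<close>, so expanding there writes it as a finite sum of rank one
  operators.\<close>

lemma trace_defect_resolvent:
  fixes T :: "'a::chilbert_space \<Rightarrow> 'a"
  assumes T: "contraction T" and w: "cmod w < 1"
    and B: "finite B" "orthonormal B" "range (defect T) \<subseteq> cspan B"
  shows "trace (defect T \<circ> op_inv (\<lambda>x. x - scaleC (cnj w) (adj T x)) \<circ> op_inv (\<lambda>x. x - scaleC w (T x)) \<circ> defect T)
    = of_real (\<Sum>b\<in>B. (norm (op_inv (\<lambda>x. x - scaleC w (T x)) (defect T b)))\<^sup>2)"
proof -
  define R where "R = op_inv (\<lambda>x. x - scaleC w (T x))"
  define R' where "R' = op_inv (\<lambda>x. x - scaleC (cnj w) (adj T x))"
  define A where "A = defect T \<circ> R' \<circ> R \<circ> defect T"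
  have RR': "cinner (R x) y = cinner x (R' y)" for x y
    unfolding R_def R'_def by (rule cinner_op_inv[OF T w])
  have AR: "cinner x (A y) = cinner (R (defect T x)) (R (defect T y))" for x y
    by (simp add: A_def RR' flip: defect_contraction(2)[OF T])
  have AL: "cinner (A x) y = cinner (R (defect T x)) (R (defect T y))" for x y
    using AR[of y x] cinner_commute[of "A x" y] cinner_commute[of "R (defect T x)" "R (defect T y)"] by simp
  have "A y = (\<Sum>b\<in>B. scaleC (cinner (A b) y) b)" for y
  proof -
    have "A y \<in> cspan B"
      using B(3) by (auto simp: A_def)
    then have "A y = (\<Sum>b\<in>B. scaleC (cinner b (A y)) b)"
      by (rule orthonormal_expand[OF B(2,1)])
    then show ?thesis
      by (simp only: AL AR)
  qed
  then have "trace A = (\<Sum>b\<in>B. cinner (A b) b)"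
    by (rule trace_finite_rank)
  also have "\<dots> = of_real (\<Sum>b\<in>B. (norm (R (defect T b)))\<^sup>2)"
    by (simp only: AL cinner_self of_real_sum)
  finally show ?thesis
    unfolding A_def R_def R'_def .
qed

text \<open>Cyclicity of the trace by hand: \<open>1 - T (adj T)\<close> is the square of the
  defect. One factor is expanded in \<open>B\<close>, and the other stays inside
  \<open>G\<close>.\<close>

lemma trace_funpow_defect:
  fixes T :: "'a::chilbert_space \<Rightarrow> 'a"
  assumes T: "contraction T" and B: "finite B" "orthonormal B" "range (defect T) \<subseteq> cspan B"
  shows "trace ((adj T ^^ n) \<circ> (T ^^ n) \<circ> (\<lambda>x. x - T (adj T x))) = of_real (\<Sum>b\<in>B. (norm ((T ^^ n) (defect T b)))\<^sup>2)"
proof -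
  define G where "G = (\<lambda>x. (adj T ^^ n) ((T ^^ n) (defect T x)))"
  have bT: "bounded_clinear T" "bounded_clinear (defect T)"
    using T by (auto simp: contraction_def defect_contraction(1))
  have bG: "bounded_clinear G"
    unfolding G_def
    by (intro bounded_clinear_compose[OF contraction_funpow_linear[OF contraction_adj[OF T]]]
        bounded_clinear_compose[OF contraction_funpow_linear[OF T]] bT)
  have "G (defect T y) = (\<Sum>b\<in>B. scaleC (cinner (defect T b) y) (G b))" for y
  proof -
    have "defect T y = (\<Sum>b\<in>B. scaleC (cinner (defect T b) y) b)"
      using orthonormal_expand[OF B(2,1), of "defect T y"] B(3) by (auto simp: defect_contraction(2)[OF T])
    then have "G (defect T y) = G (\<Sum>b\<in>B. scaleC (cinner (defect T b) y) b)"
      by (rule arg_cong)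
    then show ?thesis
      by (simp add: bounded_clinearD[OF bG])
  qed
  moreover have "((adj T ^^ n) \<circ> (T ^^ n) \<circ> (\<lambda>x. x - T (adj T x))) y = G (defect T y)" for y
    by (simp add: G_def flip: defect_contraction(3)[OF T])
  ultimately have "trace ((adj T ^^ n) \<circ> (T ^^ n) \<circ> (\<lambda>x. x - T (adj T x))) = (\<Sum>b\<in>B. cinner (defect T b) (G b))"
    by (intro trace_finite_rank) simp
  also have "\<dots> = (\<Sum>b\<in>B. of_real ((norm ((T ^^ n) (defect T b)))\<^sup>2))"
    by (simp only: G_def cinner_adj_funpow[OF bT(1), symmetric] cinner_self)
  finally show ?thesis
    by simp
qed

text \<open>The partial sums telescope to a difference of squared norms bounded by
  \<open>(norm x)\<^sup>2\<close>. It is applied to \<open>T\<close> and also to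
  \<open>adj T\<close>.\<close>

lemma summable_norm_defect_sq:
  fixes T :: "'a::chilbert_space \<Rightarrow> 'a"
  assumes T: "contraction T"
  shows "summable (\<lambda>n. (norm (defect T ((adj T ^^ n) x)))\<^sup>2)"
proof (rule bounded_imp_summable)
  fix n
  have "(\<Sum>k\<le>n. (norm (defect T ((adj T ^^ k) x)))\<^sup>2) = (norm x)\<^sup>2 - (norm ((adj T ^^ Suc n) x))\<^sup>2"
    by (induction n) (simp_all add: norm_defect_sq[OF T])
  then show "(\<Sum>k\<le>n. (norm (defect T ((adj T ^^ k) x)))\<^sup>2) \<le> (norm x)\<^sup>2"
    by simp
qed simp

lemma norm_defect_adj_sq:
  fixes T :: "'a::chilbert_space \<Rightarrow> 'a"
  assumes T: "contraction T"
  shows "(norm (defect (adj T) x))\<^sup>2 = (norm x)\<^sup>2 - (norm (T x))\<^sup>2"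
  using norm_defect_sq[OF contraction_adj[OF T], of x] T by (simp add: adj_adj contraction_def)

lemma vps_bounded_clinear:
  assumes f: "bounded_clinear f" and s: "summable (\<lambda>n. norm (scaleC (w ^ n) (a n)))"
  shows "f (vps a w) = vps (\<lambda>n. f (a n)) w"
  using bounded_linear.sums[OF bounded_clinearD(1)[OF f] summable_sums[OF summable_norm_cancel[OF s]]]
  by (simp add: vps_def bounded_clinearD[OF f] sums_iff)

lemma radial_limit_resolvent_AE:
  fixes T :: "'a::chilbert_space \<Rightarrow> 'a"
  assumes T: "contraction T"
  shows "AE t in lborel. t \<in> {0..1} \<longrightarrow>
    (\<exists>l. ((\<lambda>r. (1 - r\<^sup>2) * (norm (vps (\<lambda>n. (T ^^ n) (defect T f)) (of_real r * ucirc t)))\<^sup>2) \<longlongrightarrow> l) (at_left 1))"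
proof -
  define x where "x = defect T f"
  define D where "D = defect (adj T)"
  have bT: "bounded_clinear T"
    using T by (simp add: contraction_def)
  have bD: "bounded_clinear D"
    unfolding D_def by (rule defect_contraction(1)[OF contraction_adj[OF T]])
  have bC: "bounded_clinear (cinner x)"
    by (rule bounded_clinearI[where K = "norm x"])
      (simp_all add: cinner_add_right cinner_scaleC_right scaleC_complex_def cinner_norm_le)
  have D: "summable (\<lambda>n. (norm (D ((T ^^ n) x)))\<^sup>2)"
    using summable_norm_defect_sq[OF contraction_adj[OF T]] by (simp add: D_def adj_adj[OF bT])
  have C: "summable (\<lambda>n. (norm (cinner x ((T ^^ n) x)))\<^sup>2)"
  proof (rule summable_comparison_test'[of _ 0])
    show "summable (\<lambda>n. (norm (defect T ((adj T ^^ n) x)))\<^sup>2 * (norm f)\<^sup>2)"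
      by (intro summable_mult2 summable_norm_defect_sq T)
    fix n
    \<comment> \<open>This is where \<open>x = defect T f\<close> matters: the outer defect moves to
      the other side, which leaves a square summable sequence paired with the fixed vector
      \<open>f\<close>.\<close>
    have "cinner ((T ^^ n) x) x = cinner f (defect T ((adj T ^^ n) x))"
      by (simp add: cinner_adj_funpow[OF bT] x_def defect_contraction(2)[OF T])
    then have "norm (cinner x ((T ^^ n) x)) = norm (cinner f (defect T ((adj T ^^ n) x)))"
      using cinner_commute[of x "(T ^^ n) x"] by simp
    also have "\<dots> \<le> norm (defect T ((adj T ^^ n) x)) * norm f"
      using cinner_norm_le[of f "defect T ((adj T ^^ n) x)"] by (simp add: mult.commute)
    finally show "norm ((norm (cinner x ((T ^^ n) x)))\<^sup>2) \<le> (norm (defect T ((adj T ^^ n) x)))\<^sup>2 * (norm f)\<^sup>2"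
      by (simp add: power_mono flip: power_mult_distrib)
  qed
  \<comment> \<open>The resolvent equation gives \<open>scaleC w (T u) = u - x\<close>. Taking
    squared norms and eliminating \<open>norm (T u)\<close> through \<open>D\<close> isolates the
    weighted norm.\<close>
  have eq: "(1 - r\<^sup>2) * (norm (vps (\<lambda>n. (T ^^ n) x) (of_real r * ucirc t)))\<^sup>2 =
      2 * Re (vps (\<lambda>n. cinner x ((T ^^ n) x)) (of_real r * ucirc t)) - (norm x)\<^sup>2
      - r\<^sup>2 * (norm (vps (\<lambda>n. D ((T ^^ n) x)) (of_real r * ucirc t)))\<^sup>2" if r: "0 < r" "r < 1" for r t
  proof -
    define w where "w = of_real r * ucirc t"
    have w: "cmod w = r" "cmod w < 1"
      using r by (auto simp: w_def norm_mult)
    define u where "u = vps (\<lambda>n. (T ^^ n) x) w"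
    have "u - scaleC w (T u) = x"
      unfolding u_def using op_inv_neumann(2)[OF T w(2), of x] by (simp add: op_inv_eq_vps[OF T w(2)])
    then have "scaleC w (T u) = u - x"
      by (metis add_diff_cancel_left' diff_add_cancel)
    then have "(norm (scaleC w (T u)))\<^sup>2 = (norm u)\<^sup>2 - 2 * Re (cinner u x) + (norm x)\<^sup>2"
      by (simp add: norm_diff_sq)
    moreover have "(norm (scaleC w (T u)))\<^sup>2 = r\<^sup>2 * (norm (T u))\<^sup>2"
      by (simp add: norm_scaleC w power_mult_distrib)
    moreover have "r\<^sup>2 * (norm (D u))\<^sup>2 = r\<^sup>2 * (norm u)\<^sup>2 - r\<^sup>2 * (norm (T u))\<^sup>2"
      unfolding D_def norm_defect_adj_sq[OF T] by (rule right_diff_distrib)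
    moreover have "Re (cinner u x) = Re (cinner x u)"
      using cinner_commute[of u x] by simp
    ultimately have "(1 - r\<^sup>2) * (norm u)\<^sup>2 = 2 * Re (cinner x u) - (norm x)\<^sup>2 - r\<^sup>2 * (norm (D u))\<^sup>2"
      by (simp add: left_diff_distrib)
    moreover have "cinner x u = vps (\<lambda>n. cinner x ((T ^^ n) x)) w" "D u = vps (\<lambda>n. D ((T ^^ n) x)) w"
      unfolding u_def by (rule vps_bounded_clinear[OF bC summable_neumann[OF T w(2)]],
        rule vps_bounded_clinear[OF bD summable_neumann[OF T w(2)]])
    ultimately show ?thesis
      by (simp add: u_def w_def)
  qed
  show ?thesis
    using radial_limit_AE[OF C] radial_limit_AE[OF D]
  proof (rule AE_mp[OF _ AE_mp[OF _ AE_I2]], intro impI)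
    fix t :: real
    assume "t \<in> {0..1} \<longrightarrow> (\<exists>l. ((\<lambda>r. vps (\<lambda>n. cinner x ((T ^^ n) x)) (of_real r * ucirc t)) \<longlongrightarrow> l) (at_left 1))"
      "t \<in> {0..1} \<longrightarrow> (\<exists>l. ((\<lambda>r. vps (\<lambda>n. D ((T ^^ n) x)) (of_real r * ucirc t)) \<longlongrightarrow> l) (at_left 1))"
      "t \<in> {0..1}"
    then obtain l m where
      "((\<lambda>r. vps (\<lambda>n. cinner x ((T ^^ n) x)) (of_real r * ucirc t)) \<longlongrightarrow> l) (at_left 1)"
      "((\<lambda>r. vps (\<lambda>n. D ((T ^^ n) x)) (of_real r * ucirc t)) \<longlongrightarrow> m) (at_left 1)"
      by blast
    then have "((\<lambda>r. 2 * Re (vps (\<lambda>n. cinner x ((T ^^ n) x)) (of_real r * ucirc t)) - (norm x)\<^sup>2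
      - r\<^sup>2 * (norm (vps (\<lambda>n. D ((T ^^ n) x)) (of_real r * ucirc t)))\<^sup>2)
      \<longlongrightarrow> 2 * Re l - (norm x)\<^sup>2 - 1\<^sup>2 * (norm m)\<^sup>2) (at_left 1)"
      by (intro tendsto_intros)
    moreover have "\<forall>\<^sub>F r in at_left 1. 0 < r \<and> r < (1::real)"
      unfolding eventually_at_left_field by (rule exI[of _ 0]) auto
    ultimately have "((\<lambda>r. (1 - r\<^sup>2) * (norm (vps (\<lambda>n. (T ^^ n) x) (of_real r * ucirc t)))\<^sup>2)
      \<longlongrightarrow> 2 * Re l - (norm x)\<^sup>2 - 1\<^sup>2 * (norm m)\<^sup>2) (at_left 1)"
      by (elim Lim_transform_eventually) (auto elim!: eventually_mono simp: eq)
    then show "\<exists>l. ((\<lambda>r. (1 - r\<^sup>2) * (norm (vps (\<lambda>n. (T ^^ n) (defect T f)) (of_real r * ucirc t)))\<^sup>2) \<longlongrightarrow> l) (at_left 1)"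
      unfolding x_def by blast
  qed
qed

text \<open>Duality: with \<open>v\<close> the adjoint resolvent at \<open>y\<close>, the square of
  \<open>norm y\<close> is the pairing of \<open>f\<close> with \<open>defect T v\<close>. It
  remains to bound \<open>(1 - r\<^sup>2) * (norm (defect T v))\<^sup>2\<close> by
  \<open>(norm y)\<^sup>2\<close>, where the gap is a perfect square. The resulting bound serves as
  the dominating constant.\<close>

lemma norm_resolvent_defect_le:
  fixes T :: "'a::chilbert_space \<Rightarrow> 'a"
  assumes T: "contraction T" and w: "cmod w < 1"
  shows "(1 - (cmod w)\<^sup>2) * (norm (op_inv (\<lambda>x. x - scaleC w (T x)) (defect T f)))\<^sup>2 \<le> (norm f)\<^sup>2"
proof -
  define y where "y = op_inv (\<lambda>x. x - scaleC w (T x)) (defect T f)"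
  define v where "v = op_inv (\<lambda>x. x - scaleC (cnj w) (adj T x)) y"
  define r where "r = cmod w"
  have r: "0 \<le> r" "r < 1"
    using w by (auto simp: r_def)
  have r2: "0 < 1 - r\<^sup>2"
    using r by (simp add: power2_eq_square mult_strict_mono'[of r 1 r 1, simplified])
  have v: "v - scaleC (cnj w) (adj T v) = y"
    unfolding v_def using w by (intro op_inv_neumann(2) contraction_adj T) simp
  have Tv: "norm (adj T v) \<le> norm v"
    using contraction_adj[OF T] by (simp add: contraction_def)
  have "norm v - r * norm (adj T v) \<le> norm y"
    using norm_triangle_ineq2[of v "scaleC (cnj w) (adj T v)"] by (simp add: v norm_scaleC r_def)
  moreover have "0 \<le> norm v - r * norm (adj T v)"
    using Tv r mult_left_le_one_le[of "norm (adj T v)" r] by simp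
  ultimately have "(norm v - r * norm (adj T v))\<^sup>2 \<le> (norm y)\<^sup>2"
    by (rule power_mono)
  moreover have "(norm v - r * norm (adj T v))\<^sup>2 - (1 - r\<^sup>2) * ((norm v)\<^sup>2 - (norm (adj T v))\<^sup>2)
      = (r * norm v - norm (adj T v))\<^sup>2"
    by (simp add: power2_eq_square algebra_simps)
  ultimately have Dv: "(1 - r\<^sup>2) * (norm (defect T v))\<^sup>2 \<le> (norm y)\<^sup>2"
    using zero_le_power2[of "r * norm v - norm (adj T v)"] unfolding norm_defect_sq[OF T] by linarith
  have "cinner y y = cinner f (defect T v)"
    using cinner_op_inv[OF T w, of "defect T f" y]
    by (simp add: v_def y_def[symmetric] defect_contraction(2)[OF T])
  then have "complex_of_real ((norm y)\<^sup>2) = cinner f (defect T v)"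
    by (simp only: cinner_self)
  then have "(norm y)\<^sup>2 = cmod (cinner f (defect T v))"
    by (metis norm_of_real abs_of_nonneg zero_le_power2)
  also have "\<dots> \<le> norm f * norm (defect T v)"
    by (rule cinner_norm_le)
  finally have "((norm y)\<^sup>2)\<^sup>2 \<le> (norm f * norm (defect T v))\<^sup>2"
    by (rule power_mono) simp
  then have "(1 - r\<^sup>2) * ((norm y)\<^sup>2)\<^sup>2 \<le> (1 - r\<^sup>2) * ((norm f)\<^sup>2 * (norm (defect T v))\<^sup>2)"
    using r2 by (intro mult_left_mono) (auto simp: power_mult_distrib)
  also have "\<dots> = (norm f)\<^sup>2 * ((1 - r\<^sup>2) * (norm (defect T v))\<^sup>2)"
    by (simp add: mult_ac)
  also have "\<dots> \<le> (norm f)\<^sup>2 * (norm y)\<^sup>2"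
    by (intro mult_left_mono Dv) simp
  finally have "((1 - r\<^sup>2) * (norm y)\<^sup>2) * (norm y)\<^sup>2 \<le> (norm f)\<^sup>2 * (norm y)\<^sup>2"
    by (simp add: power2_eq_square[of "(norm y)\<^sup>2"] mult.assoc)
  then show ?thesis
    unfolding y_def[symmetric] r_def[symmetric] by (cases "y = 0") auto
qed

section \<open>From the circle integral to limits of norms\<close>

lemma decseq_norm_funpow:
  assumes "contraction T"
  shows "decseq (\<lambda>n. (norm ((T ^^ n) x))\<^sup>2)"
  using assms by (intro decseq_SucI power_mono) (auto simp: contraction_def)

lemma convergent_norm_funpow:
  assumes "contraction T"
  shows "(\<lambda>n. (norm ((T ^^ n) x))\<^sup>2) \<longlonglongrightarrow> lim (\<lambda>n. (norm ((T ^^ n) x))\<^sup>2)"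
  using decseq_convergent[OF decseq_norm_funpow[OF assms], of 0 x] by (metis limI zero_le_power2)

text \<open>The common source of both claims. The span of \<open>B\<close> only has to contain the
  range of the defect, so either the given basis or one from Gram-Schmidt can be inserted.\<close>

lemma curvature_eq:
  fixes T :: "'a::chilbert_space \<Rightarrow> 'a"
  assumes T: "contraction T" and B: "finite B" "orthonormal B" "range (defect T) \<subseteq> cspan B"
  shows "curvature T = of_real (\<Sum>b\<in>B. lim (\<lambda>n. (norm ((T ^^ n) (defect T b)))\<^sup>2))"
proof -
  define a where "a = (\<lambda>b n. (T ^^ n) (defect T b))"
  define g where "g = (\<lambda>r t. \<Sum>b\<in>B. (1 - r\<^sup>2) * (norm (vps (a b) (of_real r * ucirc t)))\<^sup>2)"
  define h where "h = (\<lambda>r t. complex_of_real (1 - r\<^sup>2) *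
             trace (defect T \<circ> op_inv (\<lambda>x. x - scaleC (complex_of_real r * exp (2 * of_real pi * \<i> * complex_of_real t)) (adj T x))
                      \<circ> op_inv (\<lambda>x. x - scaleC (complex_of_real r * cnj (exp (2 * of_real pi * \<i> * complex_of_real t))) (T x)) \<circ> defect T))"
  define \<Lambda> where "\<Lambda> = (\<lambda>t. Lim (at_left 1) (\<lambda>r. h r t))"
  have curv: "curvature T = (LINT t:{0..1}|lborel. \<Lambda> t)"
    unfolding curvature_def \<Lambda>_def h_def Let_def ..
  have h_eq: "h r t = of_real (g r t)" if "0 < r" "r < 1" for r t
  proof -
    have w: "cmod (of_real r * ucirc t) < 1"
      using that by (simp add: norm_mult)
    have "cnj (exp (2 * of_real pi * \<i> * complex_of_real t)) = ucirc t"
      by (simp add: ucirc_def exp_cnj)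
    moreover from this have "exp (2 * of_real pi * \<i> * complex_of_real t) = cnj (ucirc t)"
      by (metis complex_cnj_cnj)
    ultimately have "h r t = of_real (1 - r\<^sup>2) * of_real (\<Sum>b\<in>B. (norm (op_inv (\<lambda>x. x - scaleC (of_real r * ucirc t) (T x)) (defect T b)))\<^sup>2)"
      using trace_defect_resolvent[OF T w B] unfolding h_def by simp
    then show ?thesis
      by (simp add: g_def op_inv_eq_vps[OF T w] a_def sum_distrib_left)
  qed
  have sa: "summable (\<lambda>n. norm (scaleC (of_real r ^ n) (a b n)))" if "0 < r" "r < 1" for r b
    unfolding a_def using that by (intro summable_neumann T) simp
  have cont_t: "continuous_on S (\<lambda>t. (norm (vps (a b) (of_real r * ucirc t)))\<^sup>2)" if "0 < r" "r < 1" for r b S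
    unfolding vps_scaled[symmetric] by (intro continuous_intros continuous_on_vps_comp sa that) simp
  have cont_r: "continuous_on {0<..<1} (\<lambda>r. vps (a b) (of_real r * ucirc t))" for b t
  proof -
    have "isCont (\<lambda>r. vps (a b) (of_real r * ucirc t)) r" if r: "0 < r" "r < 1" for r
    proof -
      \<comment> \<open>Dilating by a radius strictly between \<open>r\<close> and 1 gives
        absolutely summable coefficients, so continuity of the series is available on all radii
        below \<open>s\<close>.\<close>
      define s where "s = (r + 1) / 2"
      have s: "0 < s" "s < 1" "r < s"
        using r by (auto simp: s_def)
      have "continuous_on {0<..<s} (\<lambda>r. vps (\<lambda>n. scaleC (of_real s ^ n) (a b n)) (of_real (r / s) * ucirc t))"
        using s by (intro continuous_on_vps_comp sa continuous_intros) (auto simp: norm_mult norm_divide)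
      then have "continuous_on {0<..<s} (\<lambda>r. vps (a b) (of_real r * ucirc t))"
        by (rule continuous_on_eq) (use s in \<open>simp add: vps_scaled\<close>)
      then show ?thesis
        using r s by (simp add: continuous_on_eq_continuous_at)
    qed
    then show ?thesis
      by (simp add: continuous_on_eq_continuous_at)
  qed
  have cont_g: "continuous_on S (g r)" if "0 < r" "r < 1" for r S
    unfolding g_def using that by (intro continuous_intros cont_t)
  have h_cont: "continuous_on {0<..<1} (\<lambda>r. h r t)" for t
  proof -
    have "continuous_on {0<..<1} (\<lambda>r. complex_of_real (g r t))"
      unfolding g_def by (intro continuous_intros cont_r)
    then show ?thesis
      by (rule continuous_on_eq) (simp add: h_eq)
  qed
  have h_meas: "h r \<in> borel_measurable borel" if "0 < r" "r < 1" for r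
  proof -
    have "continuous_on UNIV (\<lambda>t. complex_of_real (g r t))"
      by (intro continuous_intros cont_g that)
    then have "(\<lambda>t. complex_of_real (g r t)) \<in> borel_measurable borel"
      by (rule borel_measurable_continuous_onI)
    then show ?thesis
      using h_eq[OF that] by (simp cong: measurable_cong)
  qed
  have \<Lambda>_meas: "\<Lambda> \<in> borel_measurable borel"
    unfolding \<Lambda>_def by (rule borel_measurable_Lim_at_left[OF h_meas h_cont])
  have ev01: "\<forall>\<^sub>F r in at_left 1. 0 < r \<and> r < (1::real)"
    unfolding eventually_at_left_field by (rule exI[of _ 0]) auto
  have "AE t in lborel. \<forall>b\<in>B. t \<in> {0..1} \<longrightarrow>
      (\<exists>l. ((\<lambda>r. (1 - r\<^sup>2) * (norm (vps (a b) (of_real r * ucirc t)))\<^sup>2) \<longlongrightarrow> l) (at_left 1))"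
    unfolding a_def by (intro AE_finite_allI B radial_limit_resolvent_AE T)
  then have lim_AE: "AE t in lborel. t \<in> {0..1} \<longrightarrow> ((\<lambda>r. complex_of_real (g r t)) \<longlongrightarrow> \<Lambda> t) (at_left 1)"
  proof (rule AE_mp, intro AE_I2 impI)
    fix t :: real
    assume "\<forall>b\<in>B. t \<in> {0..1} \<longrightarrow>
      (\<exists>l. ((\<lambda>r. (1 - r\<^sup>2) * (norm (vps (a b) (of_real r * ucirc t)))\<^sup>2) \<longlongrightarrow> l) (at_left 1))" "t \<in> {0..1}"
    then obtain l where "\<And>b. b \<in> B \<Longrightarrow>
        ((\<lambda>r. (1 - r\<^sup>2) * (norm (vps (a b) (of_real r * ucirc t)))\<^sup>2) \<longlongrightarrow> l b) (at_left 1)"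
      by metis
    then have g: "((\<lambda>r. complex_of_real (g r t)) \<longlongrightarrow> of_real (\<Sum>b\<in>B. l b)) (at_left 1)"
      unfolding g_def by (intro tendsto_of_real tendsto_sum)
    \<comment> \<open>\<open>h\<close> and \<open>g\<close> were identified only for
      \<open>0 < r < 1\<close>, which is all that the limit from the left sees.\<close>
    then have "((\<lambda>r. h r t) \<longlongrightarrow> of_real (\<Sum>b\<in>B. l b)) (at_left 1)"
      by (rule Lim_transform_eventually) (use ev01 in \<open>auto elim!: eventually_mono simp: h_eq\<close>)
    then have "\<Lambda> t = of_real (\<Sum>b\<in>B. l b)"
      unfolding \<Lambda>_def by (intro tendsto_Lim) auto
    with g show "((\<lambda>r. complex_of_real (g r t)) \<longlongrightarrow> \<Lambda> t) (at_left 1)"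
      by simp
  qed
  define X where "X = (\<lambda>n. 1 - 1 / (real n + 2))"
  have X01: "0 < X n" "X n < 1" for n
    by (simp_all add: X_def)
  have X: "filterlim X (at_left 1) sequentially"
    unfolding X_def by real_asymp
  have X1: "X \<longlonglongrightarrow> 1"
    using X by (simp add: filterlim_at)
  have g_bound: "\<bar>g r t\<bar> \<le> (\<Sum>b\<in>B. (norm b)\<^sup>2)" if "0 < r" "r < 1" for r t
  proof -
    have w: "cmod (of_real r * ucirc t) = r" "cmod (of_real r * ucirc t) < 1"
      using that by (auto simp: norm_mult)
    have "g r t \<le> (\<Sum>b\<in>B. (norm b)\<^sup>2)"
      unfolding g_def using norm_resolvent_defect_le[OF T w(2)]
      by (intro sum_mono) (simp add: op_inv_eq_vps[OF T w(2)] w(1) a_def)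
    moreover have "0 \<le> g r t"
      unfolding g_def using that by (intro sum_nonneg mult_nonneg_nonneg) (auto simp: power_le_one)
    ultimately show ?thesis
      by simp
  qed
  \<comment> \<open>The radius runs along the sequence \<open>X\<close>, as dominated convergence is
    stated for sequences; almost everywhere the full radial limit exists, so nothing depends on the
    choice.\<close>
  have "(\<lambda>n. LINT t|lborel. indicator {0..1} t *\<^sub>R complex_of_real (g (X n) t)) \<longlonglongrightarrow> (LINT t|lborel. indicator {0..1} t *\<^sub>R \<Lambda> t)"
  proof (rule integral_dominated_convergence)
    show "(\<lambda>t. indicator {0..1} t *\<^sub>R \<Lambda> t) \<in> borel_measurable lborel"
      using \<Lambda>_meas by simp
    have "(\<lambda>t. complex_of_real (g (X n) t)) \<in> borel_measurable borel" for n
      by (intro borel_measurable_continuous_onI continuous_intros cont_g X01)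
    then show "(\<lambda>t. indicator {0..1} t *\<^sub>R complex_of_real (g (X n) t)) \<in> borel_measurable lborel" for n
      by simp
    show "integrable lborel (\<lambda>t::real. indicator {0..1} t *\<^sub>R (\<Sum>b\<in>B. (norm b)\<^sup>2))"
      by (rule integrable_scaleR_left) (auto intro!: integrable_real_indicator)
    show "AE t in lborel. (\<lambda>n. indicator {0..1} t *\<^sub>R complex_of_real (g (X n) t)) \<longlonglongrightarrow> indicator {0..1} t *\<^sub>R \<Lambda> t"
      using lim_AE
    proof (rule AE_mp, intro AE_I2 impI)
      fix t :: real assume "t \<in> {0..1} \<longrightarrow> ((\<lambda>r. complex_of_real (g r t)) \<longlongrightarrow> \<Lambda> t) (at_left 1)"
      then show "(\<lambda>n. indicator {0..1} t *\<^sub>R complex_of_real (g (X n) t)) \<longlonglongrightarrow> indicator {0..1} t *\<^sub>R \<Lambda> t"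
        using filterlim_compose[OF _ X] by (cases "t \<in> {0..1}") (auto simp del: of_real_sum)
    qed
    show "AE t in lborel. norm (indicator {0..1} t *\<^sub>R complex_of_real (g (X n) t)) \<le> indicator {0..1} t *\<^sub>R (\<Sum>b\<in>B. (norm b)\<^sup>2)" for n
      using g_bound[OF X01(1)[of n] X01(2)[of n]] by (intro AE_I2) (auto simp: indicator_def)
  qed
  then have to_curv: "(\<lambda>n. LINT t:{0..1}|lborel. complex_of_real (g (X n) t)) \<longlonglongrightarrow> curvature T"
    by (simp add: curv set_lebesgue_integral_def)
  have int: "(LINT t:{0..1}|lborel. complex_of_real (g r t)) =
      of_real (\<Sum>b\<in>B. (1 - r\<^sup>2) * (\<Sum>n. (r\<^sup>2) ^ n * (norm (a b n))\<^sup>2))" if "0 < r" "r < 1" for r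
  proof -
    have "set_integrable lborel {0..1} (g r)"
      by (intro borel_integrable_compact[folded set_integrable_def] cont_g that) auto
    from set_borel_integral_eq_integral(2)[OF this]
    have "(LINT t:{0..1}|lborel. g r t) = integral {0..1} (g r)" .
    moreover have "(LINT t:{0..1}|lborel. complex_of_real (g r t)) = of_real (LINT t:{0..1}|lborel. g r t)"
      by (rule set_integral_complex_of_real)
    moreover have "(g r has_integral (\<Sum>b\<in>B. (1 - r\<^sup>2) * (\<Sum>n. (r\<^sup>2) ^ n * (norm (a b n))\<^sup>2))) {0..1}"
      unfolding g_def
    proof (intro has_integral_sum has_integral_mult_right B)
      fix b
      have "(norm (scaleC (of_real r ^ n) (a b n)))\<^sup>2 = (r\<^sup>2) ^ n * (norm (a b n))\<^sup>2" for n
        using that by (simp add: norm_scaleC norm_power power_mult_distrib power_mult[symmetric] mult.commute)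
      then show "((\<lambda>t. (norm (vps (a b) (of_real r * ucirc t)))\<^sup>2) has_integral (\<Sum>n. (r\<^sup>2) ^ n * (norm (a b n))\<^sup>2)) {0..1}"
        using vps_parseval(1)[OF sa[OF that], of b 0] by (simp add: vps_scaled)
    qed
    ultimately show ?thesis
      by (simp add: has_integral_iff)
  qed
  \<comment> \<open>Parseval has turned the integrals into Abel means with parameter
    \<open>(X n)\<^sup>2\<close>.\<close>
  have "(\<lambda>n. \<Sum>b\<in>B. (1 - (X n)\<^sup>2) * (\<Sum>k. ((X n)\<^sup>2) ^ k * (norm (a b k))\<^sup>2))
      \<longlonglongrightarrow> (\<Sum>b\<in>B. lim (\<lambda>n. (norm ((T ^^ n) (defect T b)))\<^sup>2))"
  proof (intro tendsto_sum Abel_limit_decseq)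
    fix b
    show "decseq (\<lambda>k. (norm (a b k))\<^sup>2)"
      unfolding a_def by (rule decseq_norm_funpow[OF T])
    show "(\<lambda>k. (norm (a b k))\<^sup>2) \<longlonglongrightarrow> lim (\<lambda>n. (norm ((T ^^ n) (defect T b)))\<^sup>2)"
      unfolding a_def by (rule convergent_norm_funpow[OF T])
    show "(\<lambda>n. (X n)\<^sup>2) \<longlonglongrightarrow> 1"
      using tendsto_power[OF X1, of 2] by simp
    show "(X n)\<^sup>2 < 1" for n
      using X01[of n] by (simp add: power2_eq_square mult_strict_mono'[of "X n" 1 "X n" 1, simplified])
  qed simp
  then have "(\<lambda>n. LINT t:{0..1}|lborel. complex_of_real (g (X n) t)) \<longlonglongrightarrow>
      of_real (\<Sum>b\<in>B. lim (\<lambda>n. (norm ((T ^^ n) (defect T b)))\<^sup>2))"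
    unfolding int[OF X01] by (rule tendsto_of_real)
  then show ?thesis
    using to_curv LIMSEQ_unique by blast
qed

subsection \<open>Partial isometries\<close>

text \<open>The range of \<open>adj Q\<close> is orthogonal to the kernel of \<open>Q\<close>, where
  \<open>Q\<close> preserves norms and by polarisation inner products; this yields the first
  identity. Contractivity is shown for \<open>adj Q\<close>, which only meets such vectors, and
  passes to \<open>Q\<close> by taking adjoints again, with no orthogonal decomposition of the
  space.\<close>

lemma partial_isometry_adj:
  fixes Q :: "'a::chilbert_space \<Rightarrow> 'a"
  assumes Q: "partial_isometry Q"
  shows "adj Q (Q (adj Q x)) = adj Q x" "contraction Q"
proof -
  have b: "bounded_clinear Q"
    using Q by (simp add: partial_isometry_def)
  note lin = bounded_clinearD[OF b]
  define M where "M = {v. \<forall>y. Q y = 0 \<longrightarrow> cinner y v = 0}"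
  have iso: "norm (Q v) = norm v" if "v \<in> M" for v
    using Q that by (simp add: partial_isometry_def M_def)
  have adj_M: "adj Q x \<in> M" for x
    by (simp add: M_def flip: cinner_adj[OF b])
  have M: "u + v \<in> M" "u - v \<in> M" "scaleC c u \<in> M" if "u \<in> M" "v \<in> M" for u v c
    using that by (auto simp: M_def cinner_add_right cinner_diff_right cinner_scaleC_right)
  have ReQ: "Re (cinner (Q u) (Q v)) = Re (cinner u v)" if "u \<in> M" "v \<in> M" for u v
    using iso[OF M(1)[OF that]] norm_add_sq[of "Q u" "Q v"] norm_add_sq[of u v] iso[OF that(1)] iso[OF that(2)]
    by (simp add: lin)
  have QQ: "cinner (Q u) (Q v) = cinner u v" if "u \<in> M" "v \<in> M" for u v
    using ReQ[OF that] ReQ[OF that(1) M(3)[OF that(2,2), of \<i>]]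
    by (simp add: lin cinner_scaleC_right complex_eq_iff)
  show *: "adj Q (Q (adj Q x)) = adj Q x" for x
  proof -
    define w where "w = adj Q (Q (adj Q x)) - adj Q x"
    have "w \<in> M"
      unfolding w_def by (intro M adj_M)
    then have "cinner w w = 0"
      using QQ[of w "adj Q x"] adj_M unfolding w_def by (simp add: cinner_diff_right flip: cinner_adj[OF b])
    then show ?thesis
      by (simp add: cinner_eq_zero_iff w_def)
  qed
  have "norm (adj Q x) \<le> norm x" for x
  proof (cases "adj Q x = 0")
    case False
    have "complex_of_real ((norm (adj Q x))\<^sup>2) = cinner (Q (adj Q x)) x"
      by (simp add: cinner_adj[OF b] cinner_self)
    then have "(norm (adj Q x))\<^sup>2 = cmod (cinner (Q (adj Q x)) x)"
      by (metis norm_of_real abs_of_nonneg zero_le_power2)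
    also have "\<dots> \<le> norm (adj Q x) * norm x"
      using cinner_norm_le[of "Q (adj Q x)" x] by (simp add: iso[OF adj_M])
    finally show ?thesis
      using False by (simp add: power2_eq_square)
  qed simp
  then have "contraction (adj Q)"
    using bounded_clinearI[of "adj Q" 1] adj_linear[OF b] by (simp add: contraction_def)
  from contraction_adj[OF this] show "contraction Q"
    by (simp add: adj_adj[OF b])
qed

text \<open>By the identity for \<open>adj Q\<close>, this operator is an orthogonal projection, and
  a projection is its own positive square root.\<close>

lemma defect_partial_isometry:
  fixes Q :: "'a::chilbert_space \<Rightarrow> 'a"
  assumes Q: "partial_isometry Q"
  shows "defect Q = (\<lambda>x. x - Q (adj Q x))"
proof -
  have b: "bounded_clinear Q"
    using Q by (simp add: partial_isometry_def)
  note c = partial_isometry_adj(2)[OF Q]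
  show ?thesis
    unfolding defect_def
  proof (rule op_sqrt_eqI[OF contraction_T_adj[OF c]])
    show "bounded_clinear (\<lambda>x. x - Q (adj Q x))"
      using contraction_T_adj(1)[OF c] by (intro bounded_clinear_diff bounded_clinear_id) (simp add: contraction_def)
    show "x - Q (adj Q x) - Q (adj Q (x - Q (adj Q x))) = x - Q (adj Q x)" for x
      using contraction_adj[OF c] partial_isometry_adj(1)[OF Q]
      by (simp add: contraction_def bounded_clinearD(4) bounded_clinearD(5)[OF b])
    show "positive_op (\<lambda>x. x - Q (adj Q x))"
      unfolding positive_op_def
    proof
      fix x
      have "cinner x (x - Q (adj Q x)) = of_real ((norm (defect Q x))\<^sup>2)"
        unfolding norm_defect_sq[OF c] by (simp add: cinner_diff_right cinner_self flip: cinner_adj'[OF b])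
      then show "Im (cinner x (x - Q (adj Q x))) = 0 \<and> 0 \<le> Re (cinner x (x - Q (adj Q x)))"
        by simp
    qed
  qed
qed

theorem theorem2:
  fixes Q T :: "'a::chilbert_space \<Rightarrow> 'a" and e :: "nat \<Rightarrow> 'a" and q :: nat
  shows "(partial_isometry Q \<and> finite_rank (defect Q) \<and>
           inj_on e {1..q} \<and> orthonormal (e ` {1..q}) \<and> cspan (e ` {1..q}) = range (defect Q)
         \<longrightarrow> curvature Q = complex_of_real (\<Sum>k=1..q. lim (\<lambda>n. (norm ((Q ^^ n) (e k)))\<^sup>2)))
       \<and> (contraction T \<and> finite_rank (defect T)
         \<longrightarrow> curvature T = lim (\<lambda>n. trace ((adj T ^^ n) \<circ> (T ^^ n) \<circ> (\<lambda>x. x - T (adj T x)))))"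
proof (intro conjI impI; elim conjE)
  assume Q: "partial_isometry Q" and e: "inj_on e {1..q}" "orthonormal (e ` {1..q})"
    "cspan (e ` {1..q}) = range (defect Q)"
  note c = partial_isometry_adj(2)[OF Q]
  \<comment> \<open>A projection fixes its range, so the defect disappears from the general
    formula.\<close>
  have fix_e: "defect Q (e k) = e k" if "k \<in> {1..q}" for k
  proof -
    have "e k \<in> range (defect Q)"
      unfolding e(3)[symmetric] using that by (intro cspan_superset) auto
    then obtain x where "e k = defect Q x"
      by blast
    moreover have "defect Q (defect Q x) = defect Q x"
      using defect_contraction(3)[OF c, of x] by (simp add: defect_partial_isometry[OF Q])
    ultimately show ?thesis
      by simp
  qed
  have "curvature Q = of_real (\<Sum>b\<in>e ` {1..q}. lim (\<lambda>n. (norm ((Q ^^ n) (defect Q b)))\<^sup>2))"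
    by (rule curvature_eq[OF c _ e(2)]) (use e(3) in auto)
  also have "\<dots> = of_real (\<Sum>k=1..q. lim (\<lambda>n. (norm ((Q ^^ n) (e k)))\<^sup>2))"
    unfolding sum.reindex[OF e(1)] o_def by (simp only: fix_e cong: sum.cong)
  finally show "curvature Q = complex_of_real (\<Sum>k=1..q. lim (\<lambda>n. (norm ((Q ^^ n) (e k)))\<^sup>2))" .
next
  assume T: "contraction T" and "finite_rank (defect T)"
  then obtain B where B: "finite B" "orthonormal B" "range (defect T) \<subseteq> cspan B"
    using finite_rank_orthonormal by blast
  \<comment> \<open>The trace equals this finite sum at every \<open>n\<close>, so the limit in the
    claim genuinely exists and can be taken termwise.\<close>
  have "(\<lambda>n. complex_of_real (\<Sum>b\<in>B. (norm ((T ^^ n) (defect T b)))\<^sup>2)) \<longlonglongrightarrow> curvature T"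
    unfolding curvature_eq[OF T B] by (intro tendsto_of_real tendsto_sum convergent_norm_funpow T)
  then show "curvature T = lim (\<lambda>n. trace ((adj T ^^ n) \<circ> (T ^^ n) \<circ> (\<lambda>x. x - T (adj T x))))"
    unfolding trace_funpow_defect[OF T B] by (rule limI[symmetric])
qed

end
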